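(* Let $\mathbb{K}$ be a field, $n\ge 2$ an integer, and let $m_1,\dots,m_n,p_1,\dots,p_n$ be non-negative integers. For each pair $(i,j)$ with $1\le j\le i\le n$ and $(i,j)\neq(n,1)$ let $A_{ij}\in\mathbb{K}^{m_i\times p_j}$ be given. For $X\in\mathbb{K}^{m_n\times p_1}$ and $i\in\{1,\dots,n\}$ let $H_i(X)$ be the block matrix formed by block rows $i,\dots,n$ and block columns $1,\dots,i$ of the block lower triangular array with blocks $A_{ij}$ and with $X$ in the $(n,1)$ position. Consider the problem: find $X$ such that, for every $i\in\{1,\dots,n\}$, $\operatorname{rank}H_i(X)=\min_{Z\in\mathbb{K}^{m_n\times p_1}}\operatorname{rank}H_i(Z)$. Then this problem always possesses a solution, and all solutions are produced by the Construction described in the context (i.e. for any choice of index sets as in steps 1 and 2, every solution arises as the output for some choice of the free blocks in step 4). In particular, the set of solutions is an affine space (over $\mathbb{K}$, inside $\mathbb{K}^{m_n\times p_1}$) of dimension $$\sum_{1\le i<j\le n}(\alpha_i-\alpha_{i-1})(\beta_{j-1}-\beta_j),$$ where $\alpha_0=0$ and $$\alpha_i=\operatorname{rank}\begin{bmatrix}A_{(i+1)2}&\cdots&A_{(i+1)(i+1)} \\ \vdots&\ddots&\vdots \\ A_{(n-1)2}&\cdots&A_{(n-1)(i+1)} \\ A_{n2}&\cdots&A_{n(i+1)}\end{bmatrix}-\operatorname{rank}\begin{bmatrix}A_{(i+1)2}&\cdots&A_{(i+1)(i+1)} \\ \vdots&\ddots&\vdots \\ A_{(n-1)2}&\cdots&A_{(n-1)(i+1)}\end{bmatrix},\quad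 i\in\{1,\dots,n-1\},$$ $$\beta_j=\operatorname{rank}\begin{bmatrix}A_{j1}&A_{j2}&\cdots&A_{jj} \\ \vdots&\vdots&\ddots&\vdots \\ A_{(n-1)1}&A_{(n-1)2}&\cdots&A_{(n-1)j}\end{bmatrix}-\operatorname{rank}\begin{bmatrix}A_{j2}&\cdots&A_{jj} \\ \vdots&\ddots&\vdots \\ A_{(n-1)2}&\cdots&A_{(n-1)j}\end{bmatrix},\quad j\in\{1,\dots,n\}.$$
   Context: Explicitly, $H_1(X)=\begin{bmatrix} A_{11} \\ A_{21} \\ \vdots \\ X\end{bmatrix}$, $H_2(X)=\begin{bmatrix} A_{21}&A_{22} \\ \vdots&\vdots \\ X&A_{n2}\end{bmatrix}$, $\ldots$, $H_n(X)=\begin{bmatrix} X&A_{n2}&\cdots&A_{nn}\end{bmatrix}$. Conventions. Matrices may have zero rows or columns (and then have rank $0$); a block matrix whose range of block rows or block columns is empty is such an empty matrix. In the matrices defining $\alpha_i$ the block rows are $i+1,\dots,n$ (first matrix) and $i+1,\dots,n-1$ (second matrix), and the block columns are $2,\dots,i+1$; in those defining $\beta_j$ the block rows are $j,\dots,n-1$ and the block columns are $1,\dots,j$ (first matrix) and $2,\dots,j$ (second matrix). For a matrix $M$, $M(\mathcal{I},\mathcal{J})$ is the submatrix with rows in $\mathcal{I}$ and columns in $\mathcal{J}$, a colon denoting all rows or all columns; $\operatorname{Col}$ and $\operatorname{Row}$ denote column space and row space. Construction. 1. Recursively choose sets of column indices of $X$, $\emptyset=\mathcal{L}_n\subseteq\mathcal{L}_{n-1}\subseteq\cdots\subseteq\mathcal{L}_1\subseteq\mathcal{L}_0$,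 where $\mathcal{L}_0$ is the set of all columns of $X$ and, for $i\in\{1,\dots,n-1\}$, $\mathcal{L}_i$ is a minimal set of indices containing $\mathcal{L}_{i+1}$ such that $$\operatorname{Col}\begin{bmatrix}A_{i1}(:,\mathcal{L}_i)&A_{i2}&\cdots&A_{ii} \\ \vdots&\vdots&\ddots&\vdots \\ A_{(n-1)1}(:,\mathcal{L}_i)&A_{(n-1)2}&\cdots&A_{(n-1)i}\end{bmatrix}=\operatorname{Col}\begin{bmatrix}A_{i1}&A_{i2}&\cdots&A_{ii} \\ \vdots&\vdots&\ddots&\vdots \\ A_{(n-1)1}&A_{(n-1)2}&\cdots&A_{(n-1)i}\end{bmatrix}.$$ 2. Recursively choose sets of row indices of $X$, $\emptyset=\mathcal{K}_0\subseteq\mathcal{K}_1\subseteq\cdots\subseteq\mathcal{K}_{n-1}\subseteq\mathcal{K}_n$, where $\mathcal{K}_n$ is the set of all rows of $X$ and, for $i\in\{1,\dots,n-1\}$, $\mathcal{K}_i$ is a minimal set of indices containing $\mathcal{K}_{i-1}$ such that $$\operatorname{Row}\begin{bmatrix}A_{(i+1)2}&\cdots&A_{(i+1)(i+1)} \\ \vdots&\ddots&\vdots \\ A_{(n-1)2}&\cdots&A_{(n-1)(i+1)} \\ A_{n2}(\mathcal{K}_i,:)&\cdots&A_{n(i+1)}(\mathcal{K}_i,:)\end{bmatrix}=\operatorname{Row}\begin{bmatrix}A_{(i+1)2}&\cdots&A_{(i+1)(i+1)} \\ \vdots&\ddots&\vdots \\ A_{(n-1)2}&\cdots&A_{(n-1)(i+1)}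 \\ A_{n2}&\cdots&A_{n(i+1)}\end{bmatrix}.$$ 3. For $i\in\{1,\dots,n\}$ set $\mathcal{I}_i=\mathcal{K}_i\setminus\mathcal{K}_{i-1}$ and $\mathcal{J}_i=\mathcal{L}_{i-1}\setminus\mathcal{L}_i$, and regard $X$ as the block matrix $(X(\mathcal{I}_i,\mathcal{J}_j))_{i,j=1}^n$. 4. Choose the strictly upper triangular blocks $X(\mathcal{I}_i,\mathcal{J}_j)$, $i<j$, arbitrarily. 5. For $i=1,2,\dots,n$ in sequence, set $\overline{\mathcal{L}_i}=\mathcal{L}_0\setminus\mathcal{L}_i=\bigcup_{j=1}^i\mathcal{J}_j$ and let $X(\mathcal{I}_i,\overline{\mathcal{L}_i})$ be the unique minimizer over $Y$ (of the appropriate size) of the rank of $$\begin{bmatrix}A_{i1}(:,\overline{\mathcal{L}_i})&A_{i1}(:,\mathcal{L}_i)&A_{i2}&\cdots&A_{ii} \\ A_{(i+1)1}(:,\overline{\mathcal{L}_i})&A_{(i+1)1}(:,\mathcal{L}_i)&A_{(i+1)2}&\cdots&A_{(i+1)i} \\ \vdots&\vdots&\vdots&\ddots&\vdots \\ A_{(n-1)1}(:,\overline{\mathcal{L}_i})&A_{(n-1)1}(:,\mathcal{L}_i)&A_{(n-1)2}&\cdots&A_{(n-1)i} \\ X(\mathcal{K}_{i-1},\overline{\mathcal{L}_i})&X(\mathcal{K}_{i-1},\mathcal{L}_i)&A_{n2}(\mathcal{K}_{i-1},:)&\cdots&A_{ni}(\mathcal{K}_{i-1},:) \\ Y&X(\mathcal{I}_i,\mathcal{L}_i)&A_{n2}(\mathcal{I}_i,:)&\cdots&A_{ni}(\mathcal{I}_i,:)\end{bmatrix}$$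 (this minimizer exists and is unique). The output is the resulting matrix $X$. *)

theory Defs
  imports "Jordan_Normal_Form.DL_Rank" "Jordan_Normal_Form.DL_Submatrix"
begin

text \<open>
  Block rows and block columns are numbered from 1; the rows and columns inside a matrix are
  numbered from 0, so the row (column) indices of \<open>X\<close> are \<open>{..<m n}\<close> (\<open>{..<p 1}\<close>).
\<close>

definition mrank :: "'a::field mat \<Rightarrow> nat" where
  "mrank M = vec_space.rank (dim_row M) M"

definition Col :: "'a::field mat \<Rightarrow> 'a vec set" where
  "Col M = vec_space.col_space (dim_row M) M"

definition Row :: "'a::field mat \<Rightarrow> 'a vec set" where
  "Row M = vec_space.row_space (dim_col M) M"

definition append_cols :: "'a::zero mat \<Rightarrow> 'a mat \<Rightarrow> 'a mat" where
  "append_cols M N = four_block_mat M N (0\<^sub>m 0 (dim_col M)) (0\<^sub>m 0 (dim_col N))"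

text \<open>
  The first argument is the common number of rows (columns), needed when the list is empty.
\<close>

definition hcat :: "nat \<Rightarrow> 'a::zero mat list \<Rightarrow> 'a mat" where
  "hcat nr Ms = foldr append_cols Ms (0\<^sub>m nr 0)"

definition vcat :: "nat \<Rightarrow> 'a::zero mat list \<Rightarrow> 'a mat" where
  "vcat nc Ms = foldr append_rows Ms (0\<^sub>m 0 nc)"

definition blocks ::
  "(nat \<Rightarrow> nat) \<Rightarrow> (nat \<Rightarrow> nat) \<Rightarrow> nat list \<Rightarrow> nat list \<Rightarrow> (nat \<Rightarrow> nat \<Rightarrow> 'a::zero mat) \<Rightarrow> 'a mat" where
  "blocks m p rs cs B =
     vcat (\<Sum>j\<leftarrow>cs. p j) (map (\<lambda>i. hcat (m i) (map (B i) cs)) rs)"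

definition H ::
  "nat \<Rightarrow> (nat \<Rightarrow> nat) \<Rightarrow> (nat \<Rightarrow> nat) \<Rightarrow> (nat \<Rightarrow> nat \<Rightarrow> 'a::zero mat) \<Rightarrow> nat \<Rightarrow> 'a mat \<Rightarrow> 'a mat" where
  "H n m p A i X =
     blocks m p [i..<Suc n] [1..<Suc i] (\<lambda>k j. if (k, j) = (n, 1) then X else A k j)"

definition is_solution ::
  "nat \<Rightarrow> (nat \<Rightarrow> nat) \<Rightarrow> (nat \<Rightarrow> nat) \<Rightarrow> (nat \<Rightarrow> nat \<Rightarrow> 'a::field mat) \<Rightarrow> 'a mat \<Rightarrow> bool" where
  "is_solution n m p A X \<longleftrightarrow>
     (\<forall>i\<in>{1..n}. is_arg_min (\<lambda>Z. mrank (H n m p A i Z)) (\<lambda>Z. Z \<in> carrier_mat (m n) (p 1)) X)"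

definition col_condition ::
  "nat \<Rightarrow> (nat \<Rightarrow> nat) \<Rightarrow> (nat \<Rightarrow> nat) \<Rightarrow> (nat \<Rightarrow> nat \<Rightarrow> 'a::field mat) \<Rightarrow> nat \<Rightarrow> nat set \<Rightarrow> bool" where
  "col_condition n m p A i S \<longleftrightarrow>
     Col (blocks m (p(1 := card S)) [i..<n] [1..<Suc i]
            (\<lambda>k j. if j = 1 then submatrix (A k 1) UNIV S else A k j))
     = Col (blocks m p [i..<n] [1..<Suc i] A)"

definition row_condition ::
  "nat \<Rightarrow> (nat \<Rightarrow> nat) \<Rightarrow> (nat \<Rightarrow> nat) \<Rightarrow> (nat \<Rightarrow> nat \<Rightarrow> 'a::field mat) \<Rightarrow> nat \<Rightarrow> nat set \<Rightarrow> bool" where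
  "row_condition n m p A i S \<longleftrightarrow>
     Row (blocks (m(n := card S)) p [Suc i..<Suc n] [2..<Suc (Suc i)]
            (\<lambda>k j. if k = n then submatrix (A n j) S UNIV else A k j))
     = Row (blocks m p [Suc i..<Suc n] [2..<Suc (Suc i)] A)"

text \<open>Minimality of index sets is with respect to inclusion.\<close>

definition col_choice ::
  "nat \<Rightarrow> (nat \<Rightarrow> nat) \<Rightarrow> (nat \<Rightarrow> nat) \<Rightarrow> (nat \<Rightarrow> nat \<Rightarrow> 'a::field mat) \<Rightarrow> (nat \<Rightarrow> nat set) \<Rightarrow> bool" where
  "col_choice n m p A L \<longleftrightarrow>
     L n = {} \<and> L 0 = {..<p 1} \<and>
     (\<forall>i\<in>{1..<n}.
        L (Suc i) \<subseteq> L i \<and> L i \<subseteq> L 0 \<and> col_condition n m p A i (L i) \<and>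
        (\<forall>S. L (Suc i) \<subseteq> S \<and> S \<subset> L i \<longrightarrow> \<not> col_condition n m p A i S))"

definition row_choice ::
  "nat \<Rightarrow> (nat \<Rightarrow> nat) \<Rightarrow> (nat \<Rightarrow> nat) \<Rightarrow> (nat \<Rightarrow> nat \<Rightarrow> 'a::field mat) \<Rightarrow> (nat \<Rightarrow> nat set) \<Rightarrow> bool" where
  "row_choice n m p A K \<longleftrightarrow>
     K 0 = {} \<and> K n = {..<m n} \<and>
     (\<forall>i\<in>{1..<n}.
        K (i - 1) \<subseteq> K i \<and> K i \<subseteq> K n \<and> row_condition n m p A i (K i) \<and>
        (\<forall>S. K (i - 1) \<subseteq> S \<and> S \<subset> K i \<longrightarrow> \<not> row_condition n m p A i S))"

definition I_set :: "(nat \<Rightarrow> nat set) \<Rightarrow> nat \<Rightarrow> nat set" where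
  "I_set K i = K i - K (i - 1)"

definition J_set :: "(nat \<Rightarrow> nat set) \<Rightarrow> nat \<Rightarrow> nat set" where
  "J_set L i = L (i - 1) - L i"

definition L_bar :: "(nat \<Rightarrow> nat set) \<Rightarrow> nat \<Rightarrow> nat set" where
  "L_bar L i = L 0 - L i"

definition step_mat ::
  "nat \<Rightarrow> (nat \<Rightarrow> nat) \<Rightarrow> (nat \<Rightarrow> nat) \<Rightarrow> (nat \<Rightarrow> nat \<Rightarrow> 'a::field mat) \<Rightarrow>
   (nat \<Rightarrow> nat set) \<Rightarrow> (nat \<Rightarrow> nat set) \<Rightarrow> 'a mat \<Rightarrow> nat \<Rightarrow> 'a mat \<Rightarrow> 'a mat" where
  "step_mat n m p A L K X i Y =
     vcat (card (L_bar L i) + card (L i) + (\<Sum>j\<leftarrow>[2..<Suc i]. p j))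
       (map (\<lambda>k. hcat (m k)
           ([submatrix (A k 1) UNIV (L_bar L i), submatrix (A k 1) UNIV (L i)]
            @ map (A k) [2..<Suc i])) [i..<n]
        @ [hcat (card (K (i - 1)))
             ([submatrix X (K (i - 1)) (L_bar L i), submatrix X (K (i - 1)) (L i)]
              @ map (\<lambda>j. submatrix (A n j) (K (i - 1)) UNIV) [2..<Suc i]),
           hcat (card (I_set K i))
             ([Y, submatrix X (I_set K i) (L i)]
              @ map (\<lambda>j. submatrix (A n j) (I_set K i) UNIV) [2..<Suc i])])"

text \<open>
  \<open>X\<close> is an output of the construction for the index sets \<open>L\<close>, \<open>K\<close> when the free strictly upper
  triangular blocks are those of \<open>F\<close> (the other entries of \<open>F\<close> are ignored). The matrix of step
  \<open>i\<close> only involves free blocks and the parts of \<open>X\<close> fixed in steps \<open>1, \<dots>, i - 1\<close>, so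
  running the steps in sequence amounts to imposing all of them on the final \<open>X\<close>.
\<close>

definition construction_output ::
  "nat \<Rightarrow> (nat \<Rightarrow> nat) \<Rightarrow> (nat \<Rightarrow> nat) \<Rightarrow> (nat \<Rightarrow> nat \<Rightarrow> 'a::field mat) \<Rightarrow>
   (nat \<Rightarrow> nat set) \<Rightarrow> (nat \<Rightarrow> nat set) \<Rightarrow> 'a mat \<Rightarrow> 'a mat \<Rightarrow> bool" where
  "construction_output n m p A L K F X \<longleftrightarrow>
     X \<in> carrier_mat (m n) (p 1) \<and>
     (\<forall>i j. 1 \<le> i \<and> i < j \<and> j \<le> n \<longrightarrow>
        submatrix X (I_set K i) (J_set L j) = submatrix F (I_set K i) (J_set L j)) \<and>
     (\<forall>i\<in>{1..n}. \<forall>Y.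
        is_arg_min (\<lambda>Y. mrank (step_mat n m p A L K X i Y))
          (\<lambda>Y. Y \<in> carrier_mat (card (I_set K i)) (card (L_bar L i))) Y
        \<longleftrightarrow> Y = submatrix X (I_set K i) (L_bar L i))"

definition alpha ::
  "nat \<Rightarrow> (nat \<Rightarrow> nat) \<Rightarrow> (nat \<Rightarrow> nat) \<Rightarrow> (nat \<Rightarrow> nat \<Rightarrow> 'a::field mat) \<Rightarrow> nat \<Rightarrow> int" where
  "alpha n m p A i =
     (if i = 0 then 0
      else int (mrank (blocks m p [Suc i..<Suc n] [2..<Suc (Suc i)] A))
         - int (mrank (blocks m p [Suc i..<n] [2..<Suc (Suc i)] A)))"

definition beta ::
  "nat \<Rightarrow> (nat \<Rightarrow> nat) \<Rightarrow> (nat \<Rightarrow> nat) \<Rightarrow> (nat \<Rightarrow> nat \<Rightarrow> 'a::field mat) \<Rightarrow> nat \<Rightarrow> int" where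
  "beta n m p A j =
     int (mrank (blocks m p [j..<n] [1..<Suc j] A))
   - int (mrank (blocks m p [j..<n] [2..<Suc j] A))"

definition affine_space_of_dim :: "nat \<Rightarrow> nat \<Rightarrow> 'a::field mat set \<Rightarrow> int \<Rightarrow> bool" where
  "affine_space_of_dim nr nc S d \<longleftrightarrow>
     (\<exists>X0\<in>carrier_mat nr nc. \<exists>W.
        VectorSpace.subspace class_ring W (module_mat TYPE('a) nr nc) \<and>
        S = (\<lambda>M. X0 + M) ` W \<and>
        int (vectorspace.dim class_ring ((module_mat TYPE('a) nr nc)\<lparr>carrier := W\<rparr>)) = d)"

end

theory Submission
  imports Defs "HOL-Library.Function_Algebras"
begin

text \<open>
  Write \<open>H\<^sub>i(X) = [C, D; X, R]\<close> with \<open>C, D\<close> in block rows \<open>i, \<dots>, n - 1\<close> and \<open>R\<close> in block row \<open>n\<close>.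
  By the Fredholm alternative its rank is minimal iff \<open>u X v = t C v\<close> whenever \<open>u R = t D\<close> and
  \<open>C v = D w\<close>. So \<open>X\<close> is prescribed as a bilinear form on \<open>U\<^sub>i \<times> V\<^sub>i\<close>, where
  \<open>U\<^sub>i = {u. u R \<in> Row D}\<close> decreases and \<open>V\<^sub>i = {v. C v \<in> Col D}\<close> increases with \<open>i\<close>, and the
  prescriptions for different \<open>i\<close> agree where they overlap. The index sets \<open>K\<^bsub>i-1\<^esub>\<close> and \<open>L\<^sub>i\<close> of the
  construction are bases of coordinates modulo \<open>U\<^sub>i\<close> and \<open>V\<^sub>i\<close>. In these coordinates the conditions
  become a triangular linear system for the entries of \<open>X\<close> whose free entries are those in the
  strictly upper triangular blocks, and the equations of level \<open>i\<close> are those of step \<open>i\<close>.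
\<close>

section \<open>Column spans and ranks of families indexed by labels\<close>

text \<open>The prescriptions of the different levels overlap, so imposed together they look
  overdetermined. Their consistency is not checked separately. At level \<open>i\<close> only the
  rows in \<open>K i\<close> are kept, because the prescription for the remaining rows follows from
  the one at level \<open>i + 1\<close>. What is left is exactly one equation for each entry outside
  the strictly upper blocks, and such a system is solvable for all data. The lower bound for the
  rank at each level does not involve X, so one X attaining all bounds at once shows that every
  separate minimum equals its bound.

  Ranks and spans are taken for functions on labels (block number, index in the block). The step
  matrices list the rows and columns of a part of \<open>H\<close> in another order, and sets of
  labels do not see the order.\<close>

interpretation fs: vector_space "\<lambda>(c::'a::field) (f::'r \<Rightarrow> 'a) r. c * f r"
  by unfold_locales (auto simp: fun_eq_iff algebra_simps)

text \<open>Extension by zero puts the columns of every submatrix into one space, so a change of the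
  row set does not change the ambient space.\<close>

definition col_fun :: "('r \<Rightarrow> 'c \<Rightarrow> 'a::field) \<Rightarrow> 'r set \<Rightarrow> 'c \<Rightarrow> 'r \<Rightarrow> 'a" where
  "col_fun E R c = (\<lambda>r. if r \<in> R then E r c else 0)"

definition in_col_span :: "('r \<Rightarrow> 'c \<Rightarrow> 'a::field) \<Rightarrow> 'r set \<Rightarrow> 'c set \<Rightarrow> 'c \<Rightarrow> bool" where
  "in_col_span E R C c \<longleftrightarrow> (\<exists>w. \<forall>r\<in>R. E r c = (\<Sum>c'\<in>C. E r c' * w c'))"

definition rk :: "('r \<Rightarrow> 'c \<Rightarrow> 'a::field) \<Rightarrow> 'r set \<Rightarrow> 'c set \<Rightarrow> nat" where
  "rk E R C = fs.dim (col_fun E R ` C)"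

lemma span_col_fun:
  assumes "finite C"
  shows "f \<in> fs.span (col_fun E R ` C) \<longleftrightarrow> (\<exists>w. \<forall>r. f r = (\<Sum>c\<in>C. col_fun E R c r * w c))"
  using assms
proof (induction C arbitrary: f)
  case empty
  then show ?case by (auto simp: fun_eq_iff)
next
  case (insert c C)
  show ?case
  proof
    assume "f \<in> fs.span (col_fun E R ` insert c C)"
    then obtain k where "f - (\<lambda>r. k * col_fun E R c r) \<in> fs.span (col_fun E R ` C)"
      by (auto simp: fs.span_insert)
    then obtain w where w: "\<And>r. f r - k * col_fun E R c r = (\<Sum>c\<in>C. col_fun E R c r * w c)"
      using insert.IH by auto
    have "f r = (\<Sum>x\<in>insert c C. col_fun E R x r * (w(c := k)) x)" for r
    proof -
      have h: "(\<Sum>x\<in>C. col_fun E R x r * (w(c := k)) x) = (\<Sum>x\<in>C. col_fun E R x r * w x)"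
        using insert.hyps by (intro sum.cong) auto
      have "f r = col_fun E R c r * k + (\<Sum>x\<in>C. col_fun E R x r * w x)"
        using w[of r] by (simp add: algebra_simps)
      then show ?thesis unfolding sum.insert[OF insert.hyps(1,2)] h by simp
    qed
    then show "\<exists>w. \<forall>r. f r = (\<Sum>c\<in>insert c C. col_fun E R c r * w c)" by blast
  next
    assume "\<exists>w. \<forall>r. f r = (\<Sum>c\<in>insert c C. col_fun E R c r * w c)"
    then obtain w where w: "\<And>r. f r = (\<Sum>c\<in>insert c C. col_fun E R c r * w c)" by blast
    have "f - (\<lambda>r. w c * col_fun E R c r) \<in> fs.span (col_fun E R ` C)"
      unfolding insert.IH using w insert.hyps by (intro exI[of _ w]) (auto simp: mult.commute)
    then show "f \<in> fs.span (col_fun E R ` insert c C)"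
      by (auto simp: fs.span_insert)
  qed
qed

lemma in_span_col_fun:
  assumes "finite C"
  shows "col_fun E R c \<in> fs.span (col_fun E R ` C) \<longleftrightarrow> in_col_span E R C c"
  unfolding span_col_fun[OF assms] in_col_span_def col_fun_def
  by (intro ex_cong1) (auto intro!: sum.cong split: if_splits)

text \<open>The label type may be infinite, hence the ambient space infinite-dimensional; the
  dimension is therefore counted with a basis chosen inside the finite set \<open>S\<close>.\<close>

lemma fs_dim_insert:
  assumes "finite S"
  shows "fs.dim (insert x S) = (if x \<in> fs.span S then fs.dim S else Suc (fs.dim S))"
proof (cases "x \<in> fs.span S")
  case True
  then have "fs.span (insert x S) = fs.span S" by (rule fs.span_redundant)
  then show ?thesis using True by (metis fs.dim_span)
next
  case False
  obtain B where B: "B \<subseteq> S" "fs.independent B" "S \<subseteq> fs.span B" "card B = fs.dim S"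
    using fs.basis_exists by blast
  have fB: "finite B" using B(1) assms finite_subset by blast
  have sp: "fs.span B = fs.span S"
    by (intro subset_antisym fs.span_mono B fs.span_minimal fs.subspace_span)
  have xB: "x \<notin> fs.span B" using False sp by simp
  then have "x \<notin> B" using fs.span_base by blast
  have "fs.independent (insert x B)"
    using B(2) xB by (simp add: fs.independent_insert)
  moreover have "fs.span (insert x B) = fs.span (insert x S)"
    using sp by (simp add: fs.span_insert)
  ultimately have "fs.dim (insert x S) = card (insert x B)"
    by (metis fs.dim_eq_card)
  then show ?thesis using False fB \<open>x \<notin> B\<close> B(4) by simp
qed

lemma rk_empty [simp]: "rk E R {} = 0"
  by (simp add: rk_def fs.dim_eq_card_independent[OF fs.independent_empty])

lemma rk_insert:
  assumes "finite C"
  shows "rk E R (insert c C) = (if in_col_span E R C c then rk E R C else Suc (rk E R C))"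
  using assms by (simp add: rk_def fs_dim_insert in_span_col_fun)

lemma rk_cong:
  assumes "\<And>r c. r \<in> R \<Longrightarrow> c \<in> C \<Longrightarrow> E r c = E' r c"
  shows "rk E R C = rk E' R C"
proof -
  have "col_fun E R ` C = col_fun E' R ` C"
    using assms by (intro image_cong) (auto simp: col_fun_def)
  then show ?thesis by (simp add: rk_def)
qed

text \<open>Rank factorisation: if the columns in \<open>S\<close> form a basis and \<open>G\<close>
  holds the coefficients of all columns, then every row of \<open>E\<close> is a combination of the
  \<open>card S\<close> functions \<open>\<lambda>c. G c s\<close>.\<close>

lemma rk_transpose_le:
  assumes "finite R" "finite C"
  shows "rk (\<lambda>c r. E r c) C R \<le> rk E R C"
proof -
  obtain B where B: "B \<subseteq> col_fun E R ` C" "fs.independent B" "col_fun E R ` C \<subseteq> fs.span B"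
      "card B = fs.dim (col_fun E R ` C)"
    using fs.basis_exists by blast
  then obtain S where S: "S \<subseteq> C" "inj_on (col_fun E R) S" "B = col_fun E R ` S"
    by (meson subset_image_inj)
  have fS: "finite S" using S(1) assms(2) finite_subset by blast
  have cS: "card S = rk E R C" using B(4) S(2,3) by (simp add: rk_def card_image)
  have "\<forall>c\<in>C. \<exists>w. \<forall>r\<in>R. E r c = (\<Sum>s\<in>S. E r s * w s)"
    using B(3) in_span_col_fun[OF fS, of E R] unfolding S(3) in_col_span_def by blast
  then obtain G where G: "\<And>c r. c \<in> C \<Longrightarrow> r \<in> R \<Longrightarrow> E r c = (\<Sum>s\<in>S. E r s * G c s)"
    by metis
  have sub: "col_fun (\<lambda>c r. E r c) C r \<in> fs.span (col_fun G C ` S)" if "r \<in> R" for r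
    unfolding span_col_fun[OF fS]
    using G that by (intro exI[of _ "E r"]) (auto simp: col_fun_def mult.commute intro!: sum.cong)
  have "rk (\<lambda>c r. E r c) C R \<le> card (col_fun G C ` S)"
    unfolding rk_def using sub fS by (intro fs.dim_le_card) auto
  also have "\<dots> \<le> card S" using fS by (rule card_image_le)
  finally show ?thesis using cS by simp
qed

lemma rk_transpose:
  assumes "finite R" "finite C"
  shows "rk (\<lambda>c r. E r c) C R = rk E R C"
  using rk_transpose_le[OF assms, of E] rk_transpose_le[OF assms(2,1), of "\<lambda>c r. E r c"] by simp

text \<open>Induction over the columns. A column dependent on the earlier ones puts no new
  constraint on the certificate \<open>z\<close>. An independent one admits a functional
  \<open>z1\<close> that is 1 on it and 0 on the earlier ones, and \<open>z1\<close> corrects the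
  certificate.\<close>

lemma Fredholm_alternative:
  fixes E :: "'r \<Rightarrow> 'c \<Rightarrow> 'a::field"
  assumes "finite C" and R: "finite R"
    and "\<not> (\<exists>w. \<forall>r\<in>R. b r = (\<Sum>c\<in>C. E r c * w c))"
  shows "\<exists>z. (\<forall>c\<in>C. (\<Sum>r\<in>R. z r * E r c) = 0) \<and> (\<Sum>r\<in>R. z r * b r) = 1"
  using assms(1,3)
proof (induction C arbitrary: b)
  case empty
  then obtain r where r: "r \<in> R" "b r \<noteq> 0" by auto
  have "(\<Sum>s\<in>R. (if s = r then inverse (b r) else 0) * b s) = 1"
    using r R by (subst sum.remove[of _ r]) (auto intro!: sum.neutral)
  then show ?case by auto
next
  case (insert c C)
  have nC: "\<not> (\<exists>w. \<forall>r\<in>R. b r - k * E r c = (\<Sum>c\<in>C. E r c * w c))" for k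
  proof
    assume "\<exists>w. \<forall>r\<in>R. b r - k * E r c = (\<Sum>c\<in>C. E r c * w c)"
    then obtain w where w: "\<And>r. r \<in> R \<Longrightarrow> b r - k * E r c = (\<Sum>c\<in>C. E r c * w c)" by blast
    have "b r = (\<Sum>x\<in>insert c C. E r x * (w(c := k)) x)" if "r \<in> R" for r
    proof -
      have h: "(\<Sum>x\<in>C. E r x * (w(c := k)) x) = (\<Sum>x\<in>C. E r x * w x)"
        using insert.hyps by (intro sum.cong) auto
      have "b r = E r c * k + (\<Sum>x\<in>C. E r x * w x)"
        using w[OF that] by (simp add: algebra_simps)
      then show ?thesis unfolding sum.insert[OF insert.hyps(1,2)] h by simp
    qed
    with insert.prems show False by blast
  qed
  show ?case
  proof (cases "\<exists>w. \<forall>r\<in>R. E r c = (\<Sum>c\<in>C. E r c * w c)")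
    case True
    then obtain w where w: "\<And>r. r \<in> R \<Longrightarrow> E r c = (\<Sum>c\<in>C. E r c * w c)" by blast
    obtain z where z: "\<And>c. c \<in> C \<Longrightarrow> (\<Sum>r\<in>R. z r * E r c) = 0" "(\<Sum>r\<in>R. z r * b r) = 1"
      using insert.IH[of b] nC[of 0] by auto
    have "(\<Sum>r\<in>R. z r * E r c) = (\<Sum>r\<in>R. \<Sum>x\<in>C. z r * E r x * w x)"
      by (intro sum.cong) (auto simp: w sum_distrib_left mult.assoc)
    also have "\<dots> = (\<Sum>x\<in>C. (\<Sum>r\<in>R. z r * E r x) * w x)"
      by (subst sum.swap) (simp add: sum_distrib_right)
    also have "\<dots> = 0" using z by simp
    finally show ?thesis using z by auto
  next
    case False
    then obtain z1 where z1: "\<And>x. x \<in> C \<Longrightarrow> (\<Sum>r\<in>R. z1 r * E r x) = 0" "(\<Sum>r\<in>R. z1 r * E r c) = 1"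
      using insert.IH[of "\<lambda>r. E r c"] by auto
    \<comment> \<open>Subtracting \<open>k\<close> times column \<open>c\<close> makes
      \<open>z1\<close> vanish on the right-hand side, so the later correction of \<open>z2\<close>
      by a multiple of \<open>z1\<close> keeps the value 1.\<close>
    define k where "k = (\<Sum>r\<in>R. z1 r * b r)"
    obtain z2 where z2: "\<And>x. x \<in> C \<Longrightarrow> (\<Sum>r\<in>R. z2 r * E r x) = 0"
      "(\<Sum>r\<in>R. z2 r * (b r - k * E r c)) = 1"
      using insert.IH[OF nC[of k]] by auto
    define h where "h = (\<Sum>r\<in>R. z2 r * E r c)"
    have entry_lin: "(\<Sum>r\<in>R. (z2 r - h * z1 r) * f r) = (\<Sum>r\<in>R. z2 r * f r) - h * (\<Sum>r\<in>R. z1 r * f r)" for f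
      by (simp add: algebra_simps sum_subtractf sum_distrib_left)
    have "(\<Sum>r\<in>R. z2 r * b r) - k * h = 1"
      using z2(2) by (simp add: h_def algebra_simps sum_subtractf sum_distrib_left)
    then have "(\<Sum>r\<in>R. (z2 r - h * z1 r) * b r) = 1"
      unfolding entry_lin k_def by (simp add: mult.commute)
    moreover have "\<forall>x\<in>insert c C. (\<Sum>r\<in>R. (z2 r - h * z1 r) * E r x) = 0"
      unfolding entry_lin using z1 z2 by (auto simp: h_def)
    ultimately show ?thesis by (intro exI[of _ "\<lambda>r. z2 r - h * z1 r"]) blast
  qed
qed

lemma in_col_span_mono: 
  assumes "finite C'" "C \<subseteq> C'" "R' \<subseteq> R" "in_col_span E R C c"
  shows "in_col_span E R' C' c"
proof -
  obtain w where w: "\<And>r. r \<in> R \<Longrightarrow> E r c = (\<Sum>c'\<in>C. E r c' * w c')"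
    using assms(4) unfolding in_col_span_def by blast
  have "E r c = (\<Sum>c'\<in>C'. E r c' * (if c' \<in> C then w c' else 0))" if "r \<in> R'" for r
  proof -
    have "(\<Sum>c'\<in>C'. E r c' * (if c' \<in> C then w c' else 0)) = (\<Sum>c'\<in>C. E r c' * w c')"
      using assms(1,2) by (intro sum.mono_neutral_cong_right) auto
    then show ?thesis using w that assms(3) by auto
  qed
  then show ?thesis unfolding in_col_span_def by (intro exI[of _ "\<lambda>c'. if c' \<in> C then w c' else 0"]) blast
qed

lemma in_col_span_member:
  assumes "finite C" "c \<in> C"
  shows "in_col_span E R C c"
  using assms by (simp add: in_span_col_fun[symmetric] fs.span_base)

lemma in_col_span_trans:
  assumes "finite C" "finite C'" "in_col_span E R C' c" "\<And>c'. c' \<in> C' \<Longrightarrow> in_col_span E R C c'"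
  shows "in_col_span E R C c"
proof -
  have "col_fun E R ` C' \<subseteq> fs.span (col_fun E R ` C)"
    using assms(1,4) by (auto simp: in_span_col_fun)
  then have "fs.span (col_fun E R ` C') \<subseteq> fs.span (col_fun E R ` C)"
    by (intro fs.span_minimal fs.subspace_span)
  then have "col_fun E R c \<in> fs.span (col_fun E R ` C)"
    using assms(2,3) by (auto simp: in_span_col_fun[symmetric])
  then show ?thesis using assms(1) by (simp add: in_span_col_fun)
qed

lemma span_col_fun_eq_iff:
  assumes "finite C" "finite C'" "C \<subseteq> C'"
  shows "fs.span (col_fun E R ` C) = fs.span (col_fun E R ` C') \<longleftrightarrow> (\<forall>c\<in>C' - C. in_col_span E R C c)"
proof
  assume "fs.span (col_fun E R ` C) = fs.span (col_fun E R ` C')"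
  then have "col_fun E R c \<in> fs.span (col_fun E R ` C)" if "c \<in> C'" for c
    using that by (simp add: fs.span_base)
  then show "\<forall>c\<in>C' - C. in_col_span E R C c"
    using assms(1) by (simp add: in_span_col_fun)
next
  assume *: "\<forall>c\<in>C' - C. in_col_span E R C c"
  then have "in_col_span E R C c" if "c \<in> C'" for c
    using that assms(1) in_col_span_member by (cases "c \<in> C") auto
  then have "col_fun E R ` C' \<subseteq> fs.span (col_fun E R ` C)"
    using assms(1) by (auto simp: in_span_col_fun)
  then show "fs.span (col_fun E R ` C) = fs.span (col_fun E R ` C')"
    using assms(3) by (intro subset_antisym fs.span_minimal fs.subspace_span fs.span_mono) auto
qed

lemma rk_Un:
  assumes "finite N" "finite C"
  shows "rk E R C \<le> rk E R (N \<union> C) \<and> (rk E R (N \<union> C) = rk E R C \<longleftrightarrow> (\<forall>c\<in>N. in_col_span E R C c))"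
  using assms(1)
proof (induction N)
  case (insert x N)
  have step: "rk E R (insert x N \<union> C) =
      (if in_col_span E R (N \<union> C) x then rk E R (N \<union> C) else Suc (rk E R (N \<union> C)))"
    using rk_insert[of "N \<union> C" E R x] insert.hyps(1) assms(2) by simp
  show ?case
  proof (cases "\<forall>c\<in>N. in_col_span E R C c")
    case True
    then have all: "in_col_span E R C c" if "c \<in> N \<union> C" for c
      using that in_col_span_member[OF assms(2)] by auto
    have "in_col_span E R (N \<union> C) x \<longleftrightarrow> in_col_span E R C x"
    proof
      assume "in_col_span E R (N \<union> C) x"
      then show "in_col_span E R C x"
        by (rule in_col_span_trans[rotated 2]) (use all insert.hyps(1) assms(2) in auto)
    next
      assume "in_col_span E R C x"
      then show "in_col_span E R (N \<union> C) x"
        by (rule in_col_span_mono[rotated 3]) (use insert.hyps(1) assms(2) in auto)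
    qed
    then show ?thesis using step insert.IH True by simp
  next
    case False
    then have "rk E R C < rk E R (N \<union> C)" using insert.IH by linarith
    then show ?thesis using step False by auto
  qed
qed auto

section \<open>Linear independence of columns modulo the span of further columns\<close>

definition col_indep :: "('r \<Rightarrow> 'c \<Rightarrow> 'a::field) \<Rightarrow> 'r set \<Rightarrow> 'c set \<Rightarrow> 'c set \<Rightarrow> bool" where
  "col_indep E R L Q \<longleftrightarrow> (\<forall>v w. (\<forall>r\<in>R. (\<Sum>l\<in>L. E r l * v l) = (\<Sum>q\<in>Q. E r q * w q)) \<longrightarrow> (\<forall>l\<in>L. v l = 0))"

lemma col_indepD:
  assumes "col_indep E R L Q" "\<And>r. r \<in> R \<Longrightarrow> (\<Sum>l\<in>L. E r l * v l) = (\<Sum>q\<in>Q. E r q * w q)" "l \<in> L"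
  shows "v l = 0"
  using assms unfolding col_indep_def by blast

lemma col_indep_subset:
  assumes "col_indep E R L Q" "finite L" "L' \<subseteq> L" "finite Q" "Q' \<subseteq> Q" "R \<subseteq> R'"
  shows "col_indep E R' L' Q'"
  unfolding col_indep_def
proof (intro allI impI ballI)
  fix v w l
  assume *: "\<forall>r\<in>R'. (\<Sum>l\<in>L'. E r l * v l) = (\<Sum>q\<in>Q'. E r q * w q)" and l: "l \<in> L'"
  have "(\<Sum>l\<in>L. E r l * (if l \<in> L' then v l else 0)) = (\<Sum>q\<in>Q. E r q * (if q \<in> Q' then w q else 0))"
    if "r \<in> R" for r
  proof -
    have "(\<Sum>l\<in>L. E r l * (if l \<in> L' then v l else 0)) = (\<Sum>l\<in>L'. E r l * v l)"
      using assms(2,3) by (intro sum.mono_neutral_cong_right) auto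
    moreover have "(\<Sum>q\<in>Q. E r q * (if q \<in> Q' then w q else 0)) = (\<Sum>q\<in>Q'. E r q * w q)"
      using assms(4,5) by (intro sum.mono_neutral_cong_right) auto
    ultimately show ?thesis using * that assms(6) by auto
  qed
  from col_indepD[OF assms(1) this, of l] l assms(3) show "v l = 0" by auto
qed

lemma rk_Un_col_indep:
  assumes "finite L" "finite Q" "L \<inter> Q = {}" "col_indep E R L Q"
  shows "rk E R (L \<union> Q) = card L + rk E R Q"
  using assms(1,3,4)
proof (induction L)
  case (insert x L)
  have "\<not> in_col_span E R (L \<union> Q) x"
  proof
    assume "in_col_span E R (L \<union> Q) x"
    then obtain w where w: "\<And>r. r \<in> R \<Longrightarrow> E r x = (\<Sum>c\<in>L \<union> Q. E r c * w c)"
      unfolding in_col_span_def by blast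
    have "(\<Sum>l\<in>insert x L. E r l * (if l = x then 1 else - w l)) = (\<Sum>q\<in>Q. E r q * w q)"
      if "r \<in> R" for r
    proof -
      have "(\<Sum>l\<in>L. E r l * (if l = x then 1 else - w l)) = - (\<Sum>l\<in>L. E r l * w l)"
        using insert.hyps(2) unfolding sum_negf[symmetric] by (intro sum.cong) auto
      moreover have "E r x = (\<Sum>l\<in>L. E r l * w l) + (\<Sum>q\<in>Q. E r q * w q)"
        unfolding w[OF that] using insert.hyps insert.prems assms(2) by (intro sum.union_disjoint) auto
      ultimately show ?thesis using insert.hyps by simp
    qed
    from col_indepD[OF insert.prems(2) this, of x] show False by auto
  qed
  moreover have "col_indep E R L Q"
    using col_indep_subset[OF insert.prems(2)] insert.hyps assms(2) by auto
  ultimately show ?case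
    using rk_insert[of "L \<union> Q" E R x] insert assms(2) by simp
qed simp

text \<open>With \<open>L\<close> a basis of the columns \<open>N\<close> modulo \<open>Q\<close>, a
  rank difference becomes a cardinality; this is how \<open>alpha\<close> and \<open>beta\<close>
  turn into sizes of index sets.\<close>

lemma rk_Un_span_indep:
  assumes "finite N" "finite Q" "N \<inter> Q = {}" "L \<subseteq> N" "col_indep E R L Q"
    and "\<And>l. l \<in> N \<Longrightarrow> in_col_span E R (L \<union> Q) l"
  shows "rk E R (N \<union> Q) = card L + rk E R Q"
proof -
  have fL: "finite L" using assms(1,4) finite_subset by blast
  have "rk E R (N \<union> (L \<union> Q)) = rk E R (L \<union> Q)"
    using rk_Un[of N "L \<union> Q" E R] assms fL by blast
  moreover have "N \<union> (L \<union> Q) = N \<union> Q" using assms(4) by blast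
  moreover have "rk E R (L \<union> Q) = card L + rk E R Q"
    using rk_Un_col_indep[OF fL assms(2) _ assms(5)] assms(3,4) by blast
  ultimately show ?thesis by simp
qed

text \<open>A relation with a nonzero coefficient at \<open>x\<close> in \<open>L - L'\<close> would
  express column \<open>x\<close> by the others, against minimality. So every relation is supported
  on \<open>L'\<close>, and it survives the passage to fewer rows \<open>P'\<close> and more columns
  \<open>Q'\<close>, where independence is known.\<close>

lemma col_indep_of_minimal:
  assumes "finite L" "finite Q'" "L' \<subseteq> L" "P' \<subseteq> P" "Q \<subseteq> Q'" "L \<inter> Q = {}"
    and ind: "col_indep E P' L' Q'"
    and min: "\<And>l. l \<in> L - L' \<Longrightarrow> \<not> in_col_span E P ((L - {l}) \<union> Q) l"
  shows "col_indep E P L Q"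
  unfolding col_indep_def
proof (intro allI impI ballI)
  fix v w l
  assume *: "\<forall>r\<in>P. (\<Sum>l\<in>L. E r l * v l) = (\<Sum>q\<in>Q. E r q * w q)" and l: "l \<in> L"
  have fQ: "finite Q" using assms(2,5) finite_subset by blast
  have z: "v x = 0" if x: "x \<in> L - L'" for x
  proof (rule ccontr)
    assume nz: "v x \<noteq> 0"
    have "E r x = (\<Sum>c\<in>(L - {x}) \<union> Q. E r c * (if c \<in> Q then w c / v x else - v c / v x))"
      if "r \<in> P" for r
    proof -
      have "E r x * v x + (\<Sum>l\<in>L - {x}. E r l * v l) = (\<Sum>q\<in>Q. E r q * w q)"
        using * that sum.remove[OF assms(1), of x "\<lambda>l. E r l * v l"] x by simp
      then have "E r x = - (\<Sum>l\<in>L - {x}. E r l * v l) / v x + (\<Sum>q\<in>Q. E r q * w q) / v x"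
        using nz by (simp add: field_simps eq_neg_iff_add_eq_0) 
      also have "- (\<Sum>l\<in>L - {x}. E r l * v l) / v x = (\<Sum>c\<in>L - {x}. E r c * (if c \<in> Q then w c / v x else - v c / v x))"
        using assms(6) unfolding sum_negf[symmetric] sum_divide_distrib by (intro sum.cong) auto
      also have "(\<Sum>q\<in>Q. E r q * w q) / v x = (\<Sum>c\<in>Q. E r c * (if c \<in> Q then w c / v x else - v c / v x))"
        unfolding sum_divide_distrib by (intro sum.cong) auto
      also have "(\<Sum>c\<in>L - {x}. E r c * (if c \<in> Q then w c / v x else - v c / v x)) + \<dots>
        = (\<Sum>c\<in>(L - {x}) \<union> Q. E r c * (if c \<in> Q then w c / v x else - v c / v x))"
        using assms(1,6) fQ by (intro sum.union_disjoint[symmetric]) auto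
      finally show ?thesis .
    qed
    then have "in_col_span E P ((L - {x}) \<union> Q) x"
      unfolding in_col_span_def by (intro exI[of _ "\<lambda>c. if c \<in> Q then w c / v x else - v c / v x"] ballI)
    then show False using min x by blast
  qed
  have "(\<Sum>l\<in>L'. E r l * v l) = (\<Sum>q\<in>Q'. E r q * (if q \<in> Q then w q else 0))" if "r \<in> P'" for r
  proof -
    have "(\<Sum>l\<in>L. E r l * v l) = (\<Sum>l\<in>L'. E r l * v l)"
      using assms(1,3) z by (intro sum.mono_neutral_cong_right) auto
    moreover have "(\<Sum>q\<in>Q'. E r q * (if q \<in> Q then w q else 0)) = (\<Sum>q\<in>Q. E r q * w q)"
      using assms(2,5) by (intro sum.mono_neutral_cong_right) auto
    ultimately show ?thesis using * that assms(4) by auto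
  qed
  from col_indepD[OF ind this] z l show "v l = 0" by blast
qed

section \<open>Compatibility of the X block as the criterion for minimal rank\<close>

text \<open>Writing \<open>E\<close> on \<open>P \<union> K\<close> and \<open>N \<union> Q\<close> as the block matrix \<open>[C, D; X, R]\<close>, this says that
  \<open>u X v = t C v\<close> whenever \<open>u R = t D\<close> and \<open>C v = D w\<close>.\<close>

definition compatible :: "('r \<Rightarrow> 'c \<Rightarrow> 'a::field) \<Rightarrow> 'r set \<Rightarrow> 'r set \<Rightarrow> 'c set \<Rightarrow> 'c set \<Rightarrow> bool" where
  "compatible E P K N Q \<longleftrightarrow> (\<forall>u t v w.
     (\<forall>q\<in>Q. (\<Sum>k\<in>K. u k * E k q) = (\<Sum>r\<in>P. t r * E r q)) \<longrightarrow>
     (\<forall>r\<in>P. (\<Sum>l\<in>N. E r l * v l) = (\<Sum>q\<in>Q. E r q * w q)) \<longrightarrow>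
     (\<Sum>k\<in>K. u k * (\<Sum>l\<in>N. E k l * v l)) = (\<Sum>r\<in>P. t r * (\<Sum>l\<in>N. E r l * v l)))"

text \<open>If \<open>L \<union> Q\<close> spans \<open>N\<close> on all rows, independence on
  \<open>P\<close> kills the \<open>L\<close>-coefficients of an admissible \<open>v\<close>, so its
  image comes from \<open>Q\<close> on \<open>K\<close> as well and pairs correctly with
  \<open>u\<close>. Conversely, a relation on \<open>P\<close> that does not extend to
  \<open>K\<close> gives an incompatible pair by \<open>Fredholm_alternative\<close>.\<close>

lemma compatible_iff_in_col_span:
  fixes E :: "'r \<Rightarrow> 'c \<Rightarrow> 'a::field"
  assumes fin: "finite P" "finite K" "finite N" "finite Q"
    and disj: "P \<inter> K = {}" "N \<inter> Q = {}"
    and L: "L \<subseteq> N" "col_indep E P L Q" "\<And>l. l \<in> N \<Longrightarrow> in_col_span E P (L \<union> Q) l"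
  shows "(\<forall>l\<in>N. in_col_span E (P \<union> K) (L \<union> Q) l) \<longleftrightarrow> compatible E P K N Q"
proof
  have fL: "finite L" and LQ: "L \<inter> Q = {}" using fin(3) L(1) disj finite_subset by blast+
  have sumLQ: "(\<Sum>c\<in>L \<union> Q. f c) = (\<Sum>c\<in>L. f c) + (\<Sum>c\<in>Q. f c)" for f :: "_ \<Rightarrow> 'a"
    using fL fin(4) LQ by (intro sum.union_disjoint) auto
  {
    assume "\<forall>l\<in>N. in_col_span E (P \<union> K) (L \<union> Q) l"
    then obtain W where W: "\<And>l r. l \<in> N \<Longrightarrow> r \<in> P \<union> K \<Longrightarrow> E r l = (\<Sum>c\<in>L \<union> Q. E r c * W l c)"
      unfolding in_col_span_def by metis
    show "compatible E P K N Q"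
      unfolding compatible_def
    proof (intro allI impI)
      fix u t v w
      assume u: "\<forall>q\<in>Q. (\<Sum>k\<in>K. u k * E k q) = (\<Sum>r\<in>P. t r * E r q)"
        and v: "\<forall>r\<in>P. (\<Sum>l\<in>N. E r l * v l) = (\<Sum>q\<in>Q. E r q * w q)"
      define y where "y c = (\<Sum>l\<in>N. W l c * v l)" for c
      have Ev: "(\<Sum>l\<in>N. E r l * v l) = (\<Sum>c\<in>L. E r c * y c) + (\<Sum>c\<in>Q. E r c * y c)"
        if "r \<in> P \<union> K" for r
      proof -
        have "(\<Sum>l\<in>N. E r l * v l) = (\<Sum>l\<in>N. \<Sum>c\<in>L \<union> Q. E r c * W l c * v l)"
          using W[OF _ that] by (intro sum.cong) (auto simp: sum_distrib_right)
        also have "\<dots> = (\<Sum>c\<in>L \<union> Q. E r c * y c)"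
          unfolding y_def by (subst sum.swap) (simp add: sum_distrib_left mult.assoc)
        finally show ?thesis by (simp add: sumLQ)
      qed
      have "(\<Sum>l\<in>L. E r l * y l) = (\<Sum>q\<in>Q. E r q * (w q - y q))" if "r \<in> P" for r
        using Ev[of r] v that by (simp add: algebra_simps sum_subtractf)
      from col_indepD[OF L(2) this] have y0: "y l = 0" if "l \<in> L" for l using that by blast
      have Ev': "(\<Sum>l\<in>N. E r l * v l) = (\<Sum>c\<in>Q. E r c * y c)" if "r \<in> P \<union> K" for r
        using Ev[OF that] y0 by simp
      have pull: "(\<Sum>k\<in>S. f k * (\<Sum>l\<in>N. E k l * v l)) = (\<Sum>q\<in>Q. (\<Sum>k\<in>S. f k * E k q) * y q)"
        if "S \<subseteq> P \<union> K" for S f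
      proof -
        have "(\<Sum>k\<in>S. f k * (\<Sum>l\<in>N. E k l * v l)) = (\<Sum>k\<in>S. f k * (\<Sum>q\<in>Q. E k q * y q))"
          using that by (intro sum.cong) (auto intro!: Ev')
        also have "\<dots> = (\<Sum>k\<in>S. \<Sum>q\<in>Q. f k * E k q * y q)"
          by (simp add: sum_distrib_left mult.assoc)
        also have "\<dots> = (\<Sum>q\<in>Q. (\<Sum>k\<in>S. f k * E k q) * y q)"
          by (subst sum.swap) (simp add: sum_distrib_right)
        finally show ?thesis .
      qed
      show "(\<Sum>k\<in>K. u k * (\<Sum>l\<in>N. E k l * v l)) = (\<Sum>r\<in>P. t r * (\<Sum>l\<in>N. E r l * v l))"
        using pull[of K u] pull[of P t] u by simp
    qed
  next
    assume comp: "compatible E P K N Q"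
    show "\<forall>l\<in>N. in_col_span E (P \<union> K) (L \<union> Q) l"
    proof
      fix l0 assume l0: "l0 \<in> N"
      obtain y where y: "\<And>r. r \<in> P \<Longrightarrow> E r l0 = (\<Sum>c\<in>L \<union> Q. E r c * y c)"
        using L(3)[OF l0] unfolding in_col_span_def by blast
      \<comment> \<open>Column \<open>l0\<close> minus its \<open>L\<close>-part, so that on
        \<open>P\<close> only the part in the span of \<open>Q\<close> remains.\<close>
      define v where "v l = (if l = l0 then 1 else 0) - (if l \<in> L then y l else 0)" for l
      have Ev: "(\<Sum>l\<in>N. E r l * v l) = E r l0 - (\<Sum>l\<in>L. E r l * y l)" for r
      proof -
        have "(\<Sum>l\<in>N. E r l * v l) = (\<Sum>l\<in>N. E r l * (if l = l0 then 1 else 0)) - (\<Sum>l\<in>N. E r l * (if l \<in> L then y l else 0))"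
          unfolding v_def by (simp add: right_diff_distrib sum_subtractf)
        also have "(\<Sum>l\<in>N. E r l * (if l = l0 then 1 else 0)) = E r l0"
          using l0 fin(3) by (subst sum.remove[OF fin(3) l0]) (auto intro!: sum.neutral)
        also have "(\<Sum>l\<in>N. E r l * (if l \<in> L then y l else 0)) = (\<Sum>l\<in>L. E r l * y l)"
          using fin(3) L(1) by (intro sum.mono_neutral_cong_right) auto
        finally show ?thesis .
      qed
      have vP: "\<forall>r\<in>P. (\<Sum>l\<in>N. E r l * v l) = (\<Sum>q\<in>Q. E r q * y q)"
        unfolding Ev using y by (simp add: sumLQ)
      have "\<exists>w. \<forall>r\<in>P \<union> K. (\<Sum>l\<in>N. E r l * v l) = (\<Sum>q\<in>Q. E r q * w q)"
      proof (rule ccontr)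
        assume "\<not> ?thesis"
        from Fredholm_alternative[OF fin(4) _ this] fin obtain z
          where z: "\<And>q. q \<in> Q \<Longrightarrow> (\<Sum>r\<in>P \<union> K. z r * E r q) = 0"
            "(\<Sum>r\<in>P \<union> K. z r * (\<Sum>l\<in>N. E r l * v l)) = 1"
          by auto
        have sumPK: "(\<Sum>r\<in>P \<union> K. f r) = (\<Sum>r\<in>P. f r) + (\<Sum>r\<in>K. f r)" for f :: "_ \<Rightarrow> 'a"
          using fin disj by (intro sum.union_disjoint) auto
        \<comment> \<open>The annihilator \<open>z\<close> splits into its parts on \<open>K\<close>
          and on \<open>P\<close>; with the sign changed, the latter plays the role of
          \<open>t\<close>.\<close>
        have "\<forall>q\<in>Q. (\<Sum>k\<in>K. z k * E k q) = (\<Sum>r\<in>P. (- z r) * E r q)"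
          using z(1) unfolding sumPK by (auto simp: sum_negf eq_neg_iff_add_eq_0 add.commute)
        from comp[unfolded compatible_def, rule_format, OF this[rule_format] vP[rule_format]]
        have "(\<Sum>k\<in>K. z k * (\<Sum>l\<in>N. E k l * v l)) = (\<Sum>r\<in>P. - z r * (\<Sum>l\<in>N. E r l * v l))" .
        with z(2) show False unfolding sumPK by (simp add: sum_negf)
      qed
      then obtain w where w: "\<And>r. r \<in> P \<union> K \<Longrightarrow> (\<Sum>l\<in>N. E r l * v l) = (\<Sum>q\<in>Q. E r q * w q)"
        by blast
      have "E r l0 = (\<Sum>c\<in>L \<union> Q. E r c * (if c \<in> Q then w c else y c))" if "r \<in> P \<union> K" for r
      proof -
        have "(\<Sum>c\<in>L. E r c * (if c \<in> Q then w c else y c)) = (\<Sum>c\<in>L. E r c * y c)"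
          using LQ by (intro sum.cong) auto
        moreover have "(\<Sum>c\<in>Q. E r c * (if c \<in> Q then w c else y c)) = (\<Sum>c\<in>Q. E r c * w c)"
          by (intro sum.cong) auto
        ultimately show ?thesis using w[OF that] unfolding sumLQ Ev by (simp add: diff_eq_eq)
      qed
      then show "in_col_span E (P \<union> K) (L \<union> Q) l0"
        unfolding in_col_span_def by (intro exI[of _ "\<lambda>c. if c \<in> Q then w c else y c"] ballI)
    qed
  }
qed

text \<open>\<open>L\<close> stays independent modulo \<open>Q\<close> when rows are added, which
  gives the bound. Neither term of the bound sees the block on \<open>K \<times> N\<close>, where X
  will stand.\<close>

lemma rk_ge_compatible:
  assumes fin: "finite P" "finite K" "finite N" "finite Q"
    and disj: "P \<inter> K = {}" "N \<inter> Q = {}"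
    and L: "L \<subseteq> N" "col_indep E P L Q" "\<And>l. l \<in> N \<Longrightarrow> in_col_span E P (L \<union> Q) l"
  shows "card L + rk E (P \<union> K) Q \<le> rk E (P \<union> K) (N \<union> Q)"
    and "rk E (P \<union> K) (N \<union> Q) = card L + rk E (P \<union> K) Q \<longleftrightarrow> compatible E P K N Q"
proof -
  have fL: "finite L" and LQ: "L \<inter> Q = {}" using fin(3) L(1) disj finite_subset by blast+
  have ind: "col_indep E (P \<union> K) L Q"
    by (rule col_indep_subset[OF L(2) fL _ fin(4)]) auto
  have "N \<union> (L \<union> Q) = N \<union> Q" using L(1) by blast
  then show "card L + rk E (P \<union> K) Q \<le> rk E (P \<union> K) (N \<union> Q)"
    and "rk E (P \<union> K) (N \<union> Q) = card L + rk E (P \<union> K) Q \<longleftrightarrow> compatible E P K N Q"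
    using rk_Un[OF fin(3), of "L \<union> Q" E "P \<union> K"] rk_Un_col_indep[OF fL fin(4) LQ ind]
      compatible_iff_in_col_span[OF assms] fL fin(4) by simp_all
qed

lemma compatible_subset:
  assumes "compatible E P M N Q" "finite M" "K \<subseteq> M"
  shows "compatible E P K N Q"
  unfolding compatible_def
proof (intro allI impI)
  fix u t v w
  assume u: "\<forall>q\<in>Q. (\<Sum>k\<in>K. u k * E k q) = (\<Sum>r\<in>P. t r * E r q)"
    and v: "\<forall>r\<in>P. (\<Sum>l\<in>N. E r l * v l) = (\<Sum>q\<in>Q. E r q * w q)"
  have ext: "(\<Sum>k\<in>M. (if k \<in> K then u k else 0) * f k) = (\<Sum>k\<in>K. u k * f k)" for f
    using assms(2,3) by (intro sum.mono_neutral_cong_right) auto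
  show "(\<Sum>k\<in>K. u k * (\<Sum>l\<in>N. E k l * v l)) = (\<Sum>r\<in>P. t r * (\<Sum>l\<in>N. E r l * v l))"
    using assms(1)[unfolded compatible_def, rule_format, of "\<lambda>k. if k \<in> K then u k else 0" t v w] u v
    unfolding ext by blast
qed

text \<open>On \<open>Q'\<close> each row in \<open>M\<close> is a combination of rows in
  \<open>K\<close> and \<open>P'\<close>. So an admissible \<open>u\<close> on \<open>M\<close>
  splits into a part \<open>a\<close> on \<open>K\<close>, governed by the condition for
  \<open>P\<close> and \<open>Q\<close>, and a rest \<open>b\<close> that agrees on all of
  \<open>Q'\<close> with a combination of rows in \<open>P'\<close>, governed by the condition for
  \<open>P'\<close> and \<open>Q'\<close>.\<close>

lemma compatible_extend:
  fixes E :: "'r \<Rightarrow> 'c \<Rightarrow> 'a::field"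
  assumes fin: "finite P" "finite M" "finite Q'"
    and sub: "K \<subseteq> M" "P' \<subseteq> P" "Q \<subseteq> Q'"
    and span: "\<And>k. k \<in> M \<Longrightarrow> in_col_span (\<lambda>c r. E r c) Q' (K \<union> P') k"
    and KP: "K \<inter> P' = {}"
    and K: "compatible E P K N Q" and M: "compatible E P' M N Q'"
  shows "compatible E P M N Q"
  unfolding compatible_def
proof (intro allI impI)
  fix u t v w
  assume u: "\<forall>q\<in>Q. (\<Sum>k\<in>M. u k * E k q) = (\<Sum>r\<in>P. t r * E r q)"
    and v: "\<forall>r\<in>P. (\<Sum>l\<in>N. E r l * v l) = (\<Sum>q\<in>Q. E r q * w q)"
  have fK: "finite K" and fP': "finite P'" using fin sub finite_subset by blast+
  obtain G where G: "\<And>k q. k \<in> M \<Longrightarrow> q \<in> Q' \<Longrightarrow> E k q = (\<Sum>r\<in>K \<union> P'. E r q * G k r)"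
    using span unfolding in_col_span_def by metis
  define a where "a r = (\<Sum>k\<in>M. u k * G k r)" for r
  define b where "b k = u k - (if k \<in> K then a k else 0)" for k
  have extK: "(\<Sum>k\<in>M. (if k \<in> K then a k else 0) * f k) = (\<Sum>k\<in>K. a k * f k)" for f
    using fin sub by (intro sum.mono_neutral_cong_right) auto
  have bM: "(\<Sum>k\<in>M. b k * f k) = (\<Sum>k\<in>M. u k * f k) - (\<Sum>k\<in>K. a k * f k)" for f
    unfolding b_def extK[symmetric] by (simp add: algebra_simps sum_subtractf)
  have extP: "(\<Sum>r\<in>P. (if r \<in> P' then a r else 0) * f r) = (\<Sum>r\<in>P'. a r * f r)" for f
    using fin sub by (intro sum.mono_neutral_cong_right) auto
  have aP: "(\<Sum>r\<in>P. (t r - (if r \<in> P' then a r else 0)) * f r) = (\<Sum>r\<in>P. t r * f r) - (\<Sum>r\<in>P'. a r * f r)" for f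
    unfolding extP[symmetric] by (simp add: algebra_simps sum_subtractf)
  have uG: "(\<Sum>k\<in>M. u k * E k q) = (\<Sum>r\<in>K. a r * E r q) + (\<Sum>r\<in>P'. a r * E r q)" if "q \<in> Q'" for q
  proof -
    have "(\<Sum>k\<in>M. u k * E k q) = (\<Sum>k\<in>M. \<Sum>r\<in>K \<union> P'. u k * G k r * E r q)"
      by (intro sum.cong refl, subst G) (use that in \<open>auto simp: sum_distrib_left mult_ac\<close>)
    also have "\<dots> = (\<Sum>r\<in>K \<union> P'. a r * E r q)"
      unfolding a_def by (subst sum.swap) (simp add: sum_distrib_right)
    also have "\<dots> = (\<Sum>r\<in>K. a r * E r q) + (\<Sum>r\<in>P'. a r * E r q)"
      using fK fP' KP by (intro sum.union_disjoint)
    finally show ?thesis .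
  qed
  \<comment> \<open>Keeping only the \<open>K\<close>-part on the left shifts \<open>t\<close> by
    \<open>a\<close> on \<open>P'\<close>.\<close>
  have 1: "(\<Sum>k\<in>K. a k * (\<Sum>l\<in>N. E k l * v l)) =
      (\<Sum>r\<in>P. (t r - (if r \<in> P' then a r else 0)) * (\<Sum>l\<in>N. E r l * v l))"
  proof (rule K[unfolded compatible_def, rule_format])
    fix q assume q: "q \<in> Q"
    show "(\<Sum>k\<in>K. a k * E k q) = (\<Sum>r\<in>P. (t r - (if r \<in> P' then a r else 0)) * E r q)"
      unfolding aP using uG[of q] u q sub(3) by (auto simp: algebra_simps)
  next
    fix r assume "r \<in> P"
    then show "(\<Sum>l\<in>N. E r l * v l) = (\<Sum>q\<in>Q. E r q * w q)" using v by blast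
  qed
  have extQ: "(\<Sum>q\<in>Q'. E r q * (if q \<in> Q then w q else 0)) = (\<Sum>q\<in>Q. E r q * w q)" for r
    using fin sub by (intro sum.mono_neutral_cong_right) auto
  have 2: "(\<Sum>k\<in>M. b k * (\<Sum>l\<in>N. E k l * v l)) = (\<Sum>r\<in>P'. a r * (\<Sum>l\<in>N. E r l * v l))"
  proof (rule M[unfolded compatible_def, rule_format])
    fix q assume q: "q \<in> Q'"
    show "(\<Sum>k\<in>M. b k * E k q) = (\<Sum>r\<in>P'. a r * E r q)"
      unfolding bM using uG[OF q] by simp
  next
    fix r assume "r \<in> P'"
    then show "(\<Sum>l\<in>N. E r l * v l) = (\<Sum>q\<in>Q'. E r q * (if q \<in> Q then w q else 0))"
      unfolding extQ using v sub by blast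
  qed
  from 1 2 show "(\<Sum>k\<in>M. u k * (\<Sum>l\<in>N. E k l * v l)) = (\<Sum>r\<in>P. t r * (\<Sum>l\<in>N. E r l * v l))"
    unfolding aP bM by (simp add: algebra_simps)
qed

text \<open>Modulo the rows \<open>K\<close> and \<open>P\<close> (the columns \<open>L\<close> and \<open>Q\<close>), each row in \<open>I\<close> (each column
  in \<open>N - L\<close>) yields exactly one admissible \<open>u\<close> (\<open>v\<close>), and these span all the others.\<close>

lemma compatible_iff_entries:
  fixes E :: "'r \<Rightarrow> 'c \<Rightarrow> 'a::field"
  assumes fin: "finite P" "finite K" "finite I" "finite N" "finite Q"
    and disj: "K \<inter> I = {}" and L: "L \<subseteq> N"
    and rows: "\<And>k q. k \<in> I \<Longrightarrow> q \<in> Q \<Longrightarrow> E k q = (\<Sum>k'\<in>K. a k k' * E k' q) + (\<Sum>r\<in>P. t k r * E r q)"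
    and rind: "col_indep (\<lambda>c r. E r c) Q K P"
    and cols: "\<And>l r. l \<in> N - L \<Longrightarrow> r \<in> P \<Longrightarrow> E r l = (\<Sum>l'\<in>L. E r l' * b l l') + (\<Sum>q\<in>Q. E r q * w l q)"
    and cind: "col_indep E P L Q"
  defines "G \<equiv> \<lambda>r l. E r l - (\<Sum>l'\<in>L. E r l' * b l l')"
  shows "compatible E P (K \<union> I) N Q \<longleftrightarrow>
    (\<forall>k\<in>I. \<forall>l\<in>N - L. G k l - (\<Sum>k'\<in>K. a k k' * G k' l) = (\<Sum>r\<in>P. t k r * G r l))"
proof
  assume comp: "compatible E P (K \<union> I) N Q"
  show "\<forall>k\<in>I. \<forall>l\<in>N - L. G k l - (\<Sum>k'\<in>K. a k k' * G k' l) = (\<Sum>r\<in>P. t k r * G r l)"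
  proof (intro ballI)
    fix k l assume k: "k \<in> I" and l: "l \<in> N - L"
    \<comment> \<open>The pair \<open>u\<close>, \<open>v\<close> belonging to the entry
      \<open>(k, l)\<close>: unit vectors minus their coordinates in \<open>K\<close> and in
      \<open>L\<close>. The hypotheses \<open>rows\<close> and \<open>cols\<close> say that it is
      admissible.\<close>
    define u where "u x = (if x = k then 1 else 0) - (if x \<in> K then a k x else 0)" for x
    define v where "v x = (if x = l then 1 else 0) - (if x \<in> L then b l x else 0)" for x
    have usum: "(\<Sum>x\<in>K \<union> I. u x * f x) = f k - (\<Sum>x\<in>K. a k x * f x)" for f
    proof -
      have "(\<Sum>x\<in>K \<union> I. u x * f x) = (\<Sum>x\<in>K \<union> I. if x = k then f x else 0) - (\<Sum>x\<in>K \<union> I. if x \<in> K then a k x * f x else 0)"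
        unfolding sum_subtractf[symmetric] by (intro sum.cong) (auto simp: u_def left_diff_distrib)
      also have "(\<Sum>x\<in>K \<union> I. if x = k then f x else 0) = f k" using k fin by simp
      also have "(\<Sum>x\<in>K \<union> I. if x \<in> K then a k x * f x else 0) = (\<Sum>x\<in>K. a k x * f x)"
        using fin by (intro sum.mono_neutral_cong_right) auto
      finally show ?thesis .
    qed
    have vsum: "(\<Sum>x\<in>N. E r x * v x) = G r l" for r
    proof -
      have "(\<Sum>x\<in>N. E r x * v x) = (\<Sum>x\<in>N. if x = l then E r x else 0) - (\<Sum>x\<in>N. if x \<in> L then E r x * b l x else 0)"
        unfolding sum_subtractf[symmetric] by (intro sum.cong) (auto simp: v_def right_diff_distrib)
      also have "(\<Sum>x\<in>N. if x = l then E r x else 0) = E r l" using l fin by simp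
      also have "(\<Sum>x\<in>N. if x \<in> L then E r x * b l x else 0) = (\<Sum>x\<in>L. E r x * b l x)"
        using fin L by (intro sum.mono_neutral_cong_right) auto
      finally show ?thesis by (simp add: G_def)
    qed
    have "(\<Sum>x\<in>K \<union> I. u x * (\<Sum>y\<in>N. E x y * v y)) = (\<Sum>r\<in>P. t k r * (\<Sum>y\<in>N. E r y * v y))"
    proof (rule comp[unfolded compatible_def, rule_format])
      fix q assume "q \<in> Q"
      then show "(\<Sum>x\<in>K \<union> I. u x * E x q) = (\<Sum>r\<in>P. t k r * E r q)"
        unfolding usum using rows[OF k] by simp
    next
      fix r assume "r \<in> P"
      then show "(\<Sum>y\<in>N. E r y * v y) = (\<Sum>q\<in>Q. E r q * w l q)"
        unfolding vsum G_def using cols[OF l] by simp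
    qed
    then show "G k l - (\<Sum>k'\<in>K. a k k' * G k' l) = (\<Sum>r\<in>P. t k r * G r l)"
      unfolding usum vsum .
  qed
next
  assume eqs: "\<forall>k\<in>I. \<forall>l\<in>N - L. G k l - (\<Sum>k'\<in>K. a k k' * G k' l) = (\<Sum>r\<in>P. t k r * G r l)"
  show "compatible E P (K \<union> I) N Q"
    unfolding compatible_def
  proof (intro allI impI)
    fix u t' v w'
    assume u: "\<forall>q\<in>Q. (\<Sum>k\<in>K \<union> I. u k * E k q) = (\<Sum>r\<in>P. t' r * E r q)"
      and v: "\<forall>r\<in>P. (\<Sum>l\<in>N. E r l * v l) = (\<Sum>q\<in>Q. E r q * w' q)"
    have fL: "finite L" using fin L finite_subset by blast
    \<comment> \<open>After \<open>v\<close> is expanded in the corrected unit vectors for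
      \<open>N - L\<close>, the coordinates \<open>c\<close> on \<open>L\<close> remain;
      independence forces them to vanish.\<close>
    define c where "c l' = v l' + (\<Sum>l\<in>N - L. b l l' * v l)" for l'
    define F where "F r = (\<Sum>l\<in>N - L. G r l * v l)" for r
    have vF: "(\<Sum>l\<in>N. E r l * v l) = F r + (\<Sum>l'\<in>L. E r l' * c l')" for r
    proof -
      have "F r = (\<Sum>l\<in>N - L. E r l * v l) - (\<Sum>l\<in>N - L. \<Sum>l'\<in>L. E r l' * (b l l' * v l))"
        unfolding F_def G_def by (simp add: left_diff_distrib sum_subtractf sum_distrib_right mult.assoc)
      also have "(\<Sum>l\<in>N - L. \<Sum>l'\<in>L. E r l' * (b l l' * v l)) = (\<Sum>l'\<in>L. E r l' * (\<Sum>l\<in>N - L. b l l' * v l))"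
        by (subst sum.swap) (simp add: sum_distrib_left)
      finally have "F r + (\<Sum>l'\<in>L. E r l' * c l') = (\<Sum>l\<in>N - L. E r l * v l) + (\<Sum>l'\<in>L. E r l' * v l')"
        unfolding c_def by (simp add: distrib_left sum.distrib)
      also have "\<dots> = (\<Sum>l\<in>N. E r l * v l)"
        using sum.subset_diff[OF L fin(4), of "\<lambda>l. E r l * v l"] by simp
      finally show ?thesis by simp
    qed
    have "(\<Sum>l\<in>L. E r l * c l) = (\<Sum>q\<in>Q. E r q * (w' q - (\<Sum>l\<in>N - L. w l q * v l)))" if r: "r \<in> P" for r
    proof -
      have "F r = (\<Sum>l\<in>N - L. (\<Sum>q\<in>Q. E r q * w l q) * v l)"
        unfolding F_def G_def using cols[OF _ r] by (intro sum.cong) (auto simp: algebra_simps)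
      also have "\<dots> = (\<Sum>l\<in>N - L. \<Sum>q\<in>Q. E r q * (w l q * v l))"
        by (simp add: sum_distrib_right mult.assoc)
      also have "\<dots> = (\<Sum>q\<in>Q. E r q * (\<Sum>l\<in>N - L. w l q * v l))"
        by (subst sum.swap) (simp add: sum_distrib_left)
      finally show ?thesis using v r vF[of r]
        by (simp add: right_diff_distrib sum_subtractf)
    qed
    from col_indepD[OF cind this] have "c l = 0" if "l \<in> L" for l using that by blast
    then have vF': "(\<Sum>l\<in>N. E r l * v l) = F r" for r unfolding vF by simp
    \<comment> \<open>Likewise \<open>d\<close> and \<open>s\<close> are what remains of
      \<open>u\<close> and \<open>t'\<close> after subtraction of the admissible pairs belonging to
      the rows in \<open>I\<close>.\<close>
    define d where "d k' = u k' + (\<Sum>k\<in>I. u k * a k k')" for k'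
    define s where "s r = t' r - (\<Sum>k\<in>I. u k * t k r)" for r
    have uI: "(\<Sum>k\<in>K \<union> I. u k * f k) = (\<Sum>k\<in>K. d k * f k) + (\<Sum>k\<in>I. u k * (f k - (\<Sum>k'\<in>K. a k k' * f k')))" for f
    proof -
      have "(\<Sum>k\<in>K. (\<Sum>k'\<in>I. u k' * a k' k) * f k) = (\<Sum>k\<in>K. \<Sum>k'\<in>I. u k' * (a k' k * f k))"
        by (simp add: sum_distrib_right mult.assoc)
      also have "\<dots> = (\<Sum>k\<in>I. u k * (\<Sum>k'\<in>K. a k k' * f k'))"
        by (subst sum.swap) (simp add: sum_distrib_left)
      finally have "(\<Sum>k\<in>K. d k * f k) = (\<Sum>k\<in>K. u k * f k) + (\<Sum>k\<in>I. u k * (\<Sum>k'\<in>K. a k k' * f k'))"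
        unfolding d_def by (simp add: distrib_right sum.distrib)
      moreover have "(\<Sum>k\<in>K \<union> I. u k * f k) = (\<Sum>k\<in>K. u k * f k) + (\<Sum>k\<in>I. u k * f k)"
        using fin disj by (intro sum.union_disjoint)
      ultimately show ?thesis by (simp add: right_diff_distrib sum_subtractf)
    qed
    have sP: "(\<Sum>r\<in>P. t' r * f r) = (\<Sum>r\<in>P. s r * f r) + (\<Sum>k\<in>I. u k * (\<Sum>r\<in>P. t k r * f r))" for f
    proof -
      have "(\<Sum>r\<in>P. (\<Sum>k\<in>I. u k * t k r) * f r) = (\<Sum>r\<in>P. \<Sum>k\<in>I. u k * (t k r * f r))"
        by (simp add: sum_distrib_right mult.assoc)
      also have "\<dots> = (\<Sum>k\<in>I. u k * (\<Sum>r\<in>P. t k r * f r))"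
        by (subst sum.swap) (simp add: sum_distrib_left)
      finally show ?thesis unfolding s_def by (simp add: left_diff_distrib sum_subtractf)
    qed
    have ds: "(\<Sum>k\<in>K. d k * E k q) = (\<Sum>r\<in>P. s r * E r q)" if q: "q \<in> Q" for q
    proof -
      have "(\<Sum>k\<in>I. u k * (E k q - (\<Sum>k'\<in>K. a k k' * E k' q))) = (\<Sum>k\<in>I. u k * (\<Sum>r\<in>P. t k r * E r q))"
        using rows[OF _ q] by (intro sum.cong) auto
      from u[rule_format, OF q, unfolded uI sP this] show ?thesis by (rule add_right_imp_eq)
    qed
    have "(\<Sum>k\<in>K. E k q * d k) = (\<Sum>r\<in>P. E r q * s r)" if q: "q \<in> Q" for q
      using ds[OF q] by (simp add: mult.commute)
    from col_indepD[OF rind this] have d0: "d k = 0" if "k \<in> K" for k using that by blast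
    have "(\<Sum>r\<in>P. s r * F r) = (\<Sum>r\<in>P. \<Sum>q\<in>Q. s r * E r q * w' q)"
      using v by (intro sum.cong) (auto simp: vF'[symmetric] sum_distrib_left mult.assoc)
    also have "\<dots> = (\<Sum>q\<in>Q. (\<Sum>r\<in>P. s r * E r q) * w' q)"
      by (subst sum.swap) (simp add: sum_distrib_right)
    also have "\<dots> = 0" using ds d0 by (auto intro!: sum.neutral simp: ds[symmetric])
    finally have s0: "(\<Sum>r\<in>P. s r * F r) = 0" .
    have "F k - (\<Sum>k'\<in>K. a k k' * F k') = (\<Sum>r\<in>P. t k r * F r)" if k: "k \<in> I" for k
    proof -
      have pull: "(\<Sum>r\<in>S. f r * F r) = (\<Sum>l\<in>N - L. (\<Sum>r\<in>S. f r * G r l) * v l)" for S :: "'r set" and f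
        unfolding F_def sum_distrib_left sum_distrib_right by (subst sum.swap) (simp add: mult.assoc)
      have "F k - (\<Sum>k'\<in>K. a k k' * F k') = (\<Sum>l\<in>N - L. (G k l - (\<Sum>k'\<in>K. a k k' * G k' l)) * v l)"
        unfolding pull by (simp add: F_def left_diff_distrib sum_subtractf)
      also have "\<dots> = (\<Sum>l\<in>N - L. (\<Sum>r\<in>P. t k r * G r l) * v l)"
        using eqs k by (intro sum.cong) auto
      finally show ?thesis unfolding pull .
    qed
    then show "(\<Sum>k\<in>K \<union> I. u k * (\<Sum>l\<in>N. E k l * v l)) = (\<Sum>r\<in>P. t' r * (\<Sum>l\<in>N. E r l * v l))"
      unfolding vF' uI sP using d0 s0 by simp
  qed
qed

section \<open>Triangular systems as fixed-point equations\<close>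

lemma triangular_system_exists:
  fixes rank :: "'s \<Rightarrow> nat" and \<Phi> :: "'s \<Rightarrow> ('s \<Rightarrow> 'a) \<Rightarrow> 'a"
  assumes "\<And>s X Y. s \<in> S \<Longrightarrow> (\<And>s'. s' \<in> S \<Longrightarrow> rank s' < rank s \<Longrightarrow> X s' = Y s') \<Longrightarrow> \<Phi> s X = \<Phi> s Y"
    and "finite S"
  shows "\<exists>X. \<forall>s\<in>S. X s = \<Phi> s X"
proof -
  have "\<exists>X. \<forall>s\<in>S. rank s < b \<longrightarrow> X s = \<Phi> s X" for b
  proof (induction b)
    case (Suc b)
    then obtain X where X: "\<And>s. s \<in> S \<Longrightarrow> rank s < b \<Longrightarrow> X s = \<Phi> s X" by blast
    \<comment> \<open>Only the values of rank exactly \<open>b\<close> are recomputed. For ranks up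
      to \<open>b\<close>, \<open>\<Phi>\<close> reads strictly smaller ranks, where
      \<open>X\<close> and \<open>Y\<close> agree.\<close>
    define Y where "Y s = (if rank s = b then \<Phi> s X else X s)" for s
    have "\<Phi> s X = \<Phi> s Y" if "s \<in> S" "rank s \<le> b" for s
      using that by (intro assms(1)) (auto simp: Y_def)
    then have "Y s = \<Phi> s Y" if "s \<in> S" "rank s < Suc b" for s
      using that X unfolding Y_def[of s] by (auto simp: less_Suc_eq_le)
    then show ?case by blast
  qed simp
  from this[of "Suc (Max (rank ` S))"] show ?thesis
    using assms(2) by (auto simp: less_Suc_eq_le)
qed

lemma triangular_system_unique:
  fixes rank :: "'s \<Rightarrow> nat" and \<Phi> :: "'s \<Rightarrow> ('s \<Rightarrow> 'a) \<Rightarrow> 'a"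
  assumes "\<And>s X Y. s \<in> S \<Longrightarrow> (\<And>s'. s' \<in> S \<Longrightarrow> rank s' < rank s \<Longrightarrow> X s' = Y s') \<Longrightarrow> \<Phi> s X = \<Phi> s Y"
    and "\<And>s. s \<in> S \<Longrightarrow> X s = \<Phi> s X" "\<And>s. s \<in> S \<Longrightarrow> Y s = \<Phi> s Y" "s \<in> S"
  shows "X s = Y s"
  using assms(4)
proof (induction "rank s" arbitrary: s rule: less_induct)
  case less
  then have "\<Phi> s X = \<Phi> s Y" by (intro assms(1)) auto
  then show ?case using assms(2,3) less.prems by metis
qed

section \<open>Nested compatibility conditions\<close>

lemma in_col_span_cong:
  assumes "\<And>r c'. r \<in> R \<Longrightarrow> c' \<in> insert c C \<Longrightarrow> E r c' = E' r c'"
  shows "in_col_span E R C c \<longleftrightarrow> in_col_span E' R C c"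
  unfolding in_col_span_def using assms by (intro ex_cong1 ball_cong refl) (auto cong: sum.cong)

lemma col_indep_cong:
  assumes "\<And>r c. r \<in> R \<Longrightarrow> c \<in> L \<union> Q \<Longrightarrow> E r c = E' r c"
  shows "col_indep E R L Q \<longleftrightarrow> col_indep E' R L Q"
proof -
  have "(\<Sum>l\<in>L. E r l * v l) = (\<Sum>l\<in>L. E' r l * v l) \<and> (\<Sum>q\<in>Q. E r q * w q) = (\<Sum>q\<in>Q. E' r q * w q)"
    if "r \<in> R" for r v w
    using assms that by (auto intro!: sum.cong)
  then show ?thesis unfolding col_indep_def by (simp cong: ball_cong)
qed

text \<open>\<open>P i\<close> and \<open>Q i\<close> are the rows and columns of level
  \<open>i\<close> outside the X block \<open>M \<times> N\<close>. On the rows \<open>P i\<close>,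
  the columns \<open>L i\<close> form a basis of the columns \<open>N\<close> modulo
  \<open>Q i\<close>; on the columns \<open>Q i\<close>, the rows \<open>K (i - 1)\<close> form a
  basis of the rows \<open>M\<close> modulo \<open>P i\<close>. The shift in \<open>K\<close> is
  there because the row condition with index \<open>i\<close> concerns the block rows from
  \<open>i + 1\<close> on, that is, level \<open>i + 1\<close>.\<close>

locale levels =
  fixes n :: nat and P :: "nat \<Rightarrow> 'r set" and Q :: "nat \<Rightarrow> 'c set" and M :: "'r set" and N :: "'c set"
    and E0 :: "'r \<Rightarrow> 'c \<Rightarrow> 'a::field" and L :: "nat \<Rightarrow> 'c set" and K :: "nat \<Rightarrow> 'r set"
  assumes finite_M: "finite M" and finite_N: "finite N"
    and finite_P: "\<And>i. finite (P i)" and finite_Q: "\<And>i. finite (Q i)"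
    and P_mono: "\<And>i. P (Suc i) \<subseteq> P i" and Q_mono: "\<And>i. Q i \<subseteq> Q (Suc i)"
    and PM: "\<And>i. P i \<inter> M = {}" and NQ: "\<And>i. N \<inter> Q i = {}"
    and L_n: "L n = {}" and L_0: "L 0 = N" and L_Suc: "\<And>i. i < n \<Longrightarrow> L (Suc i) \<subseteq> L i"
    and K_0: "K 0 = {}" and K_n: "K n = M" and K_Suc: "\<And>i. i < n \<Longrightarrow> K i \<subseteq> K (Suc i)"
    and L_span: "\<And>i l. i \<in> {1..n} \<Longrightarrow> l \<in> N \<Longrightarrow> in_col_span E0 (P i) (L i \<union> Q i) l"
    and L_ind: "\<And>i. i \<in> {1..n} \<Longrightarrow> col_indep E0 (P i) (L i) (Q i)"
    and K_span: "\<And>i k. i \<in> {1..n} \<Longrightarrow> k \<in> M \<Longrightarrow> in_col_span (\<lambda>c r. E0 r c) (Q i) (K (i - 1) \<union> P i) k"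
    and K_ind: "\<And>i. i \<in> {1..n} \<Longrightarrow> col_indep (\<lambda>c r. E0 r c) (Q i) (K (i - 1)) (P i)"
begin

lemma L_antimono: "i \<le> j \<Longrightarrow> j \<le> n \<Longrightarrow> L j \<subseteq> L i"
proof (induction j rule: dec_induct)
  case (step j)
  then show ?case using L_Suc[of j] by auto
qed simp

lemma K_mono: "i \<le> j \<Longrightarrow> j \<le> n \<Longrightarrow> K i \<subseteq> K j"
proof (induction j rule: dec_induct)
  case (step j)
  then show ?case using K_Suc[of j] by auto
qed simp

lemma L_subset: "i \<le> n \<Longrightarrow> L i \<subseteq> N"
  using L_antimono[of 0 i] L_0 by simp

lemma K_subset: "i \<le> n \<Longrightarrow> K i \<subseteq> M"
  using K_mono[of i n] K_n by simp

lemma K_pred_subset: "i \<le> n \<Longrightarrow> K (i - 1) \<subseteq> M"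
  using K_subset[of "i - 1"] by simp

lemma finite_L: "i \<le> n \<Longrightarrow> finite (L i)"
  using L_subset finite_N finite_subset by blast

lemma finite_K: "i \<le> n \<Longrightarrow> finite (K i)"
  using K_subset finite_M finite_subset by blast

definition fill :: "('r \<Rightarrow> 'c \<Rightarrow> 'a) \<Rightarrow> 'r \<Rightarrow> 'c \<Rightarrow> 'a" where
  "fill X r c = (if r \<in> M \<and> c \<in> N then X r c else E0 r c)"

lemma fill_P [simp]: "r \<in> P i \<Longrightarrow> fill X r c = E0 r c"
  using PM by (auto simp: fill_def)

lemma fill_Q [simp]: "c \<in> Q i \<Longrightarrow> fill X r c = E0 r c"
  using NQ by (auto simp: fill_def)

definition compatible_at :: "('r \<Rightarrow> 'c \<Rightarrow> 'a) \<Rightarrow> nat \<Rightarrow> 'r set \<Rightarrow> bool" where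
  "compatible_at X i K' \<longleftrightarrow> compatible (fill X) (P i) K' N (Q i)"

lemma fill_col_indep:
  assumes "i \<in> {1..n}"
  shows "col_indep (fill X) (P i) (L i) (Q i)"
  using L_ind[OF assms] by (subst col_indep_cong[where E' = E0]) auto

lemma fill_in_col_span:
  assumes "i \<in> {1..n}" "l \<in> N"
  shows "in_col_span (fill X) (P i) (L i \<union> Q i) l"
  using L_span[OF assms] by (subst in_col_span_cong[where E' = E0]) auto

text \<open>The bound is independent of \<open>X\<close>. It serves with \<open>K' = M\<close> for
  the matrices \<open>H\<close> and with \<open>K' = K i\<close> for the matrix of step
  \<open>i\<close>.\<close>

lemma rk_fill:
  assumes i: "i \<in> {1..n}" and K': "K' \<subseteq> M"
  shows "card (L i) + rk E0 (P i \<union> K') (Q i) \<le> rk (fill X) (P i \<union> K') (N \<union> Q i)"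
    and "rk (fill X) (P i \<union> K') (N \<union> Q i) = card (L i) + rk E0 (P i \<union> K') (Q i) \<longleftrightarrow> compatible_at X i K'"
proof -
  have eq: "rk (fill X) (P i \<union> K') (Q i) = rk E0 (P i \<union> K') (Q i)"
    by (rule rk_cong) auto
  have fK: "finite K'" using K' finite_M finite_subset by blast
  have PK: "P i \<inter> K' = {}" using K' PM by blast
  have Li: "L i \<subseteq> N" using L_subset i by simp
  note 1 = rk_ge_compatible[OF finite_P fK finite_N finite_Q PK NQ Li fill_col_indep[OF i, of X]
      fill_in_col_span[OF i, of _ X], unfolded eq]
  show "card (L i) + rk E0 (P i \<union> K') (Q i) \<le> rk (fill X) (P i \<union> K') (N \<union> Q i)"
    by (rule 1(1))
  show "rk (fill X) (P i \<union> K') (N \<union> Q i) = card (L i) + rk E0 (P i \<union> K') (Q i) \<longleftrightarrow> compatible_at X i K'"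
    unfolding compatible_at_def by (rule 1(2))
qed

text \<open>For the converse one descends from level \<open>n\<close>, where \<open>K n = M\<close>:
  by \<open>compatible_extend\<close>, compatibility on all of \<open>M\<close> at level
  \<open>j + 1\<close> supplies the rows outside \<open>K j\<close> at level
  \<open>j\<close>.\<close>

lemma compatible_at_all_iff: "(\<forall>i\<in>{1..n}. compatible_at X i M) \<longleftrightarrow> (\<forall>i\<in>{1..n}. compatible_at X i (K i))"
proof
  assume *: "\<forall>i\<in>{1..n}. compatible_at X i M"
  show "\<forall>i\<in>{1..n}. compatible_at X i (K i)"
  proof
    fix i assume i: "i \<in> {1..n}"
    show "compatible_at X i (K i)"
      using *[rule_format, OF i] i unfolding compatible_at_def
      by (elim compatible_subset[OF _ finite_M K_subset]) simp
  qed
next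
  assume *: "\<forall>i\<in>{1..n}. compatible_at X i (K i)"
  show "\<forall>i\<in>{1..n}. compatible_at X i M"
  proof
    fix i assume i: "i \<in> {1..n}"
    then have "i \<le> n" by simp
    then show "compatible_at X i M"
    proof (induction i rule: inc_induct)
      case base
      then show ?case using * i K_n by force
    next
      case (step j)
      then have j: "j \<in> {1..n}" "Suc j \<in> {1..n}" using i by auto
      show ?case
        unfolding compatible_at_def
      proof (rule compatible_extend)
        show "in_col_span (\<lambda>c r. fill X r c) (Q (Suc j)) (K j \<union> P (Suc j)) k" if "k \<in> M" for k
          using K_span[OF j(2) that] by (subst in_col_span_cong[where E' = "\<lambda>c r. E0 r c"]) auto
        show "compatible (fill X) (P j) (K j) N (Q j)" using * j by (simp add: compatible_at_def)
        show "compatible (fill X) (P (Suc j)) M N (Q (Suc j))" using step.IH by (simp add: compatible_at_def)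
        show "K j \<inter> P (Suc j) = {}" using K_subset[of j] j PM[of "Suc j"] by auto
      qed (use j K_subset P_mono Q_mono finite_P finite_M finite_Q in auto)
    qed
  qed
qed

section \<open>The linear equations for the entries of X\<close>

definition col_coeff :: "nat \<Rightarrow> 'c \<Rightarrow> 'c \<Rightarrow> 'a" where
  "col_coeff i l = (SOME w. \<forall>r\<in>P i. E0 r l = (\<Sum>c\<in>L i \<union> Q i. E0 r c * w c))"

definition row_coeff :: "nat \<Rightarrow> 'r \<Rightarrow> 'r \<Rightarrow> 'a" where
  "row_coeff i k = (SOME w. \<forall>q\<in>Q i. E0 k q = (\<Sum>r\<in>K (i - 1) \<union> P i. E0 r q * w r))"

lemma col_coeff:
  assumes i: "i \<in> {1..n}" and l: "l \<in> N" and r: "r \<in> P i"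
  shows "E0 r l = (\<Sum>c\<in>L i. E0 r c * col_coeff i l c) + (\<Sum>q\<in>Q i. E0 r q * col_coeff i l q)"
proof -
  have "\<forall>r\<in>P i. E0 r l = (\<Sum>c\<in>L i \<union> Q i. E0 r c * col_coeff i l c)"
    unfolding col_coeff_def using L_span[OF i l] unfolding in_col_span_def by (rule someI_ex)
  then have "E0 r l = (\<Sum>c\<in>L i \<union> Q i. E0 r c * col_coeff i l c)" using r by blast
  also have "\<dots> = (\<Sum>c\<in>L i. E0 r c * col_coeff i l c) + (\<Sum>q\<in>Q i. E0 r q * col_coeff i l q)"
    using i finite_L finite_Q L_subset[of i] NQ[of i] by (intro sum.union_disjoint) auto
  finally show ?thesis .
qed

lemma row_coeff:
  assumes i: "i \<in> {1..n}" and k: "k \<in> M" and q: "q \<in> Q i"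
  shows "E0 k q = (\<Sum>k'\<in>K (i - 1). row_coeff i k k' * E0 k' q) + (\<Sum>r\<in>P i. row_coeff i k r * E0 r q)"
proof -
  have "\<forall>q\<in>Q i. E0 k q = (\<Sum>r\<in>K (i - 1) \<union> P i. E0 r q * row_coeff i k r)"
    unfolding row_coeff_def using K_span[OF i k] unfolding in_col_span_def by (rule someI_ex)
  then have "E0 k q = (\<Sum>r\<in>K (i - 1) \<union> P i. row_coeff i k r * E0 r q)"
    using q by (simp add: mult.commute)
  also have "\<dots> = (\<Sum>k'\<in>K (i - 1). row_coeff i k k' * E0 k' q) + (\<Sum>r\<in>P i. row_coeff i k r * E0 r q)"
    using i finite_K[of "i - 1"] finite_P K_pred_subset[of i] PM[of i] by (intro sum.union_disjoint) auto
  finally show ?thesis .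
qed

text \<open>The equation of \<open>compatible_iff_entries\<close> solved for \<open>X k l\<close>.
  The coefficients are determined by entries outside the X block, so the expression is linear in
  \<open>X\<close>; the part that does not contain \<open>X\<close> is
  \<open>entry_const\<close>.\<close>

definition entry_lin :: "nat \<Rightarrow> 'r \<Rightarrow> 'c \<Rightarrow> ('r \<Rightarrow> 'c \<Rightarrow> 'a) \<Rightarrow> 'a" where
  "entry_lin i k l X = (\<Sum>l'\<in>L i. X k l' * col_coeff i l l')
     + (\<Sum>k'\<in>K (i - 1). row_coeff i k k' * (X k' l - (\<Sum>l'\<in>L i. X k' l' * col_coeff i l l')))"

definition entry_const :: "nat \<Rightarrow> 'r \<Rightarrow> 'c \<Rightarrow> 'a" where
  "entry_const i k l = (\<Sum>r\<in>P i. row_coeff i k r * (E0 r l - (\<Sum>l'\<in>L i. E0 r l' * col_coeff i l l')))"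

lemma compatible_at_iff_entries:
  assumes i: "i \<in> {1..n}"
  shows "compatible_at X i (K i) \<longleftrightarrow> (\<forall>k\<in>K i - K (i - 1). \<forall>l\<in>N - L i. X k l = entry_lin i k l X + entry_const i k l)"
proof -
  have Ki: "K i = K (i - 1) \<union> (K i - K (i - 1))" using K_mono[of "i - 1" i] i by auto
  have KM: "K i \<subseteq> M" "K (i - 1) \<subseteq> M" using K_subset[of i] K_pred_subset[of i] i by simp_all
  have LN: "L i \<subseteq> N" using L_subset i by auto
  have fG: "fill X k l - (\<Sum>l'\<in>L i. fill X k l' * col_coeff i l l') = X k l - (\<Sum>l'\<in>L i. X k l' * col_coeff i l l')"
    if "k \<in> M" "l \<in> N" for k l
    using that LN by (auto simp: fill_def intro!: sum.cong)
  have fP: "fill X k l - (\<Sum>l'\<in>L i. fill X k l' * col_coeff i l l') = E0 k l - (\<Sum>l'\<in>L i. E0 k l' * col_coeff i l l')"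
    if "k \<in> P i" for k l
    using that by simp
  have "compatible_at X i (K i) \<longleftrightarrow> compatible (fill X) (P i) (K (i - 1) \<union> (K i - K (i - 1))) N (Q i)"
    using Ki by (simp add: compatible_at_def)
  also have "\<dots> \<longleftrightarrow> (\<forall>k\<in>K i - K (i - 1). \<forall>l\<in>N - L i.
     fill X k l - (\<Sum>l'\<in>L i. fill X k l' * col_coeff i l l')
      - (\<Sum>k'\<in>K (i - 1). row_coeff i k k' * (fill X k' l - (\<Sum>l'\<in>L i. fill X k' l' * col_coeff i l l')))
      = (\<Sum>r\<in>P i. row_coeff i k r * (fill X r l - (\<Sum>l'\<in>L i. fill X r l' * col_coeff i l l'))))"
  proof (rule compatible_iff_entries)
    show "col_indep (\<lambda>c r. fill X r c) (Q i) (K (i - 1)) (P i)"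
      using K_ind[OF i] by (subst col_indep_cong[where E' = "\<lambda>c r. E0 r c"]) auto
    show "fill X k q = (\<Sum>k'\<in>K (i - 1). row_coeff i k k' * fill X k' q) + (\<Sum>r\<in>P i. row_coeff i k r * fill X r q)"
      if "k \<in> K i - K (i - 1)" "q \<in> Q i" for k q
      using row_coeff[OF i _ that(2), of k] that KM by auto
    show "fill X r l = (\<Sum>l'\<in>L i. fill X r l' * col_coeff i l l') + (\<Sum>q\<in>Q i. fill X r q * col_coeff i l q)"
      if "l \<in> N - L i" "r \<in> P i" for l r
      using col_coeff[OF i _ that(2), of l] that by auto
    show "col_indep (fill X) (P i) (L i) (Q i)" by (rule fill_col_indep[OF i])
  qed (use LN i finite_K finite_P finite_N finite_Q in auto)
  also have "\<dots> \<longleftrightarrow> (\<forall>k\<in>K i - K (i - 1). \<forall>l\<in>N - L i. X k l = entry_lin i k l X + entry_const i k l)"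
  proof (intro ball_cong refl)
    fix k l assume k: "k \<in> K i - K (i - 1)" and l: "l \<in> N - L i"
    have 1: "(\<Sum>k'\<in>K (i - 1). row_coeff i k k' * (fill X k' l - (\<Sum>l'\<in>L i. fill X k' l' * col_coeff i l l')))
      = (\<Sum>k'\<in>K (i - 1). row_coeff i k k' * (X k' l - (\<Sum>l'\<in>L i. X k' l' * col_coeff i l l')))"
      using KM l by (intro sum.cong refl, subst fG) auto
    have 2: "(\<Sum>r\<in>P i. row_coeff i k r * (fill X r l - (\<Sum>l'\<in>L i. fill X r l' * col_coeff i l l'))) = entry_const i k l"
      unfolding entry_const_def by (intro sum.cong refl, subst fP) auto
    have 3: "fill X k l - (\<Sum>l'\<in>L i. fill X k l' * col_coeff i l l') = X k l - (\<Sum>l'\<in>L i. X k l' * col_coeff i l l')"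
      using KM k l by (intro fG) auto
    show "(fill X k l - (\<Sum>l'\<in>L i. fill X k l' * col_coeff i l l')
      - (\<Sum>k'\<in>K (i - 1). row_coeff i k k' * (fill X k' l - (\<Sum>l'\<in>L i. fill X k' l' * col_coeff i l l')))
      = (\<Sum>r\<in>P i. row_coeff i k r * (fill X r l - (\<Sum>l'\<in>L i. fill X r l' * col_coeff i l l'))))
      \<longleftrightarrow> X k l = entry_lin i k l X + entry_const i k l"
      unfolding 1 2 3 entry_lin_def by (simp only: diff_eq_eq ac_simps)
  qed
  finally show ?thesis .
qed

lemma entry_lin_cong:
  assumes "\<And>l'. l' \<in> L i \<Longrightarrow> X k l' = Y k l'"
    and "\<And>k'. k' \<in> K (i - 1) \<Longrightarrow> X k' l = Y k' l"
    and "\<And>k' l'. k' \<in> K (i - 1) \<Longrightarrow> l' \<in> L i \<Longrightarrow> X k' l' = Y k' l'"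
  shows "entry_lin i k l X = entry_lin i k l Y"
proof -
  have "(\<Sum>l'\<in>L i. X k' l' * col_coeff i l l') = (\<Sum>l'\<in>L i. Y k' l' * col_coeff i l l')" if "k' \<in> K (i - 1)" for k'
    using assms(3) that by (intro sum.cong) auto
  then show ?thesis unfolding entry_lin_def using assms(1,2)
    by (intro arg_cong2[where f = "(+)"] sum.cong refl) auto
qed

lemma entry_lin_add: "entry_lin i k l (\<lambda>r c. X r c + Y r c) = entry_lin i k l X + entry_lin i k l Y"
  unfolding entry_lin_def by (simp add: algebra_simps sum.distrib sum_subtractf)

lemma entry_lin_scale: "entry_lin i k l (\<lambda>r c. a * X r c) = a * entry_lin i k l X"
  unfolding entry_lin_def by (simp add: algebra_simps sum_distrib_left sum_subtractf)

section \<open>Rows sorted by the block I_i that contains them, and the resulting triangular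
  system\<close>

definition level :: "'r \<Rightarrow> nat" where
  "level k = (LEAST i. k \<in> K i)"

lemma level:
  assumes "k \<in> M"
  shows "level k \<in> {1..n}" "k \<in> K (level k) - K (level k - 1)"
proof -
  have "k \<in> K n" using assms K_n by simp
  then have 1: "k \<in> K (level k)" "level k \<le> n" unfolding level_def by (auto intro: LeastI Least_le)
  have 2: "level k \<noteq> 0" using 1(1) K_0 by (metis empty_iff)
  have "k \<notin> K (level k - 1)" using not_less_Least[of "level k - 1" "\<lambda>i. k \<in> K i"] 2 unfolding level_def by auto
  with 1 2 show "level k \<in> {1..n}" "k \<in> K (level k) - K (level k - 1)" by auto
qed

lemma level_le: "k \<in> K i \<Longrightarrow> level k \<le> i"
  unfolding level_def by (rule Least_le)

lemma level_eq:
  assumes "i \<in> {1..n}" "k \<in> K i - K (i - 1)"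
  shows "level k = i"
proof (rule antisym)
  show "level k \<le> i" using assms level_le by blast
  show "i \<le> level k"
  proof (rule ccontr)
    assume "\<not> i \<le> level k"
    then have "K (level k) \<subseteq> K (i - 1)" using assms by (intro K_mono) auto
    moreover have "k \<in> K (level k)" using assms K_subset[of i] level(2)[of k] by auto
    ultimately show False using assms by blast
  qed
qed

text \<open>The constant term is a parameter: \<open>entry_const\<close> gives the solutions of the
  completion problem, zero gives the direction space of the affine set that they form.\<close>

definition solves :: "('r \<Rightarrow> 'c \<Rightarrow> 'a) \<Rightarrow> ('r \<Rightarrow> 'c \<Rightarrow> 'a) \<Rightarrow> bool" where
  "solves c X \<longleftrightarrow> (\<forall>k\<in>M. \<forall>l\<in>N - L (level k). X k l = entry_lin (level k) k l X + c k l)"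

lemma compatible_at_all_iff_solves:
  "(\<forall>i\<in>{1..n}. compatible_at X i M) \<longleftrightarrow> solves (\<lambda>k. entry_const (level k) k) X"
proof -
  have "(\<forall>i\<in>{1..n}. compatible_at X i (K i)) \<longleftrightarrow>
      (\<forall>i\<in>{1..n}. \<forall>k\<in>K i - K (i - 1). \<forall>l\<in>N - L i. X k l = entry_lin i k l X + entry_const i k l)"
    using compatible_at_iff_entries by (intro ball_cong) auto
  also have "\<dots> \<longleftrightarrow> solves (\<lambda>k. entry_const (level k) k) X"
    unfolding solves_def
  proof safe
    fix k l assume *: "\<forall>i\<in>{1..n}. \<forall>k\<in>K i - K (i - 1). \<forall>l\<in>N - L i. X k l = entry_lin i k l X + entry_const i k l"
      and k: "k \<in> M" and l: "l \<in> N" "l \<notin> L (level k)"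
    show "X k l = entry_lin (level k) k l X + entry_const (level k) k l"
      using *[rule_format, OF level[OF k]] l by simp
  next
    fix i k l assume *: "\<forall>k\<in>M. \<forall>l\<in>N - L (level k). X k l = entry_lin (level k) k l X + entry_const (level k) k l"
      and i: "i \<in> {1..n}" and k: "k \<in> K i" "k \<notin> K (i - 1)" and l: "l \<in> N" "l \<notin> L i"
    have "level k = i" using level_eq i k by simp
    moreover have "k \<in> M" using K_subset[of i] i k by auto
    ultimately show "X k l = entry_lin i k l X + entry_const i k l" using * l by auto
  qed
  finally show ?thesis using compatible_at_all_iff by simp
qed

definition entry_value :: "('r \<Rightarrow> 'c \<Rightarrow> 'a) \<Rightarrow> ('r \<Rightarrow> 'c \<Rightarrow> 'a) \<Rightarrow> 'r \<times> 'c \<Rightarrow> ('r \<times> 'c \<Rightarrow> 'a) \<Rightarrow> 'a" where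
  "entry_value c F = (\<lambda>(k, l) X. if l \<in> L (level k) then F k l else entry_lin (level k) k l (curry X) + c k l)"

text \<open>Order of evaluation: a determined entry in a row of level \<open>i\<close> reads entries
  in rows of lower level and free entries of its own row. So within one level the free entries get
  the even value and the determined ones the odd value.\<close>

definition stage :: "'r \<times> 'c \<Rightarrow> nat" where
  "stage = (\<lambda>(k, l). 2 * level k + (if l \<in> L (level k) then 0 else 1))"

lemma entry_value_cong:
  assumes s: "s \<in> M \<times> N"
    and XY: "\<And>s'. s' \<in> M \<times> N \<Longrightarrow> stage s' < stage s \<Longrightarrow> X s' = Y s'"
  shows "entry_value c F s X = entry_value c F s Y"
proof -
  obtain k l where kl: "s = (k, l)" "k \<in> M" "l \<in> N" using s by blast
  show ?thesis
  proof (cases "l \<in> L (level k)")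
    case False
    have LN: "L (level k) \<subseteq> N" and KM: "K (level k - 1) \<subseteq> M"
      using level(1)[OF kl(2)] L_subset[of "level k"] K_pred_subset[of "level k"] by auto
    have K: "stage (k', l') < stage (k, l)" if "k' \<in> K (level k - 1)" for k' l'
    proof -
      have "level k' < level k" using level_le[OF that] level(1)[OF kl(2)] by auto
      then show ?thesis using False by (auto simp: stage_def kl)
    qed
    have "entry_lin (level k) k l (curry X) = entry_lin (level k) k l (curry Y)"
    proof (rule entry_lin_cong)
      show "curry X k l' = curry Y k l'" if "l' \<in> L (level k)" for l'
        using that False LN kl by (auto intro!: XY simp: stage_def)
      show "curry X k' l = curry Y k' l" if "k' \<in> K (level k - 1)" for k'
        using that KM kl by (auto intro!: XY intro: K[simplified])
      show "curry X k' l' = curry Y k' l'" if "k' \<in> K (level k - 1)" "l' \<in> L (level k)" for k' l'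
        using that KM LN kl by (auto intro!: XY intro: K[simplified])
    qed
    then show ?thesis by (simp add: entry_value_def kl)
  qed (simp add: entry_value_def kl)
qed

lemma solves_exists: "\<exists>X. (\<forall>k\<in>M. \<forall>l\<in>L (level k). X k l = F k l) \<and> solves c X"
proof -
  have "\<exists>X. \<forall>s\<in>M \<times> N. X s = entry_value c F s X"
    by (rule triangular_system_exists[where rank = stage, OF entry_value_cong finite_cartesian_product[OF finite_M finite_N]])
  then obtain X where X: "\<And>k l. k \<in> M \<Longrightarrow> l \<in> N \<Longrightarrow> X (k, l) = entry_value c F (k, l) X" by auto
  have "curry X k l = F k l" if "k \<in> M" "l \<in> L (level k)" for k l
  proof -
    have "l \<in> N" using level(1)[OF that(1)] L_subset that(2) by auto
    then show ?thesis using X that by (simp add: entry_value_def)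
  qed
  moreover have "solves c (curry X)"
    unfolding solves_def
  proof (intro ballI)
    fix k l assume "k \<in> M" "l \<in> N - L (level k)"
    then show "curry X k l = entry_lin (level k) k l (curry X) + c k l"
      using X[of k l] by (simp add: entry_value_def)
  qed
  ultimately show ?thesis by blast
qed

lemma solves_unique:
  assumes "solves c X" "solves c Y" and undet: "\<And>k l. k \<in> M \<Longrightarrow> l \<in> L (level k) \<Longrightarrow> X k l = Y k l"
    and "k \<in> M" "l \<in> N"
  shows "X k l = Y k l"
proof -
  \<comment> \<open>\<open>X\<close> prescribes its own free entries, and by \<open>undet\<close>
    the same prescription fits \<open>Y\<close>.\<close>
  have X: "case_prod X s = entry_value c X s (case_prod X)" if "s \<in> M \<times> N" for s
    using that assms(1) unfolding solves_def by (auto simp: entry_value_def)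
  have Y: "case_prod Y s = entry_value c X s (case_prod Y)" if "s \<in> M \<times> N" for s
    using that assms(2) undet unfolding solves_def by (auto simp: entry_value_def)
  have "case_prod X (k, l) = case_prod Y (k, l)"
    by (rule triangular_system_unique[where rank = stage and S = "M \<times> N", OF entry_value_cong X Y])
      (use assms(4,5) in auto)
  then show ?thesis by simp
qed

text \<open>The right-hand side never reads the replaced block, so the condition of step
  \<open>i\<close> is an explicit formula for that block in terms of the rest of \<open>X\<close>.
  Existence and uniqueness of the minimizer come from here.\<close>

lemma compatible_at_update:
  assumes i: "i \<in> {1..n}"
  shows "compatible_at (\<lambda>k l. if k \<in> K i - K (i - 1) \<and> l \<in> N - L i then Y k l else X k l) i (K i) \<longleftrightarrow>
    (\<forall>k\<in>K i - K (i - 1). \<forall>l\<in>N - L i. Y k l = entry_lin i k l X + entry_const i k l)"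
proof -
  have "entry_lin i k l (\<lambda>k l. if k \<in> K i - K (i - 1) \<and> l \<in> N - L i then Y k l else X k l) = entry_lin i k l X" for k l
    by (rule entry_lin_cong) auto
  then show ?thesis unfolding compatible_at_iff_entries[OF i] by simp
qed

section \<open>Rank differences and the number of free entries\<close>

lemma rk_cols:
  assumes i: "i \<in> {1..n}"
  shows "rk E0 (P i) (N \<union> Q i) = card (L i) + rk E0 (P i) (Q i)"
  using L_subset[of i] i by (intro rk_Un_span_indep finite_N finite_Q NQ L_ind L_span) auto

lemma rk_rows:
  assumes i: "i \<in> {1..n}"
  shows "rk E0 (P i \<union> M) (Q i) = card (K (i - 1)) + rk E0 (P i) (Q i)"
proof -
  have "rk (\<lambda>c r. E0 r c) (Q i) (M \<union> P i) = card (K (i - 1)) + rk (\<lambda>c r. E0 r c) (Q i) (P i)"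
    using K_pred_subset[of i] i PM[of i] by (intro rk_Un_span_indep finite_M finite_P K_ind K_span) auto
  then show ?thesis
    using rk_transpose[of "M \<union> P i" "Q i" E0] rk_transpose[of "P i" "Q i" E0] finite_M finite_P finite_Q
    by (simp add: Un_commute)
qed

text \<open>A row of level \<open>i\<close> has \<open>card (L i)\<close> free entries, and the sum
  over \<open>j\<close> telescopes to this number because \<open>L n\<close> is empty.\<close>

lemma card_free:
  "int (card (SIGMA k:M. L (level k))) =
    (\<Sum>(i, j) | 1 \<le> i \<and> i < j \<and> j \<le> n.
       (int (card (K i)) - int (card (K (i - 1)))) * (int (card (L (j - 1))) - int (card (L j))))"
proof -
  have "(\<Sum>j\<in>{i<..n}. int (card (L (j - 1))) - int (card (L j))) = int (card (L i))" if "i \<le> n" for i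
  proof -
    have "(\<Sum>j\<in>{i<..m}. int (card (L (j - 1))) - int (card (L j))) = int (card (L i)) - int (card (L m))"
      if "i \<le> m" for m
      using that
    proof (induction m rule: dec_induct)
      case (step m)
      have "{i<..Suc m} = insert (Suc m) {i<..m}" using step by auto
      then show ?case using step by simp
    qed simp
    from this[OF \<open>i \<le> n\<close>] show ?thesis by (simp add: L_n)
  qed note tele = this
  have set: "{(i, j). 1 \<le> i \<and> i < j \<and> j \<le> n} = (SIGMA i:{1..n}. {i<..n})" by auto
  have "(\<Sum>(i, j) | 1 \<le> i \<and> i < j \<and> j \<le> n.
       (int (card (K i)) - int (card (K (i - 1)))) * (int (card (L (j - 1))) - int (card (L j))))
    = (\<Sum>i\<in>{1..n}. \<Sum>j\<in>{i<..n}. (int (card (K i)) - int (card (K (i - 1)))) * (int (card (L (j - 1))) - int (card (L j))))"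
    unfolding set by (subst sum.Sigma) auto
  also have "\<dots> = (\<Sum>i\<in>{1..n}. (int (card (K i)) - int (card (K (i - 1)))) * int (card (L i)))"
    unfolding sum_distrib_left[symmetric] using tele by (intro sum.cong) auto
  also have "\<dots> = (\<Sum>i\<in>{1..n}. \<Sum>k\<in>{k\<in>M. level k = i}. int (card (L (level k))))"
  proof (intro sum.cong refl)
    fix i assume i: "i \<in> {1..n}"
    have "{k\<in>M. level k = i} = K i - K (i - 1)"
      using level level_eq[OF i] K_subset[of i] i by auto
    moreover have "card (K i - K (i - 1)) = card (K i) - card (K (i - 1))"
      using i K_mono[of "i - 1" i] finite_K[of "i - 1"] by (intro card_Diff_subset) auto
    moreover have "card (K (i - 1)) \<le> card (K i)"
      using i K_mono[of "i - 1" i] finite_K[of i] by (intro card_mono) auto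
    moreover have "(\<Sum>k\<in>{k\<in>M. level k = i}. int (card (L (level k)))) = int (card {k\<in>M. level k = i}) * int (card (L i))"
      by simp
    ultimately show "(int (card (K i)) - int (card (K (i - 1)))) * int (card (L i))
        = (\<Sum>k\<in>{k\<in>M. level k = i}. int (card (L (level k))))"
      by (simp only: of_nat_diff)
  qed
  also have "\<dots> = (\<Sum>k\<in>M. int (card (L (level k))))"
    using level finite_M by (intro sum.group) auto
  also have "\<dots> = int (card (SIGMA k:M. L (level k)))"
    using finite_M finite_L level(1) by (subst card_SigmaI) auto
  finally show ?thesis by simp
qed

lemma solves_cong:
  assumes "\<And>k l. k \<in> M \<Longrightarrow> l \<in> N \<Longrightarrow> X k l = Y k l"
    and "\<And>k l. k \<in> M \<Longrightarrow> l \<in> N \<Longrightarrow> c k l = d k l"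
  shows "solves c X \<longleftrightarrow> solves d Y"
  unfolding solves_def
proof (intro ball_cong refl)
  fix k l assume k: "k \<in> M" and l: "l \<in> N - L (level k)"
  have "L (level k) \<subseteq> N" "K (level k - 1) \<subseteq> M"
    using level(1)[OF k] L_subset[of "level k"] K_pred_subset[of "level k"] by auto
  then have "entry_lin (level k) k l X = entry_lin (level k) k l Y"
    using k l assms(1) by (intro entry_lin_cong) auto
  then show "X k l = entry_lin (level k) k l X + c k l \<longleftrightarrow> Y k l = entry_lin (level k) k l Y + d k l"
    using assms k l by simp
qed

lemma solves_add:
  assumes "solves c X" "solves d Y"
  shows "solves (\<lambda>k l. c k l + d k l) (\<lambda>k l. X k l + Y k l)"
  using assms unfolding solves_def entry_lin_add by simp

lemma solves_scale:
  assumes "solves c X"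
  shows "solves (\<lambda>k l. a * c k l) (\<lambda>k l. a * X k l)"
  using assms unfolding solves_def entry_lin_scale by (simp add: distrib_left)

end

section \<open>Matrices with labelled rows and columns\<close>

text \<open>A sum instead of a lookup makes linearity immediate; for distinct labels at most one
  summand survives.\<close>

definition vec_fun :: "'r list \<Rightarrow> 'a::field vec \<Rightarrow> 'r \<Rightarrow> 'a" where
  "vec_fun \<rho> v r = (\<Sum>a<length \<rho>. if \<rho> ! a = r then v $ a else 0)"

lemma vec_fun_nth:
  assumes "distinct \<rho>" "a < length \<rho>"
  shows "vec_fun \<rho> v (\<rho> ! a) = v $ a"
proof -
  have "vec_fun \<rho> v (\<rho> ! a) = (\<Sum>b<length \<rho>. if b = a then v $ b else 0)"
    unfolding vec_fun_def using assms by (intro sum.cong) (auto simp: nth_eq_iff_index_eq)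
  then show ?thesis using assms(2) by simp
qed

lemma vec_fun_notin: "r \<notin> set \<rho> \<Longrightarrow> vec_fun \<rho> v r = 0"
  unfolding vec_fun_def by (intro sum.neutral) auto

lemma inj_on_vec_fun:
  assumes "distinct \<rho>" "length \<rho> = nr"
  shows "inj_on (vec_fun \<rho>) (carrier_vec nr)"
proof (rule inj_onI)
  fix u v assume u: "u \<in> carrier_vec nr" and v: "v \<in> carrier_vec nr" and eq: "vec_fun \<rho> u = vec_fun \<rho> v"
  show "u = v"
  proof (rule eq_vecI)
    fix a assume "a < dim_vec v"
    then show "u $ a = v $ a"
      using vec_fun_nth[OF assms(1), of a u] vec_fun_nth[OF assms(1), of a v] v assms(2) eq by simp
  qed (use u v in auto)
qed

lemma vec_fun_mult_mat_vec:
  assumes A: "A \<in> carrier_mat (length \<rho>) nc" and x: "x \<in> carrier_vec nc"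
  shows "vec_fun \<rho> (A *\<^sub>v x) r = (\<Sum>b<nc. vec_fun \<rho> (col A b) r * x $ b)"
proof -
  have "vec_fun \<rho> (A *\<^sub>v x) r = (\<Sum>a<length \<rho>. \<Sum>b<nc. (if \<rho> ! a = r then col A b $ a else 0) * x $ b)"
    unfolding vec_fun_def
  proof (intro sum.cong refl)
    fix a assume a: "a \<in> {..<length \<rho>}"
    have "(A *\<^sub>v x) $ a = (\<Sum>b<nc. col A b $ a * x $ b)"
      using A x a by (auto simp: scalar_prod_def atLeast0LessThan intro!: sum.cong)
    then show "(if \<rho> ! a = r then (A *\<^sub>v x) $ a else 0) = (\<Sum>b<nc. (if \<rho> ! a = r then col A b $ a else 0) * x $ b)"
      by simp
  qed
  also have "\<dots> = (\<Sum>b<nc. vec_fun \<rho> (col A b) r * x $ b)"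
    unfolding vec_fun_def by (subst sum.swap) (simp add: sum_distrib_right)
  finally show ?thesis .
qed

text \<open>Bridge between the two notions of span: both sides consist of all combinations of the
  columns, on the left in the form of products \<open>A *\<^sub>v x\<close>.\<close>

lemma vec_fun_col_space:
  assumes \<rho>: "distinct \<rho>" and A: "A \<in> carrier_mat (length \<rho>) nc"
  shows "vec_fun \<rho> ` vec_space.col_space (length \<rho>) A = fs.span (vec_fun \<rho> ` set (cols A))"
proof -
  define E where "E = (\<lambda>r b. vec_fun \<rho> (col A b) r)"
  have cols: "vec_fun \<rho> ` set (cols A) = col_fun E UNIV ` {..<nc}"
    using A by (auto simp: cols_def col_fun_def E_def fun_eq_iff image_image)
  have "vec_fun \<rho> ` vec_space.col_space (length \<rho>) A = {vec_fun \<rho> (A *\<^sub>v x) |x. x \<in> carrier_vec nc}"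
    using vec_space.col_space_eq[OF A] A by auto
  also have "\<dots> = {f. \<exists>w. \<forall>r. f r = (\<Sum>b<nc. col_fun E UNIV b r * w b)}"
  proof (intro Set.set_eqI iffI)
    fix f assume "f \<in> {vec_fun \<rho> (A *\<^sub>v x) |x. x \<in> carrier_vec nc}"
    then obtain x where "f = vec_fun \<rho> (A *\<^sub>v x)" "x \<in> carrier_vec nc" by blast
    then show "f \<in> {f. \<exists>w. \<forall>r. f r = (\<Sum>b<nc. col_fun E UNIV b r * w b)}"
      using vec_fun_mult_mat_vec[OF A, of x] by (intro CollectI exI[of _ "\<lambda>b. x $ b"]) (simp add: col_fun_def E_def)
  next
    fix f assume "f \<in> {f. \<exists>w. \<forall>r. f r = (\<Sum>b<nc. col_fun E UNIV b r * w b)}"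
    then obtain w where f: "\<And>r. f r = (\<Sum>b<nc. col_fun E UNIV b r * w b)" by blast
    have "f = vec_fun \<rho> (A *\<^sub>v vec nc w)"
    proof
      fix r show "f r = vec_fun \<rho> (A *\<^sub>v vec nc w) r"
        using f vec_fun_mult_mat_vec[OF A, of "vec nc w" r] by (simp add: col_fun_def E_def)
    qed
    then show "f \<in> {vec_fun \<rho> (A *\<^sub>v x) |x. x \<in> carrier_vec nc}" by auto
  qed
  also have "\<dots> = fs.span (vec_fun \<rho> ` set (cols A))"
    unfolding cols by (auto simp: span_col_fun)
  finally show ?thesis .
qed

lemma vec_fun_span:
  assumes \<rho>: "distinct \<rho>" and S: "S \<subseteq> carrier_vec (length \<rho>)" "finite S"
  shows "vec_fun \<rho> ` LinearCombinations.module.span class_ring (module_vec TYPE('a::field) (length \<rho>)) S = fs.span (vec_fun \<rho> ` S)"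
proof -
  obtain xs where xs: "set xs = S" using S(2) finite_list by blast
  have A: "mat_of_cols (length \<rho>) xs \<in> carrier_mat (length \<rho>) (length xs)" by simp
  have "cols (mat_of_cols (length \<rho>) xs) = xs" using xs S(1) by (intro cols_mat_of_cols) auto
  then show ?thesis using vec_fun_col_space[OF \<rho> A] xs by (simp add: vec_space.col_space_def)
qed

text \<open>\<open>vec_fun\<close> is injective on vectors and respects spans, hence also
  dependence. So it carries a maximal independent set of columns to a basis of the span of the
  images.\<close>

lemma rank_eq_dim_vec_fun:
  fixes A :: "'a::field mat"
  assumes \<rho>: "distinct \<rho>" and A: "A \<in> carrier_mat (length \<rho>) nc"
  shows "vec_space.rank (length \<rho>) A = fs.dim (vec_fun \<rho> ` set (cols A))"
proof -
  interpret V: vec_space "TYPE('a)" "length \<rho>" .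
  have cA: "set (cols A) \<subseteq> carrier_vec (length \<rho>)" using A cols_dim[of A] by simp
  have inj: "inj_on (vec_fun \<rho>) (carrier_vec (length \<rho>))" using inj_on_vec_fun[OF \<rho>] by simp
  have dep: "V.lin_dep T \<longleftrightarrow> fs.dependent (vec_fun \<rho> ` T)" if T: "T \<subseteq> carrier_vec (length \<rho>)" "finite T" for T
  proof -
    have "V.lin_dep T \<longleftrightarrow> (\<exists>v\<in>T. v \<in> V.span (T - {v}))"
      using V.lindep_span[of T] T by simp
    also have "\<dots> \<longleftrightarrow> (\<exists>v\<in>T. vec_fun \<rho> v \<in> fs.span (vec_fun \<rho> ` T - {vec_fun \<rho> v}))"
    proof (intro bex_cong refl)
      fix v assume v: "v \<in> T"
      have TV: "T - {v} \<subseteq> carrier_vec (length \<rho>)" using T by blast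
      then have "V.span (T - {v}) \<subseteq> carrier_vec (length \<rho>)" using V.span_closed[of "T - {v}"] by auto
      then have "v \<in> V.span (T - {v}) \<longleftrightarrow> vec_fun \<rho> v \<in> vec_fun \<rho> ` V.span (T - {v})"
        using inj_on_image_mem_iff[OF inj, of v "V.span (T - {v})"] T(1) v by blast
      moreover have "vec_fun \<rho> ` (T - {v}) = vec_fun \<rho> ` T - {vec_fun \<rho> v}"
        using inj_on_subset[OF inj T(1)] v by (auto dest: inj_onD)
      ultimately show "v \<in> V.span (T - {v}) \<longleftrightarrow> vec_fun \<rho> v \<in> fs.span (vec_fun \<rho> ` T - {vec_fun \<rho> v})"
        using vec_fun_span[OF \<rho> TV] T(2) by simp
    qed
    also have "\<dots> \<longleftrightarrow> fs.dependent (vec_fun \<rho> ` T)"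
      unfolding fs.dependent_def by blast
    finally show ?thesis .
  qed
  have "V.lin_indpt {}" using dep[of "{}"] fs.independent_empty by simp
  then obtain S where S: "maximal S (\<lambda>T. T \<subseteq> set (cols A) \<and> V.lin_indpt T)"
    using maximal_exists_superset[of "set (cols A)" "\<lambda>T. T \<subseteq> set (cols A) \<and> V.lin_indpt T" "{}"] by auto
  then have Scols: "S \<subseteq> set (cols A)" and Sind: "V.lin_indpt S"
    and Smax: "\<And>T. S \<subseteq> T \<Longrightarrow> T \<subseteq> set (cols A) \<Longrightarrow> V.lin_indpt T \<Longrightarrow> T = S"
    unfolding maximal_def by auto
  have SV: "S \<subseteq> carrier_vec (length \<rho>)" using Scols cA by blast
  have fS: "finite S" using Scols finite_subset by blast
  have ind: "fs.independent (vec_fun \<rho> ` S)" using dep[OF SV fS] Sind by simp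
  have "vec_fun \<rho> v \<in> fs.span (vec_fun \<rho> ` S)" if v: "v \<in> set (cols A)" for v
  proof (rule ccontr)
    assume n: "vec_fun \<rho> v \<notin> fs.span (vec_fun \<rho> ` S)"
    have "fs.independent (vec_fun \<rho> ` insert v S)"
      unfolding image_insert using n ind by (rule fs.independent_insertI)
    then have "V.lin_indpt (insert v S)" using dep[of "insert v S"] fS SV v cA by auto
    then have "insert v S = S" using Smax[of "insert v S"] v Scols by auto
    then show False using n fs.span_base by blast
  qed
  then have "card (vec_fun \<rho> ` S) = fs.dim (vec_fun \<rho> ` set (cols A))"
    using Scols ind by (intro fs.basis_card_eq_dim) auto
  moreover have "card (vec_fun \<rho> ` S) = card S" using inj_on_subset[OF inj SV] by (rule card_image)
  ultimately show ?thesis using V.rank_card_indpt[OF A S] by simp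
qed

text \<open>Separates the identity of rows and columns from their order: assembling blocks
  concatenates label lists, whereas for distinct row labels the rank depends only on the label
  sets.\<close>

definition represents :: "'a mat \<Rightarrow> 'r list \<Rightarrow> 'c list \<Rightarrow> ('r \<Rightarrow> 'c \<Rightarrow> 'a) \<Rightarrow> bool" where
  "represents A \<rho> \<kappa> E \<longleftrightarrow> A \<in> carrier_mat (length \<rho>) (length \<kappa>) \<and>
     (\<forall>a<length \<rho>. \<forall>b<length \<kappa>. A $$ (a, b) = E (\<rho> ! a) (\<kappa> ! b))"

lemma represents_carrier: "represents A \<rho> \<kappa> E \<Longrightarrow> A \<in> carrier_mat (length \<rho>) (length \<kappa>)"
  by (simp add: represents_def)

lemma represents_transpose: "represents A \<rho> \<kappa> E \<Longrightarrow> represents A\<^sup>T \<kappa> \<rho> (\<lambda>c r. E r c)"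
  by (auto simp: represents_def)

lemma vec_fun_cols:
  assumes "represents A \<rho> \<kappa> E" "distinct \<rho>"
  shows "vec_fun \<rho> ` set (cols A) = col_fun E (set \<rho>) ` set \<kappa>"
proof -
  have A: "A \<in> carrier_mat (length \<rho>) (length \<kappa>)" by (rule represents_carrier[OF assms(1)])
  have "vec_fun \<rho> (col A b) = col_fun E (set \<rho>) (\<kappa> ! b)" if b: "b < length \<kappa>" for b
  proof
    fix r show "vec_fun \<rho> (col A b) r = col_fun E (set \<rho>) (\<kappa> ! b) r"
    proof (cases "r \<in> set \<rho>")
      case True
      then obtain a where "a < length \<rho>" "r = \<rho> ! a" by (metis in_set_conv_nth)
      then show ?thesis using assms b A by (simp add: vec_fun_nth col_fun_def represents_def)
    qed (simp add: vec_fun_notin col_fun_def)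
  qed
  then have "vec_fun \<rho> ` set (cols A) = (\<lambda>b. col_fun E (set \<rho>) (\<kappa> ! b)) ` {..<length \<kappa>}"
    using A by (auto simp: cols_def image_image atLeast0LessThan)
  also have "\<dots> = col_fun E (set \<rho>) ` set \<kappa>"
    by (auto simp: set_conv_nth)
  finally show ?thesis .
qed

lemma mrank_represents:
  assumes "represents A \<rho> \<kappa> E" "distinct \<rho>"
  shows "mrank A = rk E (set \<rho>) (set \<kappa>)"
  using rank_eq_dim_vec_fun[OF assms(2) represents_carrier[OF assms(1)]] represents_carrier[OF assms(1)]
  by (simp add: mrank_def rk_def vec_fun_cols[OF assms])

lemma Col_eq_iff_represents:
  assumes "represents A \<rho> \<kappa> E" "represents A' \<rho> \<kappa>' E" "distinct \<rho>"
  shows "Col A = Col A' \<longleftrightarrow> fs.span (col_fun E (set \<rho>) ` set \<kappa>) = fs.span (col_fun E (set \<rho>) ` set \<kappa>')"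
proof -
  note A = represents_carrier[OF assms(1)] and A' = represents_carrier[OF assms(2)]
  have sub: "Col A \<subseteq> carrier_vec (length \<rho>)" "Col A' \<subseteq> carrier_vec (length \<rho>)"
    using vec_space.col_space_eq[OF A] vec_space.col_space_eq[OF A'] A A' by (auto simp: Col_def)
  have "Col A = Col A' \<longleftrightarrow> vec_fun \<rho> ` Col A = vec_fun \<rho> ` Col A'"
    using inj_on_image_eq_iff[OF inj_on_vec_fun[OF assms(3) refl] sub] by simp
  also have "\<dots> \<longleftrightarrow> fs.span (col_fun E (set \<rho>) ` set \<kappa>) = fs.span (col_fun E (set \<rho>) ` set \<kappa>')"
    using vec_fun_col_space[OF assms(3) A] vec_fun_col_space[OF assms(3) A'] A A'
    by (simp add: Col_def vec_fun_cols[OF assms(1,3)] vec_fun_cols[OF assms(2,3)])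
  finally show ?thesis .
qed

lemma Row_eq_Col_transpose: "Row A = Col A\<^sup>T"
  by (simp add: Row_def Col_def vec_space.row_space_eq_col_space_transpose)

lemma represents_append_cols:
  assumes "represents A \<rho> \<kappa> E" "represents A' \<rho> \<kappa>' E"
  shows "represents (append_cols A A') \<rho> (\<kappa> @ \<kappa>') E"
  using assms by (auto simp: represents_def append_cols_def nth_append)

lemma represents_append_rows:
  assumes "represents A \<rho> \<kappa> E" "represents A' \<rho>' \<kappa> E"
  shows "represents (A @\<^sub>r A') (\<rho> @ \<rho>') \<kappa> E"
  using assms by (auto simp: represents_def append_rows_def nth_append)

lemma represents_hcat:
  assumes "list_all2 (\<lambda>A \<kappa>. represents A \<rho> \<kappa> E) As \<kappa>s"
  shows "represents (hcat (length \<rho>) As) \<rho> (concat \<kappa>s) E"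
  using assms
proof (induction rule: list_all2_induct)
  case Nil
  then show ?case by (simp add: represents_def hcat_def)
next
  case (Cons A As \<kappa> \<kappa>s)
  then show ?case using represents_append_cols by (simp add: hcat_def)
qed

lemma represents_vcat:
  assumes "list_all2 (\<lambda>A \<rho>. represents A \<rho> \<kappa> E) As \<rho>s"
  shows "represents (vcat (length \<kappa>) As) (concat \<rho>s) \<kappa> E"
  using assms
proof (induction rule: list_all2_induct)
  case Nil
  then show ?case by (simp add: represents_def vcat_def)
next
  case (Cons A As \<rho> \<rho>s)
  then show ?case using represents_append_rows by (simp add: vcat_def)
qed

lemma represents_blocks:
  assumes "\<And>i j. i \<in> set rs \<Longrightarrow> j \<in> set cs \<Longrightarrow> represents (B i j) (lr i) (lc j) E"
    and "\<And>i. i \<in> set rs \<Longrightarrow> length (lr i) = m i" and "\<And>j. j \<in> set cs \<Longrightarrow> length (lc j) = p j"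
  shows "represents (blocks m p rs cs B) (concat (map lr rs)) (concat (map lc cs)) E"
proof -
  have len: "(\<Sum>j\<leftarrow>cs. p j) = length (concat (map lc cs))"
    using assms(3) by (simp add: length_concat comp_def cong: map_cong)
  show ?thesis
    unfolding blocks_def len
  proof (rule represents_vcat, unfold list_all2_map1 list_all2_map2, rule list.rel_refl_strong)
    fix i assume i: "i \<in> set rs"
    show "represents (hcat (m i) (map (B i) cs)) (lr i) (concat (map lc cs)) E"
      unfolding assms(2)[OF i, symmetric]
      by (rule represents_hcat, unfold list_all2_map1 list_all2_map2, rule list.rel_refl_strong)
        (rule assms(1)[OF i])
  qed
qed

lemma pick_image:
  assumes "finite S"
  shows "pick S ` {..<card S} = S" "inj_on (pick S) {..<card S}"
proof -
  have sub: "pick S ` {..<card S} \<subseteq> S" using pick_in_set_le by auto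
  show inj: "inj_on (pick S) {..<card S}"
  proof (rule inj_onI)
    fix x y assume "x \<in> {..<card S}" "y \<in> {..<card S}" "pick S x = pick S y"
    then show "x = y"
      using pick_mono_le[of x S y] pick_mono_le[of y S x] by (cases x y rule: linorder_cases) auto
  qed
  show "pick S ` {..<card S} = S"
    using sub assms inj by (intro card_subset_eq) (auto simp: card_image)
qed

text \<open>\<open>pick S\<close> enumerates \<open>S\<close> increasingly, as
  \<open>submatrix\<close> does; the block number keeps the labels of different blocks
  apart.\<close>

definition labels :: "nat \<Rightarrow> nat set \<Rightarrow> (nat \<times> nat) list" where
  "labels k S = map (\<lambda>a. (k, pick S a)) [0..<card S]"

lemma set_labels: "finite S \<Longrightarrow> set (labels k S) = {k} \<times> S"
  using pick_image(1)[of S] by (auto simp: labels_def atLeast0LessThan)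

lemma distinct_labels: "finite S \<Longrightarrow> distinct (labels k S)"
  using pick_image(2)[of S] by (auto simp: labels_def distinct_map inj_on_def)

lemma length_labels [simp]: "length (labels k S) = card S"
  by (simp add: labels_def)

lemma represents_submatrix:
  assumes A: "A \<in> carrier_mat nr nc" and S: "S \<subseteq> {..<nr}" and T: "T \<subseteq> {..<nc}"
    and E: "\<And>a b. a \<in> S \<Longrightarrow> b \<in> T \<Longrightarrow> E (k, a) (j, b) = A $$ (a, b)"
  shows "represents (submatrix A S T) (labels k S) (labels j T) E"
proof -
  have c: "{i. i < nr \<and> i \<in> S} = S" "{i. i < nc \<and> i \<in> T} = T" using S T by auto
  have "pick S a < nr" if "a < card S" for a using pick_in_set_le[OF that] S by auto
  moreover have "pick T a < nc" if "a < card T" for a using pick_in_set_le[OF that] T by auto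
  ultimately show ?thesis
    using A by (auto simp: represents_def labels_def submatrix_def c E pick_in_set_le)
qed

lemma submatrix_UNIV_row: "submatrix A UNIV T = submatrix A {..<dim_row A} T"
proof -
  have "pick {..<dim_row A} a = a" if "a < dim_row A" for a
    using that pick_reduce_set[of a "dim_row A" UNIV] by (simp add: pick_UNIV lessThan_def)
  then show ?thesis unfolding submatrix_def by (intro cong_mat) (auto simp: pick_UNIV)
qed

lemma submatrix_UNIV_col: "submatrix A S UNIV = submatrix A S {..<dim_col A}"
proof -
  have "pick {..<dim_col A} a = a" if "a < dim_col A" for a
    using that pick_reduce_set[of a "dim_col A" UNIV] by (simp add: pick_UNIV lessThan_def)
  then show ?thesis unfolding submatrix_def by (intro cong_mat) (auto simp: pick_UNIV)
qed

lemma submatrix_UNIV: "submatrix A UNIV UNIV = A"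
  unfolding submatrix_def by (intro eq_matI) (auto simp: pick_UNIV)

lemma distinct_concat_labels:
  assumes "distinct ks" "\<And>k. k \<in> set ks \<Longrightarrow> finite (S k)"
  shows "distinct (concat (map (\<lambda>k. labels k (S k)) ks))"
  using assms
proof (induction ks)
  case (Cons k ks)
  then show ?case using distinct_labels[of "S k" k] by (auto simp: set_labels)
qed simp

lemma set_concat_labels:
  assumes "\<And>k. k \<in> set ks \<Longrightarrow> finite (S k)"
  shows "set (concat (map (\<lambda>k. labels k (S k)) ks)) = (SIGMA k:set ks. S k)"
  using assms by (auto simp: set_labels)

section \<open>The completion problem\<close>

text \<open>The block numbers are ignored because all labels of interest lie in the block
  \<open>(n, 1)\<close>.\<close>

definition entry :: "'a mat \<Rightarrow> nat \<times> nat \<Rightarrow> nat \<times> nat \<Rightarrow> 'a" where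
  "entry X r c = X $$ (snd r, snd c)"

lemma represents_full:
  assumes "A \<in> carrier_mat nr nc" "\<And>a b. a < nr \<Longrightarrow> b < nc \<Longrightarrow> E (k, a) (j, b) = A $$ (a, b)"
  shows "represents A (labels k {..<nr}) (labels j {..<nc}) E"
proof -
  have "submatrix A {..<nr} {..<nc} = A"
    using assms(1) by (metis carrier_matD submatrix_UNIV submatrix_UNIV_col submatrix_UNIV_row)
  then show ?thesis using represents_submatrix[OF assms(1) subset_refl subset_refl, of E k j] assms(2) by simp
qed

lemma represents_submatrix_UNIV_row:
  assumes "A \<in> carrier_mat nr nc" "T \<subseteq> {..<nc}" "\<And>a b. a < nr \<Longrightarrow> b \<in> T \<Longrightarrow> E (k, a) (j, b) = A $$ (a, b)"
  shows "represents (submatrix A UNIV T) (labels k {..<nr}) (labels j T) E"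
  using represents_submatrix[OF assms(1) subset_refl assms(2), of E k j] assms(1,3)
  by (simp add: submatrix_UNIV_row)

lemma represents_submatrix_UNIV_col:
  assumes "A \<in> carrier_mat nr nc" "S \<subseteq> {..<nr}" "\<And>a b. a \<in> S \<Longrightarrow> b < nc \<Longrightarrow> E (k, a) (j, b) = A $$ (a, b)"
  shows "represents (submatrix A S UNIV) (labels k S) (labels j {..<nc}) E"
  using represents_submatrix[OF assms(1,2) subset_refl, of E k j] assms(1,3)
  by (simp add: submatrix_UNIV_col)

lemma submatrix_eq_iff:
  assumes X: "X \<in> carrier_mat nr nc" and Y: "Y \<in> carrier_mat nr nc"
    and S: "S \<subseteq> {..<nr}" and T: "T \<subseteq> {..<nc}"
  shows "submatrix X S T = submatrix Y S T \<longleftrightarrow> (\<forall>k\<in>S. \<forall>l\<in>T. X $$ (k, l) = Y $$ (k, l))"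
proof
  assume eq: "submatrix X S T = submatrix Y S T"
  show "\<forall>k\<in>S. \<forall>l\<in>T. X $$ (k, l) = Y $$ (k, l)"
  proof (intro ballI)
    fix k l assume k: "k \<in> S" and l: "l \<in> T"
    then have "k < nr" "l < nc" using S T by auto
    then show "X $$ (k, l) = Y $$ (k, l)"
      using submatrix_index_card[of k X l S T] submatrix_index_card[of k Y l S T] eq k l X Y by simp
  qed
next
  assume eq: "\<forall>k\<in>S. \<forall>l\<in>T. X $$ (k, l) = Y $$ (k, l)"
  have c: "{i. i < nr \<and> i \<in> S} = S" "{i. i < nc \<and> i \<in> T} = T" using S T by auto
  show "submatrix X S T = submatrix Y S T"
    using X Y eq by (intro eq_matI) (auto simp: submatrix_def c pick_in_set_le)
qed

lemma submatrix_carrier: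
  assumes "X \<in> carrier_mat nr nc" "S \<subseteq> {..<nr}" "T \<subseteq> {..<nc}"
  shows "submatrix X S T \<in> carrier_mat (card S) (card T)"
proof -
  have c: "{i. i < nr \<and> i \<in> S} = S" "{i. i < nc \<and> i \<in> T} = T" using assms by auto
  then show ?thesis using assms(1) by (auto simp: submatrix_def)
qed

lemma submatrix_surj:
  assumes Y: "Y \<in> carrier_mat (card S) (card T)" and S: "S \<subseteq> {..<nr}" and T: "T \<subseteq> {..<nc}"
  obtains Z where "Z \<in> carrier_mat nr nc" "submatrix Z S T = Y"
proof
  \<comment> \<open>\<open>card {a \<in> S. a < k}\<close> is the position of \<open>k\<close> in
    \<open>S\<close>, inverse to \<open>pick S\<close>; the values outside
    \<open>S \<times> T\<close> are junk.\<close>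
  let ?Z = "mat nr nc (\<lambda>(k, l). Y $$ (card {a \<in> S. a < k}, card {b \<in> T. b < l}))"
  show "?Z \<in> carrier_mat nr nc" by simp
  have c: "{i. i < nr \<and> i \<in> S} = S" "{i. i < nc \<and> i \<in> T} = T" using S T by auto
  have "pick S a < nr" "pick S a \<in> S" if "a < card S" for a using pick_in_set_le[OF that] S by auto
  moreover have "pick T a < nc" "pick T a \<in> T" if "a < card T" for a using pick_in_set_le[OF that] T by auto
  ultimately show "submatrix ?Z S T = Y"
    using Y by (intro eq_matI) (auto simp: submatrix_def c card_pick_le)
qed

text \<open>Least cardinality gives minimality for inclusion, even though \<open>good\<close> need
  not be monotone.\<close>

lemma minimal_superset_exists:
  assumes "T \<subseteq> U" "finite U" "good U"
  shows "\<exists>S. T \<subseteq> S \<and> S \<subseteq> U \<and> good S \<and> (\<forall>S'. T \<subseteq> S' \<and> S' \<subset> S \<longrightarrow> \<not> good S')"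
proof -
  obtain S where S: "T \<subseteq> S \<and> S \<subseteq> U \<and> good S"
    and min: "\<And>S'. T \<subseteq> S' \<and> S' \<subseteq> U \<and> good S' \<Longrightarrow> card S \<le> card S'"
    using ex_has_least_nat[of "\<lambda>S. T \<subseteq> S \<and> S \<subseteq> U \<and> good S" U card] assms by auto
  have "\<not> good S'" if S': "T \<subseteq> S'" "S' \<subset> S" for S'
  proof
    assume "good S'"
    then have "card S \<le> card S'" using S S' by (intro min) auto
    moreover have "card S' < card S" using S' S assms(2) finite_subset by (intro psubset_card_mono) auto
    ultimately show False by simp
  qed
  then show ?thesis using S by blast
qed

text \<open>Translates minimality of a spanning set into absence of redundant members: if
  \<open>x\<close> lay in the span of the others, \<open>S - {x}\<close> would still span
  everything.\<close>

lemma in_col_span_all_remove: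
  assumes fin: "finite S" "finite Q"
    and all: "\<And>c. c \<in> N - S \<Longrightarrow> in_col_span E R (S \<union> Q) c" and x: "in_col_span E R (S - {x} \<union> Q) x"
    and c: "c \<in> N - (S - {x})"
  shows "in_col_span E R (S - {x} \<union> Q) c"
proof (cases "c \<in> S")
  case True
  then show ?thesis using c x by auto
next
  case False
  have fin': "finite (S - {x} \<union> Q)" using fin by simp
  show ?thesis
  proof (rule in_col_span_trans[OF fin'])
    show "in_col_span E R (S \<union> Q) c" using all c False by simp
    fix c' assume c': "c' \<in> S \<union> Q"
    show "in_col_span E R (S - {x} \<union> Q) c'"
      using x in_col_span_member[OF fin', of c' E R] c' by (cases "c' = x") auto
  qed (use fin in simp)
qed

locale completion =
  fixes n :: nat and m p :: "nat \<Rightarrow> nat" and A :: "nat \<Rightarrow> nat \<Rightarrow> 'a::field mat"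
  assumes n: "n \<ge> 2"
    and A: "\<And>i j. 1 \<le> j \<Longrightarrow> j \<le> i \<Longrightarrow> i \<le> n \<Longrightarrow> (i, j) \<noteq> (n, 1) \<Longrightarrow> A i j \<in> carrier_mat (m i) (p j)"
begin

text \<open>Nothing is known about \<open>A n 1\<close>, so \<open>E0\<close> is junk on \<open>M \<times> N\<close>, where \<open>levels.fill\<close> overwrites it.\<close>

definition E0 :: "nat \<times> nat \<Rightarrow> nat \<times> nat \<Rightarrow> 'a" where
  "E0 r c = A (fst r) (fst c) $$ (snd r, snd c)"

definition P :: "nat \<Rightarrow> (nat \<times> nat) set" where
  "P i = (SIGMA k:{i..<n}. {..<m k})"

definition Q :: "nat \<Rightarrow> (nat \<times> nat) set" where
  "Q i = (SIGMA j:{2..<Suc i}. {..<p j})"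

definition M :: "(nat \<times> nat) set" where
  "M = {n} \<times> {..<m n}"

definition N :: "(nat \<times> nat) set" where
  "N = {1} \<times> {..<p 1}"

lemma finite_PQMN [simp]: "finite (P i)" "finite (Q i)" "finite M" "finite N"
  by (auto simp: P_def Q_def M_def N_def)

section \<open>Column and row conditions as span conditions, and existence of index sets\<close>

lemma col_condition_iff:
  assumes i: "i \<in> {1..<n}" and S: "S \<subseteq> {..<p 1}"
  shows "col_condition n m p A i S \<longleftrightarrow> (\<forall>l\<in>N - {1} \<times> S. in_col_span E0 (P i) ({1} \<times> S \<union> Q i) l)"
proof -
  have fS: "finite S" using S finite_subset by blast
  let ?lr = "\<lambda>k. labels k {..<m k}"
  let ?T = "\<lambda>S j. if j = 1 then S else {..<p j}"
  let ?lc = "\<lambda>S j. labels j (?T S j)"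
  have 1: "represents (blocks m (p(1 := card S)) [i..<n] [1..<Suc i]
            (\<lambda>k j. if j = 1 then submatrix (A k 1) UNIV S else A k j))
      (concat (map ?lr [i..<n])) (concat (map (?lc S) [1..<Suc i])) E0"
  proof (rule represents_blocks)
    fix k j assume "k \<in> set [i..<n]" "j \<in> set [1..<Suc i]"
    then have k: "i \<le> k" "k < n" and j: "1 \<le> j" "j \<le> i" by auto
    have Akj: "A k j \<in> carrier_mat (m k) (p j)" using k j by (intro A) auto
    show "represents (if j = 1 then submatrix (A k 1) UNIV S else A k j) (?lr k) (?lc S j) E0"
      using Akj S by (auto intro!: represents_submatrix_UNIV_row represents_full simp: E0_def)
  qed auto
  have 2: "represents (blocks m p [i..<n] [1..<Suc i] A)
      (concat (map ?lr [i..<n])) (concat (map (?lc {..<p 1}) [1..<Suc i])) E0"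
  proof (rule represents_blocks)
    fix k j assume "k \<in> set [i..<n]" "j \<in> set [1..<Suc i]"
    then have k: "i \<le> k" "k < n" and j: "1 \<le> j" "j \<le> i" by auto
    have Akj: "A k j \<in> carrier_mat (m k) (p j)" using k j by (intro A) auto
    show "represents (A k j) (?lr k) (?lc {..<p 1} j) E0"
      using Akj by (auto intro!: represents_full simp: E0_def)
  qed auto
  have rows: "set (concat (map ?lr [i..<n])) = P i"
    by (subst set_concat_labels) (auto simp: P_def)
  have cols: "set (concat (map (?lc S) [1..<Suc i])) = {1} \<times> S \<union> Q i" if "finite S" for S
    by (subst set_concat_labels) (use i that in \<open>auto simp: Q_def split: if_splits\<close>)
  have dist: "distinct (concat (map ?lr [i..<n]))" by (rule distinct_concat_labels) auto
  have diff: "({1} \<times> {..<p 1} \<union> Q i) - ({1} \<times> S \<union> Q i) = N - {1} \<times> S"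
    by (auto simp: N_def Q_def)
  have "col_condition n m p A i S \<longleftrightarrow>
      fs.span (col_fun E0 (P i) ` ({1} \<times> S \<union> Q i)) = fs.span (col_fun E0 (P i) ` ({1} \<times> {..<p 1} \<union> Q i))"
    unfolding col_condition_def Col_eq_iff_represents[OF 1 2 dist] rows cols[OF fS] cols[OF finite_lessThan] ..
  also have "\<dots> \<longleftrightarrow> (\<forall>l\<in>N - {1} \<times> S. in_col_span E0 (P i) ({1} \<times> S \<union> Q i) l)"
    unfolding diff[symmetric] using S fS by (intro span_col_fun_eq_iff) auto
  finally show ?thesis .
qed

lemma row_condition_iff:
  assumes i: "i \<in> {1..<n}" and S: "S \<subseteq> {..<m n}"
  shows "row_condition n m p A i S \<longleftrightarrow>
    (\<forall>k\<in>M - {n} \<times> S. in_col_span (\<lambda>c r. E0 r c) (Q (Suc i)) ({n} \<times> S \<union> P (Suc i)) k)"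
proof -
  have fS: "finite S" using S finite_subset by blast
  let ?T = "\<lambda>S k. if k = n then S else {..<m k}"
  let ?lr = "\<lambda>S k. labels k (?T S k)"
  let ?lc = "\<lambda>j. labels j {..<p j}"
  have 1: "represents (blocks (m(n := card S)) p [Suc i..<Suc n] [2..<Suc (Suc i)]
            (\<lambda>k j. if k = n then submatrix (A n j) S UNIV else A k j))
      (concat (map (?lr S) [Suc i..<Suc n])) (concat (map ?lc [2..<Suc (Suc i)])) E0"
  proof (rule represents_blocks)
    fix k j assume "k \<in> set [Suc i..<Suc n]" "j \<in> set [2..<Suc (Suc i)]"
    then have k: "Suc i \<le> k" "k \<le> n" and j: "2 \<le> j" "j \<le> Suc i" by auto
    have Akj: "A k j \<in> carrier_mat (m k) (p j)" using k j by (intro A) auto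
    show "represents (if k = n then submatrix (A n j) S UNIV else A k j) (?lr S k) (?lc j) E0"
      using Akj S by (auto intro!: represents_submatrix_UNIV_col represents_full simp: E0_def)
  qed auto
  have 2: "represents (blocks m p [Suc i..<Suc n] [2..<Suc (Suc i)] A)
      (concat (map (?lr {..<m n}) [Suc i..<Suc n])) (concat (map ?lc [2..<Suc (Suc i)])) E0"
  proof (rule represents_blocks)
    fix k j assume "k \<in> set [Suc i..<Suc n]" "j \<in> set [2..<Suc (Suc i)]"
    then have k: "Suc i \<le> k" "k \<le> n" and j: "2 \<le> j" "j \<le> Suc i" by auto
    have Akj: "A k j \<in> carrier_mat (m k) (p j)" using k j by (intro A) auto
    show "represents (A k j) (?lr {..<m n} k) (?lc j) E0"
      using Akj by (auto intro!: represents_full simp: E0_def)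
  qed auto
  have rows: "set (concat (map (?lr S) [Suc i..<Suc n])) = {n} \<times> S \<union> P (Suc i)" if "finite S" for S
    by (subst set_concat_labels) (use i that in \<open>auto simp: P_def split: if_splits\<close>)
  have cols: "set (concat (map ?lc [2..<Suc (Suc i)])) = Q (Suc i)"
    by (subst set_concat_labels) (auto simp: Q_def)
  have dist: "distinct (concat (map ?lc [2..<Suc (Suc i)]))" by (rule distinct_concat_labels) auto
  have diff: "({n} \<times> {..<m n} \<union> P (Suc i)) - ({n} \<times> S \<union> P (Suc i)) = M - {n} \<times> S"
    by (auto simp: M_def P_def)
  let ?E = "\<lambda>c r. E0 r c"
  have "row_condition n m p A i S \<longleftrightarrow> fs.span (col_fun ?E (Q (Suc i)) ` ({n} \<times> S \<union> P (Suc i)))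
      = fs.span (col_fun ?E (Q (Suc i)) ` ({n} \<times> {..<m n} \<union> P (Suc i)))"
    unfolding row_condition_def Row_eq_Col_transpose
      Col_eq_iff_represents[OF represents_transpose[OF 1] represents_transpose[OF 2] dist] rows[OF fS] rows[OF finite_lessThan] cols ..
  also have "\<dots> \<longleftrightarrow> (\<forall>k\<in>M - {n} \<times> S. in_col_span ?E (Q (Suc i)) ({n} \<times> S \<union> P (Suc i)) k)"
    unfolding diff[symmetric] using S fS by (intro span_col_fun_eq_iff) auto
  finally show ?thesis .
qed

lemma col_choice_exists: "\<exists>L. col_choice n m p A L"
proof -
  define good where "good i T S \<longleftrightarrow> T \<subseteq> S \<and> S \<subseteq> {..<p 1} \<and> col_condition n m p A i S
    \<and> (\<forall>S'. T \<subseteq> S' \<and> S' \<subset> S \<longrightarrow> \<not> col_condition n m p A i S')" for i T S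
  have ex: "\<exists>S. good i T S" if "i \<in> {1..<n}" "T \<subseteq> {..<p 1}" for i T
    unfolding good_def
    by (rule minimal_superset_exists[OF that(2)]) (use that in \<open>auto simp: col_condition_iff N_def\<close>)
  \<comment> \<open>The sets are built downwards from \<open>L n = {}\<close>, so \<open>f t\<close>
    stands for \<open>L (n - t)\<close>. Beyond the range of the column conditions the choice is
    unconstrained.\<close>
  have "\<exists>f. \<forall>t. (f t \<subseteq> {..<p 1} \<and> (t = 0 \<longrightarrow> f t = {})) \<and> (n - Suc t \<in> {1..<n} \<longrightarrow> good (n - Suc t) (f t) (f (Suc t)))"
  proof (rule dependent_nat_choice)
    fix T :: "nat set" and t :: nat assume T: "T \<subseteq> {..<p 1} \<and> (t = 0 \<longrightarrow> T = {})"
    show "\<exists>S. (S \<subseteq> {..<p 1} \<and> (Suc t = 0 \<longrightarrow> S = {})) \<and> (n - Suc t \<in> {1..<n} \<longrightarrow> good (n - Suc t) T S)"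
    proof (cases "n - Suc t \<in> {1..<n}")
      case True
      then obtain S where "good (n - Suc t) T S" using ex T by blast
      then show ?thesis by (auto simp: good_def)
    qed auto
  qed auto
  then obtain f where f: "\<And>t. f t \<subseteq> {..<p 1}" "f 0 = {}"
    "\<And>t. n - Suc t \<in> {1..<n} \<Longrightarrow> good (n - Suc t) (f t) (f (Suc t))"
    by blast
  \<comment> \<open>\<open>L 0\<close> is not obtained by minimality; it is the set of all
    columns.\<close>
  define L where "L i = (if i = 0 then {..<p 1} else f (n - i))" for i
  have "good i (L (Suc i)) (L i)" if i: "i \<in> {1..<n}" for i
  proof -
    have "Suc (n - Suc i) = n - i" "n - Suc (n - Suc i) = i" using i by auto
    then show ?thesis using f(3)[of "n - Suc i"] i by (simp add: L_def)
  qed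
  then have "col_choice n m p A L"
    unfolding col_choice_def good_def using f(2) n by (auto simp: L_def)
  then show ?thesis by blast
qed

lemma row_choice_exists: "\<exists>K. row_choice n m p A K"
proof -
  define good where "good i T S \<longleftrightarrow> T \<subseteq> S \<and> S \<subseteq> {..<m n} \<and> row_condition n m p A i S
    \<and> (\<forall>S'. T \<subseteq> S' \<and> S' \<subset> S \<longrightarrow> \<not> row_condition n m p A i S')" for i T S
  have ex: "\<exists>S. good i T S" if "i \<in> {1..<n}" "T \<subseteq> {..<m n}" for i T
    unfolding good_def
    by (rule minimal_superset_exists[OF that(2)]) (use that in \<open>auto simp: row_condition_iff M_def\<close>)
  have "\<exists>f. \<forall>t. (f t \<subseteq> {..<m n} \<and> (t = 0 \<longrightarrow> f t = {})) \<and> (Suc t \<in> {1..<n} \<longrightarrow> good (Suc t) (f t) (f (Suc t)))"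
  proof (rule dependent_nat_choice)
    fix T :: "nat set" and t :: nat assume T: "T \<subseteq> {..<m n} \<and> (t = 0 \<longrightarrow> T = {})"
    show "\<exists>S. (S \<subseteq> {..<m n} \<and> (Suc t = 0 \<longrightarrow> S = {})) \<and> (Suc t \<in> {1..<n} \<longrightarrow> good (Suc t) T S)"
    proof (cases "Suc t \<in> {1..<n}")
      case True
      then obtain S where "good (Suc t) T S" using ex T by blast
      then show ?thesis by (auto simp: good_def)
    qed auto
  qed auto
  then obtain f where f: "\<And>t. f t \<subseteq> {..<m n}" "f 0 = {}"
    "\<And>t. Suc t \<in> {1..<n} \<Longrightarrow> good (Suc t) (f t) (f (Suc t))"
    by blast
  \<comment> \<open>\<open>K n\<close> is likewise prescribed as the set of all rows.\<close>
  define K where "K i = (if i = n then {..<m n} else f i)" for i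
  have "good i (K (i - 1)) (K i)" if i: "i \<in> {1..<n}" for i
    using f(3)[of "i - 1"] i by (auto simp: K_def)
  then have "row_choice n m p A K"
    unfolding row_choice_def good_def using f(2) n by (auto simp: K_def)
  then show ?thesis by blast
qed

lemma mrank_blocks:
  assumes "distinct rs" "\<And>k j. k \<in> set rs \<Longrightarrow> j \<in> set cs \<Longrightarrow> 1 \<le> j \<and> j \<le> k \<and> k \<le> n \<and> (k, j) \<noteq> (n, 1)"
  shows "mrank (blocks m p rs cs A) = rk E0 (SIGMA k:set rs. {..<m k}) (SIGMA j:set cs. {..<p j})"
proof -
  have "represents (blocks m p rs cs A) (concat (map (\<lambda>k. labels k {..<m k}) rs))
      (concat (map (\<lambda>j. labels j {..<p j}) cs)) E0"
  proof (rule represents_blocks)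
    fix k j assume "k \<in> set rs" "j \<in> set cs"
    then have "A k j \<in> carrier_mat (m k) (p j)" using A assms(2) by blast
    then show "represents (A k j) (labels k {..<m k}) (labels j {..<p j}) E0"
      by (rule represents_full) (simp add: E0_def)
  qed auto
  from mrank_represents[OF this] show ?thesis
    using assms(1) by (simp add: distinct_concat_labels set_concat_labels del: set_concat)
qed

end

section \<open>A fixed choice of index sets: independence from minimality\<close>

locale index_choice = completion +
  fixes L K :: "nat \<Rightarrow> nat set"
  assumes L: "col_choice n m p A L" and K: "row_choice n m p A K"
begin

lemma col_choiceD:
  assumes "i \<in> {1..<n}"
  shows "L (Suc i) \<subseteq> L i" "L i \<subseteq> L 0" "col_condition n m p A i (L i)"
    "\<And>S. L (Suc i) \<subseteq> S \<Longrightarrow> S \<subset> L i \<Longrightarrow> \<not> col_condition n m p A i S"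
  using L[unfolded col_choice_def, THEN conjunct2, THEN conjunct2, THEN bspec, OF assms] by simp_all

lemma row_choiceD:
  assumes "i \<in> {1..<n}"
  shows "K (i - 1) \<subseteq> K i" "K i \<subseteq> K n" "row_condition n m p A i (K i)"
    "\<And>S. K (i - 1) \<subseteq> S \<Longrightarrow> S \<subset> K i \<Longrightarrow> \<not> row_condition n m p A i S"
  using K[unfolded row_choice_def, THEN conjunct2, THEN conjunct2, THEN bspec, OF assms] by simp_all

lemma L_facts:
  shows "L n = {}" "L 0 = {..<p 1}" "i < n \<Longrightarrow> L (Suc i) \<subseteq> L i" "i \<le> n \<Longrightarrow> L i \<subseteq> {..<p 1}"
proof -
  show 0: "L n = {}" "L 0 = {..<p 1}" using L by (auto simp: col_choice_def)
  show 1: "L i \<subseteq> {..<p 1}" if "i \<le> n" for i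
    using 0 col_choiceD(2)[of i] that by (cases "i = 0"; cases "i = n") simp_all
  show "L (Suc i) \<subseteq> L i" if "i < n"
    using col_choiceD(1)[of i] that 1[of "Suc i"] 0 by (cases "i = 0") simp_all
qed

lemma K_facts:
  shows "K n = {..<m n}" "K 0 = {}" "i < n \<Longrightarrow> K i \<subseteq> K (Suc i)" "i \<le> n \<Longrightarrow> K i \<subseteq> {..<m n}"
proof -
  show 0: "K n = {..<m n}" "K 0 = {}" using K by (auto simp: row_choice_def)
  show 1: "K i \<subseteq> {..<m n}" if "i \<le> n" for i
    using 0 row_choiceD(2)[of i] that by (cases "i = 0"; cases "i = n") simp_all
  show "K i \<subseteq> K (Suc i)" if i: "i < n"
  proof (cases "Suc i = n")
    case True
    then show ?thesis using 1[of i] 0 i by simp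
  next
    case False
    then have "Suc i \<in> {1..<n}" using i by simp
    from row_choiceD(1)[OF this] show ?thesis by simp
  qed
qed

lemma L_in_col_span:
  assumes "i \<in> {1..<n}" "l \<in> N - {1} \<times> L i"
  shows "in_col_span E0 (P i) ({1} \<times> L i \<union> Q i) l"
proof -
  have "L i \<subseteq> {..<p 1}" using assms(1) by (intro L_facts) simp
  from col_choiceD(3)[OF assms(1), unfolded col_condition_iff[OF assms(1) this]] assms(2)
  show ?thesis by blast
qed

lemma K_in_col_span:
  assumes "i \<in> {1..<n}" "k \<in> M - {n} \<times> K i"
  shows "in_col_span (\<lambda>c r. E0 r c) (Q (Suc i)) ({n} \<times> K i \<union> P (Suc i)) k"
proof -
  have "K i \<subseteq> {..<m n}" using assms(1) by (intro K_facts) simp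
  from row_choiceD(3)[OF assms(1), unfolded row_condition_iff[OF assms(1) this]] assms(2)
  show ?thesis by blast
qed

lemma finite_LK: "i \<le> n \<Longrightarrow> finite (L i)" "i \<le> n \<Longrightarrow> finite (K i)"
  using L_facts(4)[of i] K_facts(4)[of i] by (simp_all add: finite_subset)

lemma P_anti: "i \<le> i' \<Longrightarrow> P i' \<subseteq> P i" and Q_incr: "i \<le> i' \<Longrightarrow> Q i \<subseteq> Q i'"
  by (auto simp: P_def Q_def)

lemma disj: "P i \<inter> M = {}" "N \<inter> Q i = {}" "({n} \<times> S) \<inter> P i = {}" "({1} \<times> S) \<inter> Q i = {}"
  by (auto simp: P_def Q_def M_def N_def)

text \<open>Downward induction from the empty \<open>L n\<close>. The step from \<open>i + 1\<close>
  to \<open>i\<close> enlarges the row set, shrinks \<open>Q\<close>, and adds to \<open>L\<close>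
  only columns that minimality shows to be irredundant, as \<open>col_indep_of_minimal\<close>
  demands.\<close>

lemma L_independent:
  assumes "i \<in> {1..n}"
  shows "col_indep E0 (P i) ({1} \<times> L i) (Q i)"
proof -
  have "i \<le> n" using assms by simp
  then show ?thesis
  proof (induction i rule: inc_induct)
    case base
    then show ?case by (simp add: L_facts col_indep_def)
  next
    case (step i)
    then have i: "i \<in> {1..<n}" using assms by auto
    show ?case
    proof (rule col_indep_of_minimal[OF _ _ _ _ _ _ step.IH])
      fix x :: "nat \<times> nat" assume x: "x \<in> {1} \<times> L i - {1} \<times> L (Suc i)"
      then obtain l where l: "x = (1, l)" "l \<in> L i" "l \<notin> L (Suc i)" by auto
      define S where "S = L i - {l}"
      have S1: "{1} \<times> S = {1} \<times> L i - {x}" by (auto simp: S_def l)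
      have "L (Suc i) \<subseteq> S" "S \<subset> L i" using l L_facts(3)[of i] i by (auto simp: S_def)
      then have "\<not> col_condition n m p A i S" using col_choiceD(4)[OF i] by blast
      moreover have S: "S \<subseteq> {..<p 1}" using L_facts(4)[of i] i by (auto simp: S_def)
      ultimately have n: "\<not> (\<forall>l\<in>N - ({1} \<times> L i - {x}). in_col_span E0 (P i) ({1} \<times> L i - {x} \<union> Q i) l)"
        unfolding S1[symmetric] col_condition_iff[OF i S] by simp
      show "\<not> in_col_span E0 (P i) ({1} \<times> L i - {x} \<union> Q i) x"
      proof
        assume x: "in_col_span E0 (P i) ({1} \<times> L i - {x} \<union> Q i) x"
        have "in_col_span E0 (P i) ({1} \<times> L i - {x} \<union> Q i) c" if "c \<in> N - ({1} \<times> L i - {x})" for c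
          by (rule in_col_span_all_remove[OF _ _ L_in_col_span[OF i] x that]) (use i finite_LK[of i] in simp_all)
        with n show False by blast
      qed
    qed (use i finite_LK[of i] L_facts(3)[of i] P_anti[of i "Suc i"] Q_incr[of i "Suc i"] disj(4)[of "L i" i] in auto)
  qed
qed

text \<open>Mirror image of the column case, upwards from the empty \<open>K 0\<close>. Row
  condition \<open>i\<close> yields independence at level \<open>i + 1\<close>, which is why
  \<open>K (i - 1)\<close> goes with level \<open>i\<close>.\<close>

lemma K_independent:
  assumes "i \<le> n"
  shows "0 < i \<Longrightarrow> col_indep (\<lambda>c r. E0 r c) (Q i) ({n} \<times> K (i - 1)) (P i)"
  using assms
proof (induction i)
  case (Suc i)
  show ?case
  proof (cases "i = 0")
    case True
    then show ?thesis by (simp add: K_facts col_indep_def)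
  next
    case False
    then have i: "i \<in> {1..<n}" using Suc.prems by auto
    have IH: "col_indep (\<lambda>c r. E0 r c) (Q i) ({n} \<times> K (i - 1)) (P i)" using Suc i by auto
    have pred: "K (i - 1) \<subseteq> K i" using row_choiceD(1)[OF i] .
    have "col_indep (\<lambda>c r. E0 r c) (Q (Suc i)) ({n} \<times> K i) (P (Suc i))"
    proof (rule col_indep_of_minimal[OF _ _ _ _ _ _ IH])
      fix x :: "nat \<times> nat" assume x: "x \<in> {n} \<times> K i - {n} \<times> K (i - 1)"
      then obtain k where k: "x = (n, k)" "k \<in> K i" "k \<notin> K (i - 1)" by auto
      define S where "S = K i - {k}"
      have S1: "{n} \<times> S = {n} \<times> K i - {x}" by (auto simp: S_def k)
      have "K (i - 1) \<subseteq> S" "S \<subset> K i" using k pred by (auto simp: S_def)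
      then have "\<not> row_condition n m p A i S" using row_choiceD(4)[OF i] by blast
      moreover have S: "S \<subseteq> {..<m n}" using K_facts(4)[of i] i by (auto simp: S_def)
      ultimately have n: "\<not> (\<forall>l\<in>M - ({n} \<times> K i - {x}).
          in_col_span (\<lambda>c r. E0 r c) (Q (Suc i)) ({n} \<times> K i - {x} \<union> P (Suc i)) l)"
        unfolding S1[symmetric] row_condition_iff[OF i S] by simp
      show "\<not> in_col_span (\<lambda>c r. E0 r c) (Q (Suc i)) ({n} \<times> K i - {x} \<union> P (Suc i)) x"
      proof
        assume x: "in_col_span (\<lambda>c r. E0 r c) (Q (Suc i)) ({n} \<times> K i - {x} \<union> P (Suc i)) x"
        have "in_col_span (\<lambda>c r. E0 r c) (Q (Suc i)) ({n} \<times> K i - {x} \<union> P (Suc i)) c"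
          if "c \<in> M - ({n} \<times> K i - {x})" for c
          by (rule in_col_span_all_remove[OF _ _ K_in_col_span[OF i] x that]) (use i finite_LK[of i] in simp_all)
        with n show False by blast
      qed
    qed (use i finite_LK[of i] pred P_anti[of i "Suc i"] Q_incr[of i "Suc i"] disj(3)[of "K i" "Suc i"] in auto)
    then show ?thesis by simp
  qed
qed simp

sublocale lv: levels n P Q M N E0 "\<lambda>i. {1} \<times> L i" "\<lambda>i. {n} \<times> K i"
proof
  fix i l assume i: "i \<in> {1..n}" and l: "l \<in> N"
  show "in_col_span E0 (P i) ({1} \<times> L i \<union> Q i) l"
  proof (cases "i = n")
    case True
    \<comment> \<open>There is no column condition for \<open>i = n\<close>, but \<open>P n\<close>
      is empty and the span condition is vacuous.\<close>
    then show ?thesis by (simp add: P_def in_col_span_def)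
  next
    case False
    then have "i \<in> {1..<n}" using i by auto
    then show ?thesis
      using L_in_col_span[of i l] l finite_LK[of i] by (cases "l \<in> {1} \<times> L i") (auto intro!: in_col_span_member)
  qed
next
  fix i k assume i: "i \<in> {1..n}" and k: "k \<in> M"
  show "in_col_span (\<lambda>c r. E0 r c) (Q i) ({n} \<times> K (i - 1) \<union> P i) k"
  proof (cases "i = 1")
    case True
    \<comment> \<open>\<open>Q 1\<close> is empty, so the empty \<open>K 0\<close> suffices.\<close>
    then show ?thesis by (simp add: Q_def in_col_span_def)
  next
    case False
    then have "i - 1 \<in> {1..<n}" "Suc (i - 1) = i" using i by auto
    then show ?thesis
      using K_in_col_span[of "i - 1" k] k finite_LK(2)[of "i - 1"]
      by (cases "k \<in> {n} \<times> K (i - 1)") (auto intro!: in_col_span_member)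
  qed
next
  show "col_indep E0 (P i) ({1} \<times> L i) (Q i)" if "i \<in> {1..n}" for i
    using L_independent[OF that] .
  show "col_indep (\<lambda>c r. E0 r c) (Q i) ({n} \<times> K (i - 1)) (P i)" if "i \<in> {1..n}" for i
    using K_independent[of i] that by simp
next
  show "{1} \<times> L (Suc i) \<subseteq> {1} \<times> L i" "{n} \<times> K i \<subseteq> {n} \<times> K (Suc i)" if "i < n" for i
    using L_facts(3)[OF that] K_facts(3)[OF that] by auto
qed (use P_anti Q_incr disj L_facts(1,2) K_facts(1,2) in \<open>simp_all add: M_def N_def\<close>)

section \<open>Ranks of the matrices \<open>H\<close> and of the step matrices\<close>

lemma fill_entry:
  "lv.fill (entry X) (k, a) (j, b) =
    (if k = n \<and> j = 1 \<and> a < m n \<and> b < p 1 then X $$ (a, b) else A k j $$ (a, b))"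
  unfolding lv.fill_def by (auto simp: M_def N_def entry_def E0_def)

lemma mrank_H:
  assumes X: "X \<in> carrier_mat (m n) (p 1)" and i: "i \<in> {1..n}"
  shows "mrank (H n m p A i X) = rk (lv.fill (entry X)) (P i \<union> M) (N \<union> Q i)"
proof -
  have "represents (H n m p A i X) (concat (map (\<lambda>k. labels k {..<m k}) [i..<Suc n]))
      (concat (map (\<lambda>j. labels j {..<p j}) [1..<Suc i])) (lv.fill (entry X))"
    unfolding H_def
  proof (rule represents_blocks)
    fix k j assume "k \<in> set [i..<Suc n]" "j \<in> set [1..<Suc i]"
    then have k: "i \<le> k" "k \<le> n" and j: "1 \<le> j" "j \<le> i" by auto
    have Akj: "A k j \<in> carrier_mat (m k) (p j)" if "(k, j) \<noteq> (n, 1)" using k j that by (intro A) auto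
    show "represents (if (k, j) = (n, 1) then X else A k j) (labels k {..<m k}) (labels j {..<p j}) (lv.fill (entry X))"
    proof (cases "(k, j) = (n, 1)")
      case True
      then show ?thesis using X by (auto intro!: represents_full simp: fill_entry)
    next
      case False
      then show ?thesis using Akj by (auto intro!: represents_full simp: fill_entry)
    qed
  qed auto
  from mrank_represents[OF this] have
    "mrank (H n m p A i X) = rk (lv.fill (entry X)) (SIGMA k:set [i..<Suc n]. {..<m k}) (SIGMA j:set [1..<Suc i]. {..<p j})"
    by (simp add: distinct_concat_labels set_concat_labels del: set_concat upt_Suc)
  moreover have "(SIGMA k:set [i..<Suc n]. {..<m k}) = P i \<union> M"
    using i by (auto simp: P_def M_def)
  moreover have "(SIGMA j:set [1..<Suc i]. {..<p j}) = N \<union> Q i"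
    using i by (auto simp: Q_def N_def not_less_eq_eq)
  ultimately show ?thesis by simp
qed

lemma I_set_subset: "i \<le> n \<Longrightarrow> I_set K i \<subseteq> {..<m n}"
  and L_bar_subset: "L_bar L i \<subseteq> {..<p 1}"
  using K_facts(4)[of i] L_facts(2) by (auto simp: I_set_def L_bar_def)

lemma block_sets:
  "{n} \<times> K i - {n} \<times> K (i - 1) = {n} \<times> I_set K i" "N - {1} \<times> L i = {1} \<times> L_bar L i"
  using L_facts(2) by (auto simp: I_set_def L_bar_def N_def)

text \<open>Giving the candidate block as a submatrix of a full-size \<open>Z\<close> turns the step
  matrix into \<open>X\<close> with one block overwritten, the form treated by
  \<open>compatible_at_update\<close>. The two row groups taken from block row \<open>n\<close> join
  to \<open>K i\<close>, and the two column groups from block column 1 join to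
  \<open>N\<close>.\<close>

lemma mrank_step:
  assumes X: "X \<in> carrier_mat (m n) (p 1)" and Z: "Z \<in> carrier_mat (m n) (p 1)" and i: "i \<in> {1..n}"
  shows "mrank (step_mat n m p A L K X i (submatrix Z (I_set K i) (L_bar L i))) =
    rk (lv.fill (\<lambda>r c. if r \<in> {n} \<times> K i - {n} \<times> K (i - 1) \<and> c \<in> N - {1} \<times> L i then entry Z r c else entry X r c))
      (P i \<union> {n} \<times> K i) (N \<union> Q i)" (is "_ = rk ?E _ _")
proof -
  define E where "E = ?E"
  let ?I = "I_set K i" and ?Lb = "L_bar L i" and ?K = "K (i - 1)"
  let ?lr = "\<lambda>k. labels k {..<m k}" and ?lc = "\<lambda>j. labels j {..<p j}"
  let ?\<rho>s = "map ?lr [i..<n] @ [labels n ?K, labels n ?I]"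
  let ?\<kappa>s = "[labels 1 ?Lb, labels 1 (L i)] @ map ?lc [2..<Suc i]"
  have in': "i \<le> n" "i - 1 \<le> n" using i by auto
  have subs: "?I \<subseteq> {..<m n}" "?K \<subseteq> {..<m n}" "?Lb \<subseteq> {..<p 1}" "L i \<subseteq> {..<p 1}"
    using in' I_set_subset K_facts(4) L_facts(4) L_bar_subset by auto
  have fin: "finite ?I" "finite ?K" "finite ?Lb" "finite (L i)"
    using subs by (simp_all add: finite_subset)
  have EA: "E (k, a) (j, b) = A k j $$ (a, b)" if "(k, j) \<noteq> (n, 1)" for k j a b
    using that unfolding E_def lv.fill_def by (auto simp: M_def N_def E0_def)
  have EZ: "E (n, a) (1, b) = Z $$ (a, b)" if "a \<in> ?I" "b \<in> ?Lb" for a b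
    using that subs unfolding E_def lv.fill_def block_sets by (auto simp: M_def N_def entry_def)
  have EX: "E (n, a) (1, b) = X $$ (a, b)" if "a < m n" "b < p 1" "a \<notin> ?I \<or> b \<notin> ?Lb" for a b
    using that unfolding E_def lv.fill_def block_sets by (auto simp: M_def N_def entry_def)
  have dI: "a \<in> ?K \<Longrightarrow> a \<notin> ?I" "b \<in> L i \<Longrightarrow> b \<notin> ?Lb" for a b
    by (auto simp: I_set_def L_bar_def)
  have len: "card ?Lb + card (L i) + (\<Sum>j\<leftarrow>[2..<Suc i]. p j) = length (concat ?\<kappa>s)"
    by (simp add: length_concat comp_def)
  have "represents (step_mat n m p A L K X i (submatrix Z ?I ?Lb)) (concat ?\<rho>s) (concat ?\<kappa>s) E"
    unfolding step_mat_def len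
  proof (rule represents_vcat, rule list_all2_appendI)
    show "list_all2 (\<lambda>B \<rho>. represents B \<rho> (concat ?\<kappa>s) E)
        (map (\<lambda>k. hcat (m k) ([submatrix (A k 1) UNIV ?Lb, submatrix (A k 1) UNIV (L i)] @ map (A k) [2..<Suc i])) [i..<n])
        (map ?lr [i..<n])"
      unfolding list_all2_map1 list_all2_map2
    proof (rule list.rel_refl_strong)
      fix k assume "k \<in> set [i..<n]"
      then have k: "i \<le> k" "k < n" by auto
      have Akj: "A k j \<in> carrier_mat (m k) (p j)" if "1 \<le> j" "j \<le> i" for j using k that by (intro A) auto
      have "represents (hcat (length (?lr k)) ([submatrix (A k 1) UNIV ?Lb, submatrix (A k 1) UNIV (L i)] @ map (A k) [2..<Suc i]))
          (?lr k) (concat ?\<kappa>s) E"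
      proof (rule represents_hcat, rule list_all2_appendI)
        show "list_all2 (\<lambda>B \<kappa>. represents B (?lr k) \<kappa> E) [submatrix (A k 1) UNIV ?Lb, submatrix (A k 1) UNIV (L i)]
            [labels 1 ?Lb, labels 1 (L i)]"
          using Akj[of 1] i k subs by (auto intro!: represents_submatrix_UNIV_row[of _ _ "p 1"] EA[unfolded One_nat_def])
        show "list_all2 (\<lambda>B \<kappa>. represents B (?lr k) \<kappa> E) (map (A k) [2..<Suc i]) (map ?lc [2..<Suc i])"
          unfolding list_all2_map1 list_all2_map2
        proof (rule list.rel_refl_strong)
          fix j assume "j \<in> set [2..<Suc i]"
          then show "represents (A k j) (?lr k) (?lc j) E" using Akj by (intro represents_full EA) auto
        qed
      qed
      then show "represents (hcat (m k) ([submatrix (A k 1) UNIV ?Lb, submatrix (A k 1) UNIV (L i)] @ map (A k) [2..<Suc i]))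
          (?lr k) (concat ?\<kappa>s) E" by simp
    qed
    have hX: "represents (hcat (card S) ([B, submatrix X S (L i)] @ map (\<lambda>j. submatrix (A n j) S UNIV) [2..<Suc i]))
        (labels n S) (concat ?\<kappa>s) E"
      if S: "S \<subseteq> {..<m n}" and B: "represents B (labels n S) (labels 1 ?Lb) E" for S B
    proof -
      have "represents (hcat (length (labels n S)) ([B, submatrix X S (L i)] @ map (\<lambda>j. submatrix (A n j) S UNIV) [2..<Suc i]))
          (labels n S) (concat ?\<kappa>s) E"
      proof (rule represents_hcat, rule list_all2_appendI)
        have "represents (submatrix X S (L i)) (labels n S) (labels 1 (L i)) E"
        proof (rule represents_submatrix[OF X S subs(4)])
          fix a b assume "a \<in> S" "b \<in> L i"
          then show "E (n, a) (1, b) = X $$ (a, b)" using S subs dI by (intro EX) auto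
        qed
        then show "list_all2 (\<lambda>B \<kappa>. represents B (labels n S) \<kappa> E) [B, submatrix X S (L i)] [labels 1 ?Lb, labels 1 (L i)]"
          using B by simp
        show "list_all2 (\<lambda>B \<kappa>. represents B (labels n S) \<kappa> E) (map (\<lambda>j. submatrix (A n j) S UNIV) [2..<Suc i]) (map ?lc [2..<Suc i])"
          unfolding list_all2_map1 list_all2_map2
        proof (rule list.rel_refl_strong)
          fix j assume j: "j \<in> set [2..<Suc i]"
          then have "A n j \<in> carrier_mat (m n) (p j)" using in' by (intro A) auto
          then show "represents (submatrix (A n j) S UNIV) (labels n S) (?lc j) E"
            using S j by (intro represents_submatrix_UNIV_col EA) auto
        qed
      qed
      then show ?thesis by simp
    qed
    have "represents (submatrix X ?K ?Lb) (labels n ?K) (labels 1 ?Lb) E"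
    proof (rule represents_submatrix[OF X subs(2,3)])
      fix a b assume "a \<in> ?K" "b \<in> ?Lb"
      then show "E (n, a) (1, b) = X $$ (a, b)" using subs dI by (intro EX) auto
    qed
    moreover have "represents (submatrix Z ?I ?Lb) (labels n ?I) (labels 1 ?Lb) E"
      by (rule represents_submatrix[OF Z subs(1,3) EZ])
    ultimately show "list_all2 (\<lambda>B \<rho>. represents B \<rho> (concat ?\<kappa>s) E)
       [hcat (card ?K) ([submatrix X ?K ?Lb, submatrix X ?K (L i)] @ map (\<lambda>j. submatrix (A n j) ?K UNIV) [2..<Suc i]),
        hcat (card ?I) ([submatrix Z ?I ?Lb, submatrix X ?I (L i)] @ map (\<lambda>j. submatrix (A n j) ?I UNIV) [2..<Suc i])]
       [labels n ?K, labels n ?I]"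
      using hX subs(1,2) by (simp only: list_all2_Cons list_all2_Nil simp_thms)
  qed
  moreover have "distinct (concat ?\<rho>s)"
  proof -
    have "distinct (concat (map ?lr [i..<n]))" by (rule distinct_concat_labels) auto
    moreover have "set (concat (map ?lr [i..<n])) = P i"
      by (subst set_concat_labels) (auto simp: P_def)
    ultimately show ?thesis
      using fin disj(3)[of _ i] dI by (auto simp: set_labels distinct_labels simp del: set_concat)
  qed
  moreover have "set (concat ?\<rho>s) = P i \<union> {n} \<times> K i"
  proof -
    have "set (concat (map ?lr [i..<n])) = P i"
      by (subst set_concat_labels) (auto simp: P_def)
    moreover have "K (i - 1) \<subseteq> K i" using K_facts(3)[of "i - 1"] i by (cases i) simp_all
    then have "?K \<union> ?I = K i" by (auto simp: I_set_def)
    ultimately show ?thesis using fin by (auto simp: set_labels simp del: set_concat)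
  qed
  moreover have "set (concat ?\<kappa>s) = N \<union> Q i"
  proof -
    have "set (concat (map ?lc [2..<Suc i])) = Q i"
      by (subst set_concat_labels) (auto simp: Q_def)
    moreover have "?Lb \<union> L i = {..<p 1}" using subs L_facts(2) by (auto simp: L_bar_def)
    ultimately show ?thesis using fin by (auto simp: set_labels N_def simp del: set_concat upt_Suc)
  qed
  ultimately show ?thesis using mrank_represents[of _ "concat ?\<rho>s" "concat ?\<kappa>s" E] unfolding E_def by simp
qed

text \<open>The bound of \<open>rk_fill\<close> is attained by exactly one block, the one with the
  entries \<open>g\<close>. Hence a unique minimizer exists for any \<open>X\<close>, and the left
  side only says that \<open>X\<close> carries it.\<close>

lemma step_iff_cond:
  assumes X: "X \<in> carrier_mat (m n) (p 1)" and i: "i \<in> {1..n}"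
  shows "(\<forall>Y. is_arg_min (\<lambda>Y. mrank (step_mat n m p A L K X i Y))
          (\<lambda>Y. Y \<in> carrier_mat (card (I_set K i)) (card (L_bar L i))) Y
        \<longleftrightarrow> Y = submatrix X (I_set K i) (L_bar L i)) \<longleftrightarrow> lv.compatible_at (entry X) i ({n} \<times> K i)"
    (is "(\<forall>Y. ?min Y \<longleftrightarrow> Y = ?sub X) \<longleftrightarrow> _")
proof -
  have I: "I_set K i \<subseteq> {..<m n}" and Lb: "L_bar L i \<subseteq> {..<p 1}"
    using I_set_subset L_bar_subset i by auto
  define f where "f Y = mrank (step_mat n m p A L K X i Y)" for Y
  define c where "c = card ({1::nat} \<times> L i) + rk E0 (P i \<union> {n} \<times> K i) (Q i)"
  define g where "g k l = lv.entry_lin i (n, k) (1, l) (entry X) + lv.entry_const i (n, k) (1, l)" for k l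
  define good where "good Z \<longleftrightarrow> (\<forall>k\<in>I_set K i. \<forall>l\<in>L_bar L i. Z $$ (k, l) = g k l)" for Z
  have KM: "{n} \<times> K i \<subseteq> M" using lv.K_subset i by simp
  have ball: "(\<forall>r\<in>{n} \<times> S. \<forall>s\<in>{1} \<times> T. R r s) \<longleftrightarrow> (\<forall>k\<in>S. \<forall>l\<in>T. R (n, k) (1, l))"
    for S T :: "nat set" and R :: "nat \<times> nat \<Rightarrow> nat \<times> nat \<Rightarrow> bool"
    by auto
  have f: "c \<le> f (?sub Z)" "f (?sub Z) = c \<longleftrightarrow> good Z" if Z: "Z \<in> carrier_mat (m n) (p 1)" for Z
  proof -
    show "c \<le> f (?sub Z)" unfolding f_def mrank_step[OF X Z i] c_def by (rule lv.rk_fill(1)[OF i KM])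
    have "f (?sub Z) = c \<longleftrightarrow> (\<forall>k\<in>{n} \<times> K i - {n} \<times> K (i - 1). \<forall>l\<in>N - {1} \<times> L i.
        entry Z k l = lv.entry_lin i k l (entry X) + lv.entry_const i k l)"
      unfolding f_def mrank_step[OF X Z i] c_def lv.rk_fill(2)[OF i KM] lv.compatible_at_update[OF i] ..
    then show "f (?sub Z) = c \<longleftrightarrow> good Z"
      unfolding block_sets ball good_def g_def by (simp add: entry_def)
  qed
  \<comment> \<open>A matrix carrying \<open>g\<close> on the block: it attains the bound, so the
    bound is the minimum.\<close>
  define Z0 where "Z0 = mat (m n) (p 1) (\<lambda>(k, l). g k l)"
  have Z0: "Z0 \<in> carrier_mat (m n) (p 1)" by (simp add: Z0_def)
  have good_iff: "good Z \<longleftrightarrow> ?sub Z = ?sub Z0" if Z: "Z \<in> carrier_mat (m n) (p 1)" for Z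
  proof -
    have "Z0 $$ (k, l) = g k l" if "k \<in> I_set K i" "l \<in> L_bar L i" for k l
    proof -
      have "k < m n" "l < p 1" using that I Lb by auto
      then show ?thesis by (simp add: Z0_def)
    qed
    then show ?thesis unfolding good_def submatrix_eq_iff[OF Z Z0 I Lb] by simp
  qed
  have f0: "f (?sub Z0) = c" using f(2)[OF Z0] good_iff[OF Z0] by simp
  have min: "?min Y \<longleftrightarrow> Y = ?sub Z0" for Y
  proof
    assume Y: "?min Y"
    then obtain Z where Z: "Z \<in> carrier_mat (m n) (p 1)" "?sub Z = Y"
      using submatrix_surj[OF _ I Lb] unfolding is_arg_min_def by blast
    have "\<not> f (?sub Z0) < f Y"
      using Y submatrix_carrier[OF Z0 I Lb] unfolding is_arg_min_def f_def by blast
    then have "f (?sub Z) = c" using f(1)[OF Z(1)] f0 Z(2) by simp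
    then show "Y = ?sub Z0" using f(2)[OF Z(1)] good_iff[OF Z(1)] Z(2) by simp
  next
    assume Y: "Y = ?sub Z0"
    have "c \<le> f Y'" if Y': "Y' \<in> carrier_mat (card (I_set K i)) (card (L_bar L i))" for Y'
    proof -
      obtain Z where "Z \<in> carrier_mat (m n) (p 1)" "?sub Z = Y'"
        using submatrix_surj[OF Y' I Lb] .
      then show ?thesis using f(1) by blast
    qed
    then show "?min Y"
      using Y f0 submatrix_carrier[OF Z0 I Lb] unfolding is_arg_min_def f_def[symmetric]
      by (auto simp: not_less)
  qed
  have "(\<forall>Y. ?min Y \<longleftrightarrow> Y = ?sub X) \<longleftrightarrow> ?sub X = ?sub Z0"
    unfolding min by metis
  also have "\<dots> \<longleftrightarrow> good X" using good_iff[OF X] by simp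
  also have "\<dots> \<longleftrightarrow> lv.compatible_at (entry X) i ({n} \<times> K i)"
    unfolding lv.compatible_at_iff_entries[OF i] block_sets ball good_def g_def by (simp add: entry_def)
  finally show ?thesis .
qed

section \<open>Solutions and construction outputs as matrices solving the triangular system\<close>

definition mat_of :: "(nat \<times> nat \<Rightarrow> nat \<times> nat \<Rightarrow> 'a) \<Rightarrow> 'a mat" where
  "mat_of X = mat (m n) (p 1) (\<lambda>(a, b). X (n, a) (1, b))"

lemma mat_of_carrier [simp]: "mat_of X \<in> carrier_mat (m n) (p 1)"
  by (simp add: mat_of_def)

lemma entry_mat_of: "k \<in> M \<Longrightarrow> l \<in> N \<Longrightarrow> entry (mat_of X) k l = X k l"
  by (auto simp: mat_of_def entry_def M_def N_def)

lemma eq_matI_entry: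
  assumes "X \<in> carrier_mat (m n) (p 1)" "Y \<in> carrier_mat (m n) (p 1)"
    and "\<And>k l. k \<in> M \<Longrightarrow> l \<in> N \<Longrightarrow> entry X k l = entry Y k l"
  shows "X = Y"
proof (rule eq_matI)
  fix a b assume "a < dim_row Y" "b < dim_col Y"
  then have "(n, a) \<in> M" "(1, b) \<in> N" using assms(2) by (auto simp: M_def N_def)
  from assms(3)[OF this] show "X $$ (a, b) = Y $$ (a, b)" by (simp add: entry_def)
qed (use assms in auto)

abbreviation inhom :: "nat \<times> nat \<Rightarrow> nat \<times> nat \<Rightarrow> 'a" where
  "inhom \<equiv> \<lambda>k. lv.entry_const (lv.level k) k"

abbreviation free_cols :: "nat \<times> nat \<Rightarrow> (nat \<times> nat) set" where
  "free_cols k \<equiv> {1} \<times> L (lv.level k)"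

lemma free_cols_subset: "k \<in> M \<Longrightarrow> free_cols k \<subseteq> N"
  using lv.level(1)[of k] lv.L_subset[of "lv.level k"] by simp

lemma solves_matrix_exists:
  "\<exists>X\<in>carrier_mat (m n) (p 1). (\<forall>k\<in>M. \<forall>l\<in>free_cols k. entry X k l = F k l) \<and> lv.solves c (entry X)"
proof -
  obtain X where X: "\<forall>k\<in>M. \<forall>l\<in>free_cols k. X k l = F k l" "lv.solves c X"
    using lv.solves_exists by blast
  have "lv.solves c (entry (mat_of X))"
    using X(2) lv.solves_cong[of "entry (mat_of X)" X c c] entry_mat_of by blast
  moreover have "\<forall>k\<in>M. \<forall>l\<in>free_cols k. entry (mat_of X) k l = F k l"
  proof (intro ballI)
    fix k l assume k: "k \<in> M" and l: "l \<in> free_cols k"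
    then have "entry (mat_of X) k l = X k l" using free_cols_subset[OF k] by (intro entry_mat_of) blast+
    with X(1) k l show "entry (mat_of X) k l = F k l" by auto
  qed
  ultimately show ?thesis using mat_of_carrier by blast
qed

lemma solves_matrix_unique:
  assumes "X \<in> carrier_mat (m n) (p 1)" "Y \<in> carrier_mat (m n) (p 1)"
    and "lv.solves c (entry X)" "lv.solves c (entry Y)"
    and "\<And>k l. k \<in> M \<Longrightarrow> l \<in> free_cols k \<Longrightarrow> entry X k l = entry Y k l"
  shows "X = Y"
  using assms(1,2) lv.solves_unique[OF assms(3,4,5)] by (rule eq_matI_entry)

text \<open>One matrix \<open>X0\<close> that solves the triangular system attains the bounds for
  all \<open>i\<close> simultaneously. So each separate minimum equals its bound, and minimality for
  \<open>i\<close> is compatibility at level \<open>i\<close>.\<close>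

lemma is_solution_iff:
  "is_solution n m p A X \<longleftrightarrow> X \<in> carrier_mat (m n) (p 1) \<and> lv.solves inhom (entry X)"
proof -
  define c where "c i = card ({1::nat} \<times> L i) + rk E0 (P i \<union> M) (Q i)" for i
  have le: "c i \<le> mrank (H n m p A i Z)" and eq: "mrank (H n m p A i Z) = c i \<longleftrightarrow> lv.compatible_at (entry Z) i M"
    if "i \<in> {1..n}" "Z \<in> carrier_mat (m n) (p 1)" for i Z
    unfolding mrank_H[OF that(2,1)] c_def using lv.rk_fill[OF that(1) subset_refl] by auto
  obtain X0 where X0: "X0 \<in> carrier_mat (m n) (p 1)" "lv.solves inhom (entry X0)"
    using solves_matrix_exists by blast
  have X0c: "mrank (H n m p A i X0) = c i" if "i \<in> {1..n}" for i
    using eq[OF that X0(1)] X0(2) that unfolding lv.compatible_at_all_iff_solves[symmetric] by blast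
  have "is_arg_min (\<lambda>Z. mrank (H n m p A i Z)) (\<lambda>Z. Z \<in> carrier_mat (m n) (p 1)) X
      \<longleftrightarrow> X \<in> carrier_mat (m n) (p 1) \<and> lv.compatible_at (entry X) i M" if i: "i \<in> {1..n}" for i
  proof -
    have "(\<nexists>Z. Z \<in> carrier_mat (m n) (p 1) \<and> mrank (H n m p A i Z) < mrank (H n m p A i X))
        \<longleftrightarrow> mrank (H n m p A i X) = c i" if X: "X \<in> carrier_mat (m n) (p 1)"
    proof
      assume "\<nexists>Z. Z \<in> carrier_mat (m n) (p 1) \<and> mrank (H n m p A i Z) < mrank (H n m p A i X)"
      then have "\<not> mrank (H n m p A i X0) < mrank (H n m p A i X)" using X0(1) by blast
      then show "mrank (H n m p A i X) = c i" using le[OF i X] X0c[OF i] by simp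
    next
      assume "mrank (H n m p A i X) = c i"
      then show "\<nexists>Z. Z \<in> carrier_mat (m n) (p 1) \<and> mrank (H n m p A i Z) < mrank (H n m p A i X)"
        using le[OF i] by (auto simp: not_less)
    qed
    then show ?thesis unfolding is_arg_min_def using eq[OF i] by blast
  qed
  then have "is_solution n m p A X \<longleftrightarrow> (\<forall>i\<in>{1..n}. X \<in> carrier_mat (m n) (p 1) \<and> lv.compatible_at (entry X) i M)"
    unfolding is_solution_def by (intro ball_cong refl)
  \<comment> \<open>The range \<open>{1..n}\<close> is nonempty, so the carrier condition may leave
    the quantifier.\<close>
  also have "\<dots> \<longleftrightarrow> X \<in> carrier_mat (m n) (p 1) \<and> (\<forall>i\<in>{1..n}. lv.compatible_at (entry X) i M)"
    using n by fastforce
  finally show ?thesis unfolding lv.compatible_at_all_iff_solves .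
qed

lemma L_le_antimono: "i \<le> j \<Longrightarrow> j \<le> n \<Longrightarrow> L j \<subseteq> L i"
proof (induction j rule: dec_induct)
  case (step j)
  then show ?case using L_facts(3)[of j] by auto
qed simp

text \<open>Because \<open>L n\<close> is empty, \<open>L i\<close> is the union of the sets
  \<open>J_set L j\<close> with \<open>j > i\<close>; so the strictly upper blocks contain exactly
  the free entries.\<close>

lemma upper_blocks_iff:
  assumes X: "X \<in> carrier_mat (m n) (p 1)" and F: "F \<in> carrier_mat (m n) (p 1)"
  shows "(\<forall>i j. 1 \<le> i \<and> i < j \<and> j \<le> n \<longrightarrow>
        submatrix X (I_set K i) (J_set L j) = submatrix F (I_set K i) (J_set L j))
    \<longleftrightarrow> (\<forall>k\<in>M. \<forall>l\<in>free_cols k. entry X k l = entry F k l)"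
proof -
  have sub: "submatrix X (I_set K i) (J_set L j) = submatrix F (I_set K i) (J_set L j) \<longleftrightarrow>
      (\<forall>k\<in>I_set K i. \<forall>l\<in>J_set L j. X $$ (k, l) = F $$ (k, l))" if "i < j" "j \<le> n" for i j
  proof (rule submatrix_eq_iff[OF X F])
    show "I_set K i \<subseteq> {..<m n}" using that by (intro I_set_subset) simp
    have "L (j - 1) \<subseteq> {..<p 1}" using that by (intro L_facts) simp
    then show "J_set L j \<subseteq> {..<p 1}" by (auto simp: J_set_def)
  qed
  show ?thesis
  proof (intro iffI allI impI ballI)
    fix k l
    assume *: "\<forall>i j. 1 \<le> i \<and> i < j \<and> j \<le> n \<longrightarrow>
        submatrix X (I_set K i) (J_set L j) = submatrix F (I_set K i) (J_set L j)"
      and k: "k \<in> M" and l: "l \<in> free_cols k"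
    define i where "i = lv.level k"
    have i: "1 \<le> i" "i \<le> n" using lv.level(1)[OF k] by (auto simp: i_def)
    obtain a b where ab: "k = (n, a)" "l = (1, b)" "b \<in> L i" using k l by (auto simp: M_def i_def)
    have a: "a \<in> I_set K i" using lv.level(2)[OF k, folded i_def] ab(1) by (simp add: I_set_def)
    \<comment> \<open>The column \<open>b\<close> leaves the decreasing chain at \<open>j\<close>,
      so \<open>j\<close> is the number of its block.\<close>
    define j where "j = (LEAST j. b \<notin> L j)"
    have "b \<notin> L n" by (simp add: L_facts)
    then have j: "b \<notin> L j" "j \<le> n"
      unfolding j_def by (rule LeastI[of "\<lambda>j. b \<notin> L j"], rule Least_le[of "\<lambda>j. b \<notin> L j"])
    have ij: "i < j"
    proof (rule ccontr)
      assume "\<not> i < j"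
      then show False using L_le_antimono[of j i] i ab(3) j(1) by auto
    qed
    have "b \<in> L (j - 1)" using not_less_Least[of "j - 1" "\<lambda>j. b \<notin> L j"] ij unfolding j_def by auto
    then have "b \<in> J_set L j" using j by (simp add: J_set_def)
    then show "entry X k l = entry F k l"
      using * sub[OF ij j(2)] i(1) ij j(2) a by (auto simp: entry_def ab)
  next
    fix i j
    assume *: "\<forall>k\<in>M. \<forall>l\<in>free_cols k. entry X k l = entry F k l" and ij: "1 \<le> i \<and> i < j \<and> j \<le> n"
    have "X $$ (a, b) = F $$ (a, b)" if a: "a \<in> I_set K i" and b: "b \<in> J_set L j" for a b
    proof -
      have "lv.level (n, a) = i" using ij a by (intro lv.level_eq) (auto simp: I_set_def)
      moreover have "(n, a) \<in> M" using a I_set_subset[of i] ij by (auto simp: M_def)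
      moreover have "L (j - 1) \<subseteq> L i" by (rule L_le_antimono) (use ij in auto)
      then have "b \<in> L i" using b by (auto simp: J_set_def)
      ultimately show ?thesis using * by (fastforce simp: entry_def)
    qed
    then show "submatrix X (I_set K i) (J_set L j) = submatrix F (I_set K i) (J_set L j)"
      using sub ij by blast
  qed
qed

text \<open>The steps together express compatibility on \<open>K i\<close> at every level
  \<open>i\<close>, which \<open>compatible_at_all_iff\<close> upgrades to compatibility on all
  rows.\<close>

lemma construction_output_iff:
  assumes F: "F \<in> carrier_mat (m n) (p 1)"
  shows "construction_output n m p A L K F X \<longleftrightarrow> X \<in> carrier_mat (m n) (p 1) \<and>
    (\<forall>k\<in>M. \<forall>l\<in>free_cols k. entry X k l = entry F k l) \<and> lv.solves inhom (entry X)"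
proof (cases "X \<in> carrier_mat (m n) (p 1)")
  case True
  have "(\<forall>i\<in>{1..n}. \<forall>Y. is_arg_min (\<lambda>Y. mrank (step_mat n m p A L K X i Y))
          (\<lambda>Y. Y \<in> carrier_mat (card (I_set K i)) (card (L_bar L i))) Y
        \<longleftrightarrow> Y = submatrix X (I_set K i) (L_bar L i))
      \<longleftrightarrow> (\<forall>i\<in>{1..n}. lv.compatible_at (entry X) i ({n} \<times> K i))"
    by (intro ball_cong refl step_iff_cond[OF True])
  also have "\<dots> \<longleftrightarrow> lv.solves inhom (entry X)"
    unfolding lv.compatible_at_all_iff[symmetric] lv.compatible_at_all_iff_solves ..
  finally show ?thesis
    unfolding construction_output_def upper_blocks_iff[OF True F] by (rule conj_cong[OF refl conj_cong[OF refl]])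
qed (simp add: construction_output_def)

section \<open>The solution set as an affine space and its dimension\<close>

lemma affine_solutions:
  "affine_space_of_dim (m n) (p 1) {X. is_solution n m p A X} (int (card (SIGMA k:M. free_cols k)))"
proof -
  let ?C = "carrier_mat (m n) (p 1) :: 'a mat set"
  define W where "W = {X \<in> ?C. lv.solves (\<lambda>_ _. 0) (entry X)}"
  define Fr where "Fr = (SIGMA k:M. free_cols k)"
  define d where "d = card Fr"
  have "finite Fr" unfolding Fr_def using lv.level(1) finite_LK by (intro finite_SigmaI) auto
  then obtain h where h: "bij_betw h {0..<d} Fr" unfolding d_def using ex_bij_betw_nat_finite by blast
  have hF: "fst (h t) \<in> M" "snd (h t) \<in> free_cols (fst (h t))" if "t < d" for t
  proof -
    have "h t \<in> Fr" using bij_betwE[OF h] that by simp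
    then show "fst (h t) \<in> M" "snd (h t) \<in> free_cols (fst (h t))"
      unfolding Fr_def by (cases "h t", simp)+
  qed
  define h' where "h' = inv_into {0..<d} h"
  have h': "h' (k, l) < d" "h (h' (k, l)) = (k, l)" if "k \<in> M" "l \<in> free_cols k" for k l
  proof -
    have "(k, l) \<in> h ` {0..<d}" using h that by (auto simp: bij_betw_def Fr_def)
    then show "h' (k, l) < d" "h (h' (k, l)) = (k, l)"
      unfolding h'_def using inv_into_into[of "(k, l)" h "{0..<d}"] f_inv_into_f[of "(k, l)" h "{0..<d}"] by simp_all
  qed
  have uniq: "X = Y" if "X \<in> W" "Y \<in> W"
    "\<And>t. t < d \<Longrightarrow> entry X (fst (h t)) (snd (h t)) = entry Y (fst (h t)) (snd (h t))" for X Y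
  proof (rule solves_matrix_unique)
    fix k l assume "k \<in> M" "l \<in> free_cols k"
    from h'[OF this] show "entry X k l = entry Y k l" using that(3)[of "h' (k, l)"] by simp
  qed (use that in \<open>auto simp: W_def\<close>)
  have ex: "\<exists>X. X \<in> W \<and> (\<forall>t<d. entry X (fst (h t)) (snd (h t)) = v $ t)" for v
  proof -
    obtain X where X: "X \<in> ?C" "\<And>k l. k \<in> M \<Longrightarrow> l \<in> free_cols k \<Longrightarrow> entry X k l = v $ h' (k, l)"
      "lv.solves (\<lambda>_ _. 0) (entry X)"
      using solves_matrix_exists[of "\<lambda>k l. v $ h' (k, l)" "\<lambda>_ _. 0"] by blast
    have "entry X (fst (h t)) (snd (h t)) = v $ t" if t: "t < d" for t
      using X(2)[OF hF[OF t]] h t by (simp add: h'_def bij_betw_inv_into_left[OF h])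
    then show ?thesis using X by (auto simp: W_def)
  qed
  \<comment> \<open>\<open>T v\<close> is the homogeneous solution whose free entries, enumerated by
    \<open>h\<close>, are those of \<open>v\<close>. Although it is defined by choice,
    \<open>uniq\<close> determines it and makes it linear.\<close>
  define T where "T v = (SOME X. X \<in> W \<and> (\<forall>t<d. entry X (fst (h t)) (snd (h t)) = v $ t))" for v
  have T: "T v \<in> W" "\<And>t. t < d \<Longrightarrow> entry (T v) (fst (h t)) (snd (h t)) = v $ t" for v
    using someI_ex[OF ex[of v]] unfolding T_def[symmetric] by auto
  have WC: "W \<subseteq> ?C" by (auto simp: W_def)
  have entry_add: "entry (X + Y) k l = entry X k l + entry Y k l"
    and entry_smult: "entry (a \<cdot>\<^sub>m Y) k l = a * entry Y k l"
    if "Y \<in> ?C" "k \<in> M" "l \<in> N" for X Y a k l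
    using that by (auto simp: entry_def M_def N_def)
  have hN: "snd (h t) \<in> N" if "t < d" for t
    by (rule subsetD[OF free_cols_subset[OF hF(1)[OF that]] hF(2)[OF that]])
  have add: "lv.solves (\<lambda>k l. c k l + c' k l) (entry (X + Y))"
    if "X \<in> ?C" "Y \<in> ?C" "lv.solves c (entry X)" "lv.solves c' (entry Y)" for X Y c c'
  proof -
    have "lv.solves (\<lambda>k l. c k l + c' k l) (entry (X + Y)) \<longleftrightarrow>
        lv.solves (\<lambda>k l. c k l + c' k l) (\<lambda>k l. entry X k l + entry Y k l)"
      using entry_add that(2) by (intro lv.solves_cong) auto
    then show ?thesis using lv.solves_add[OF that(3,4)] by simp
  qed
  have smult: "lv.solves (\<lambda>k l. a * c k l) (entry (a \<cdot>\<^sub>m X))"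
    if "X \<in> ?C" "lv.solves c (entry X)" for X c a
  proof -
    have "lv.solves (\<lambda>k l. a * c k l) (entry (a \<cdot>\<^sub>m X)) \<longleftrightarrow>
        lv.solves (\<lambda>k l. a * c k l) (\<lambda>k l. a * entry X k l)"
      using entry_smult that(1) by (intro lv.solves_cong) auto
    then show ?thesis using lv.solves_scale[OF that(2)] by simp
  qed
  have T_add: "T (u + v) = T u + T v" if "u \<in> carrier_vec d" "v \<in> carrier_vec d" for u v
  proof (rule uniq)
    show "T u + T v \<in> W"
      using T(1)[of u] T(1)[of v] add[of "T u" "T v" "\<lambda>_ _. 0" "\<lambda>_ _. 0"] by (auto simp: W_def)
    fix t assume t: "t < d"
    show "entry (T (u + v)) (fst (h t)) (snd (h t)) = entry (T u + T v) (fst (h t)) (snd (h t))"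
      using T(2)[OF t] T(1)[of v] WC hF[OF t] hN[OF t] t that by (subst entry_add) auto
  qed (rule T)
  have T_smult: "T (a \<cdot>\<^sub>v v) = a \<cdot>\<^sub>m T v" if "v \<in> carrier_vec d" for a v
  proof (rule uniq)
    show "a \<cdot>\<^sub>m T v \<in> W"
      using T(1)[of v] smult[of "T v" "\<lambda>_ _. 0" a] by (auto simp: W_def)
    fix t assume t: "t < d"
    show "entry (T (a \<cdot>\<^sub>v v)) (fst (h t)) (snd (h t)) = entry (a \<cdot>\<^sub>m T v) (fst (h t)) (snd (h t))"
      using T(2)[OF t] T(1)[of v] WC hF[OF t] hN[OF t] t that by (subst entry_smult) auto
  qed (rule T)
  interpret V: vec_space "TYPE('a)" d .
  interpret W: vectorspace class_ring "module_mat TYPE('a) (m n) (p 1)" by (rule matrix_vs)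
  interpret lm: linear_map class_ring "module_vec TYPE('a) d" "module_mat TYPE('a) (m n) (p 1)" T
  proof (intro linear_map.intro mod_hom.intro mod_hom_axioms.intro)
    show "vectorspace class_ring (module_mat TYPE('a) (m n) (p 1))" by (rule matrix_vs)
    show "Module.module class_ring (module_mat TYPE('a) (m n) (p 1))" by (rule W.module_axioms)
    show "T \<in> LinearCombinations.module_hom class_ring (module_vec TYPE('a) d) (module_mat TYPE('a) (m n) (p 1))"
      unfolding LinearCombinations.module_hom_def using T(1) WC T_add T_smult by (auto simp: module_vec_simps module_mat_simps)
  qed (rule V.vectorspace_axioms V.module_axioms)+
  have im: "lm.imT = W"
  proof -
    have "W \<subseteq> T ` carrier_vec d"
    proof
      fix X assume X: "X \<in> W"
      define v where "v = vec d (\<lambda>t. entry X (fst (h t)) (snd (h t)))"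
      have "T v = X"
        using T(2)[of _ v] by (intro uniq T(1) X) (simp add: v_def)
      moreover have "v \<in> carrier_vec d" by (simp add: v_def)
      ultimately show "X \<in> T ` carrier_vec d" by blast
    qed
    moreover have "T ` carrier_vec d \<subseteq> W" using T(1) by blast
    ultimately show ?thesis by (simp add: lm.im_def)
  qed
  have inj: "inj_on T (carrier (module_vec TYPE('a) d))"
  proof (rule inj_onI)
    fix u v assume uv: "u \<in> carrier (module_vec TYPE('a) d)" "v \<in> carrier (module_vec TYPE('a) d)" "T u = T v"
    show "u = v"
      using uv T(2)[of _ u] T(2)[of _ v] by (intro eq_vecI) (auto simp: module_vec_simps)
  qed
  \<comment> \<open>\<open>T\<close> is injective with image \<open>W\<close>, so rank and nullity
    give the dimension \<open>d\<close> of its domain.\<close>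
  have dimW: "vectorspace.dim class_ring ((module_mat TYPE('a) (m n) (p 1))\<lparr>carrier := W\<rparr>) = d"
    using lm.rank_nullity lm.inj_imp_dim_ker0[OF inj] V.dim_is_n V.fin_dim unfolding im by simp
  have subW: "VectorSpace.subspace class_ring W (module_mat TYPE('a) (m n) (p 1))"
    using lm.imT_is_subspace unfolding im .
  obtain X0 where X0: "X0 \<in> ?C" "lv.solves inhom (entry X0)"
    using solves_matrix_exists by blast
  have sol: "{X. is_solution n m p A X} = (\<lambda>Y. X0 + Y) ` W"
  proof (intro subset_antisym subsetI)
    fix X assume "X \<in> {X. is_solution n m p A X}"
    then have X: "X \<in> ?C" "lv.solves inhom (entry X)" by (auto simp: is_solution_iff)
    \<comment> \<open>The difference is written as a sum with a multiple, so that \<open>add\<close>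
      and \<open>smult\<close> apply; the constant terms cancel.\<close>
    have "lv.solves (\<lambda>k l. inhom k l + (-1) * inhom k l) (entry (X + (-1) \<cdot>\<^sub>m X0))"
      using X X0 smult[OF X0, of "-1"] by (intro add) auto
    then have "X + (-1) \<cdot>\<^sub>m X0 \<in> W" using X X0 by (simp add: W_def)
    moreover have "X = X0 + (X + (-1) \<cdot>\<^sub>m X0)" using X X0 by (intro eq_matI) auto
    ultimately show "X \<in> (\<lambda>Y. X0 + Y) ` W" by blast
  next
    fix X assume "X \<in> (\<lambda>Y. X0 + Y) ` W"
    then obtain Y where Y: "Y \<in> W" "X = X0 + Y" by blast
    then show "X \<in> {X. is_solution n m p A X}"
      using add[of X0 Y inhom "\<lambda>_ _. 0"] X0 by (auto simp: is_solution_iff W_def)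
  qed
  show ?thesis
    unfolding affine_space_of_dim_def Fr_def[symmetric] d_def[symmetric]
    using dimW by (intro bexI[of _ X0] exI[of _ W] conjI subW sol X0(1)) simp
qed

text \<open>The two ranks belong to level \<open>i + 1\<close>, whose row basis is
  \<open>K i\<close>; since the levels end at \<open>n\<close>, the index stays below
  \<open>n\<close>. For \<open>i = 0\<close> the convention \<open>alpha = 0\<close> matches the
  empty \<open>K 0\<close>.\<close>

lemma alpha_eq:
  assumes "i < n"
  shows "alpha n m p A i = int (card (K i))"
proof (cases "i = 0")
  case True
  then show ?thesis by (simp add: alpha_def K_facts)
next
  case False
  then have i: "Suc i \<in> {1..n}" using assms by simp
  have "mrank (blocks m p [Suc i..<Suc n] [2..<Suc (Suc i)] A) =
      rk E0 (SIGMA k:set [Suc i..<Suc n]. {..<m k}) (SIGMA j:set [2..<Suc (Suc i)]. {..<p j})"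
    by (rule mrank_blocks) auto
  moreover have "(SIGMA k:set [Suc i..<Suc n]. {..<m k}) = P (Suc i) \<union> M"
    using assms by (auto simp: P_def M_def)
  moreover have "mrank (blocks m p [Suc i..<n] [2..<Suc (Suc i)] A) =
      rk E0 (SIGMA k:set [Suc i..<n]. {..<m k}) (SIGMA j:set [2..<Suc (Suc i)]. {..<p j})"
    by (rule mrank_blocks) auto
  moreover have "(SIGMA k:set [Suc i..<n]. {..<m k}) = P (Suc i)" "(SIGMA j:set [2..<Suc (Suc i)]. {..<p j}) = Q (Suc i)"
    by (auto simp: P_def Q_def)
  ultimately show ?thesis
    using lv.rk_rows[OF i] False by (simp add: alpha_def card_cartesian_product_singleton)
qed

lemma beta_eq:
  assumes "j \<in> {1..n}"
  shows "beta n m p A j = int (card (L j))"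
proof -
  have "mrank (blocks m p [j..<n] [1..<Suc j] A) =
      rk E0 (SIGMA k:set [j..<n]. {..<m k}) (SIGMA i:set [1..<Suc j]. {..<p i})"
    by (rule mrank_blocks) auto
  moreover have "(SIGMA i:set [1..<Suc j]. {..<p i}) = N \<union> Q j"
    using assms by (auto simp: Q_def N_def not_less_eq_eq)
  moreover have "mrank (blocks m p [j..<n] [2..<Suc j] A) =
      rk E0 (SIGMA k:set [j..<n]. {..<m k}) (SIGMA i:set [2..<Suc j]. {..<p i})"
    by (rule mrank_blocks) auto
  moreover have "(SIGMA k:set [j..<n]. {..<m k}) = P j" "(SIGMA i:set [2..<Suc j]. {..<p i}) = Q j"
    by (auto simp: P_def Q_def)
  ultimately show ?thesis
    using lv.rk_cols[OF assms] by (simp add: beta_def card_cartesian_product_singleton)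
qed

lemma affine_solutions_alpha_beta:
  "affine_space_of_dim (m n) (p 1) {X. is_solution n m p A X}
      (\<Sum>(i, j) | 1 \<le> i \<and> i < j \<and> j \<le> n.
         (alpha n m p A i - alpha n m p A (i - 1)) * (beta n m p A (j - 1) - beta n m p A j))"
proof -
  have "(\<Sum>(i, j) | 1 \<le> i \<and> i < j \<and> j \<le> n.
         (alpha n m p A i - alpha n m p A (i - 1)) * (beta n m p A (j - 1) - beta n m p A j))
    = int (card (SIGMA k:M. free_cols k))"
    unfolding lv.card_free
  proof (intro sum.cong refl, clarify)
    fix i j assume "1 \<le> i" "i < j" "j \<le> n"
    then have "i < n" "i - 1 < n" "j - 1 \<in> {1..n}" "j \<in> {1..n}" by auto
    then show "(alpha n m p A i - alpha n m p A (i - 1)) * (beta n m p A (j - 1) - beta n m p A j) =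
        (int (card ({n} \<times> K i)) - int (card ({n} \<times> K (i - 1)))) *
        (int (card ({1::nat} \<times> L (j - 1))) - int (card ({1::nat} \<times> L j)))"
      by (simp only: alpha_eq beta_eq card_cartesian_product_singleton)
  qed
  then show ?thesis using affine_solutions by simp
qed

lemma construction_ex1:
  assumes F: "F \<in> carrier_mat (m n) (p 1)"
  shows "\<exists>!X. construction_output n m p A L K F X"
proof -
  obtain X where "X \<in> carrier_mat (m n) (p 1)" "\<forall>k\<in>M. \<forall>l\<in>free_cols k. entry X k l = entry F k l"
    "lv.solves inhom (entry X)"
    using solves_matrix_exists[of "entry F" inhom] by blast
  then show ?thesis
    unfolding construction_output_iff[OF F] by (intro ex1I[of _ X] solves_matrix_unique[of _ X inhom]) auto
qed

lemma is_solution_iff_output: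
  "is_solution n m p A X \<longleftrightarrow> (\<exists>F\<in>carrier_mat (m n) (p 1). construction_output n m p A L K F X)"
  unfolding is_solution_iff using construction_output_iff by blast

end

theorem theorem5:
  fixes n :: nat and m p :: "nat \<Rightarrow> nat" and A :: "nat \<Rightarrow> nat \<Rightarrow> 'a::field mat"
  assumes "n \<ge> 2"
    and "\<And>i j. 1 \<le> j \<Longrightarrow> j \<le> i \<Longrightarrow> i \<le> n \<Longrightarrow> (i, j) \<noteq> (n, 1) \<Longrightarrow> A i j \<in> carrier_mat (m i) (p j)"
  shows "(\<exists>X. is_solution n m p A X) \<and>
    (\<exists>L. col_choice n m p A L) \<and> (\<exists>K. row_choice n m p A K) \<and>
    (\<forall>L K. col_choice n m p A L \<longrightarrow> row_choice n m p A K \<longrightarrow>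
       (\<forall>F\<in>carrier_mat (m n) (p 1). \<exists>!X. construction_output n m p A L K F X) \<and>
       (\<forall>X. is_solution n m p A X \<longleftrightarrow>
          (\<exists>F\<in>carrier_mat (m n) (p 1). construction_output n m p A L K F X))) \<and>
    affine_space_of_dim (m n) (p 1) {X. is_solution n m p A X}
      (\<Sum>(i, j) | 1 \<le> i \<and> i < j \<and> j \<le> n.
         (alpha n m p A i - alpha n m p A (i - 1)) * (beta n m p A (j - 1) - beta n m p A j))"
proof -
  interpret completion n m p A using assms by unfold_locales
  obtain L K where L: "col_choice n m p A L" and K: "row_choice n m p A K"
    using col_choice_exists row_choice_exists by blast
  \<comment> \<open>Solvability and dimension do not mention index sets, so one choice serves for
    them; the statement about outputs is proved below for arbitrary choices.\<close>
  interpret index_choice n m p A L K using L K by unfold_locales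
  have "\<exists>X. is_solution n m p A X"
    using solves_matrix_exists[of "\<lambda>_ _. 0" inhom] is_solution_iff by blast
  moreover have "(\<forall>F\<in>carrier_mat (m n) (p 1). \<exists>!X. construction_output n m p A L K F X) \<and>
       (\<forall>X. is_solution n m p A X \<longleftrightarrow>
          (\<exists>F\<in>carrier_mat (m n) (p 1). construction_output n m p A L K F X))"
    if "col_choice n m p A L" "row_choice n m p A K" for L K
  proof -
    interpret any: index_choice n m p A L K using that by unfold_locales
    show ?thesis using any.construction_ex1 any.is_solution_iff_output by blast
  qed
  ultimately show ?thesis
    using L K affine_solutions_alpha_beta by blast
qed

end
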